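(* Consider the following six assertions. (C1) For all $n\ge 2$, $m\ge 1$ and all $B_1,\dots,B_m\in M(n,\mathbb{R})$ with $\operatorname{Tr}(B_\alpha[B_\gamma,B_\beta])=0$ for all $1\le\alpha,\beta,\gamma\le m$, one has $\sum_{\alpha,\beta=1}^m\|[B_\alpha,B_\beta]\|^2\le\left(\sum_{\alpha=1}^m\|B_\alpha\|^2\right)^2$. (C2) For all $n\ge2$, $m\ge 2$ and all $B,B_2,\dots,B_m\in M(n,\mathbb{R})$ such that $\operatorname{Tr}(B_\alpha B_\beta^* )=0$ for all $2\le\alpha\ne\beta\le m$ and $\operatorname{Tr}(B_\alpha[B,B_\beta])=0$ for all $2\le\alpha,\beta\le m$, one has $$\sum_{\alpha=2}^m\|[B,B_\alpha]\|^2\le\left(\max_{2\le\alpha\le m}\|B_\alpha\|^2+\sum_{\alpha=2}^m\|B_\alpha\|^2\right)\|B\|^2.$$ (C3) For all $n\ge2$ and $X\in M(n,\mathbb{R})$ with $\|X\|=1$, one has $\lambda_1(T_X)+\lambda_3(T_X)\le3$. (C4) For all $n\ge2$ and $X\in M(n,\mathbb{R})$ with $\|X\|=1$, one has $\sum_{i=1}^{2k}\lambda_i(T_X)\le 2k+2$ for every $k=1,\dots,\lfloor n^2/2\rfloor$. (C5) For all $n\ge2$ and $X\in M(n,\mathbb{R})$ with $\|X\|=1$, the family of eigenvalues $\lambda(T_X)$ is weakly majorized by the multiset $\{2^{2},1^{2n-4},0^{(n-1)^2+1}\}$. (C6) For all $n\ge2$, $m\ge2$ and all $B,B_2,\dots,B_m\in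 M(n,\mathbb{R})$ with $\operatorname{Tr}(B_\alpha B_\beta^* )=0$ for all $2\le\alpha\ne\beta\le m$, one has $$\sum_{\alpha=2}^m\|[B,B_\alpha]\|^2\le\left(2\max_{2\le\alpha\le m}\|B_\alpha\|^2+\sum_{\alpha=2}^m\|B_\alpha\|^2\right)\|B\|^2.$$ Then: (1) The assertions (C2), (C4), (C5) and (C6) are equivalent to each other. (2) If one of (C2), (C4), (C5), (C6) is true, then (C1) and (C3) hold.
   Context: $M(n,\mathbb{R})$ is the space of real $n\times n$ matrices, $X^*$ is the (conjugate) transpose of $X$, $\|X\|=\sqrt{\operatorname{Tr}XX^*}$ is the Frobenius norm, and $[X,Y]=XY-YX$. For $X\in M(n,\mathbb{R})$, $T_X$ is the linear map on $M(n,\mathbb{R})$ given by $T_X(Y)=[X^*,[X,Y]]$; it is self-adjoint and positive semi-definite, and $\lambda(T_X)=\{\lambda_1(T_X)\ge\lambda_2(T_X)\ge\cdots\ge\lambda_{n^2}(T_X)\}$ denotes its eigenvalues counted with multiplicity in decreasing order. For $x,y\in\mathbb{R}^N$ with decreasing rearrangements $x^\downarrow,y^\downarrow$, $x$ is weakly majorized by $y$ if $\sum_{i=1}^k x_i^\downarrow\le\sum_{i=1}^k y_i^\downarrow$ for all $k=1,\dots,N$. The multiset $\{2^{2},1^{2n-4},0^{(n-1)^2+1}\}$ consists of $n^2$ numbers: $2$ with multiplicity $2$, $1$ with multiplicity $2n-4$, and $0$ with multiplicity $(n-1)^2+1$. *)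

theory Defs
  imports
    Complex_Main
    "HOL-Library.Multiset"
    "Jordan_Normal_Form.Matrix"
    "Jordan_Normal_Form.Char_Poly"
begin

text \<open>
  The assertions quantify over the dimension \<open>n\<close>, so \<open>M(n, \<real>)\<close> is rendered as
  \<open>carrier_mat n n :: real mat set\<close>.  Since all matrices are real, the adjoint is the transpose.
\<close>

definition mtrace :: "real mat \<Rightarrow> real" where
  "mtrace X = (\<Sum>i<dim_row X. X $$ (i, i))"

definition fnorm :: "real mat \<Rightarrow> real" where
  "fnorm X = sqrt (mtrace (X * transpose_mat X))"

definition comm :: "real mat \<Rightarrow> real mat \<Rightarrow> real mat" where
  "comm X Y = X * Y - Y * X"

definition T_op :: "real mat \<Rightarrow> real mat \<Rightarrow> real mat" where
  "T_op X Y = comm (transpose_mat X) (comm X Y)"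

definition unit_matrix :: "nat \<Rightarrow> nat \<Rightarrow> nat \<Rightarrow> real mat" where
  "unit_matrix n k l = mat n n (\<lambda>(i, j). if i = k \<and> j = l then 1 else 0)"

text \<open>
  The matrix of a linear map \<open>F\<close> on \<open>M(n, \<real>)\<close> in the orthonormal basis of matrix units,
  enumerated row by row: the index \<open>p < n * n\<close> stands for the position \<open>(p div n, p mod n)\<close>, and
  column \<open>q\<close> holds the entries of the image under \<open>F\<close> of the \<open>q\<close>-th matrix unit.
\<close>

definition matrix_of_op :: "nat \<Rightarrow> (real mat \<Rightarrow> real mat) \<Rightarrow> real mat" where
  "matrix_of_op n F =
     mat (n * n) (n * n)
       (\<lambda>(p, q). F (unit_matrix n (q div n) (q mod n)) $$ (p div n, p mod n))"

text \<open>
  The eigenvalues counted with (algebraic) multiplicity.  Only real roots are collected; this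
  loses nothing for the self-adjoint maps \<open>T_op X\<close>, where moreover algebraic and geometric
  multiplicities agree.
\<close>

definition eigenvalues_op :: "nat \<Rightarrow> (real mat \<Rightarrow> real mat) \<Rightarrow> real multiset" where
  "eigenvalues_op n F = proots (char_poly (matrix_of_op n F))"

definition decr :: "real multiset \<Rightarrow> real list" where
  "decr M = rev (sorted_list_of_multiset M)"

text \<open>The \<open>i\<close>-th largest eigenvalue of \<open>T_op X\<close>, with \<open>i\<close> counted from \<open>1\<close>.\<close>

definition lam :: "nat \<Rightarrow> real mat \<Rightarrow> nat \<Rightarrow> real" where
  "lam n X i = decr (eigenvalues_op n (T_op X)) ! (i - 1)"

text \<open>
  Weak majorization only depends on decreasing rearrangements, so vectors in \<open>\<real>\<^sup>N\<close> are taken as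
  multisets; the first conjunct says that both have the same number \<open>N\<close> of entries.
\<close>

definition weakly_majorized :: "real multiset \<Rightarrow> real multiset \<Rightarrow> bool" where
  "weakly_majorized M N \<longleftrightarrow>
     size M = size N \<and>
     (\<forall>k\<in>{1..size N}. (\<Sum>i<k. decr M ! i) \<le> (\<Sum>i<k. decr N ! i))"

definition C1 :: bool where
  "C1 \<longleftrightarrow>
     (\<forall>(n::nat) (m::nat) (B :: nat \<Rightarrow> real mat).
        2 \<le> n \<longrightarrow> 1 \<le> m \<longrightarrow>
        (\<forall>\<alpha>\<in>{1..m}. B \<alpha> \<in> carrier_mat n n) \<longrightarrow>
        (\<forall>\<alpha>\<in>{1..m}. \<forall>\<beta>\<in>{1..m}. \<forall>\<gamma>\<in>{1..m}. mtrace (B \<alpha> * comm (B \<gamma>) (B \<beta>)) = 0) \<longrightarrow>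
        (\<Sum>\<alpha>=1..m. \<Sum>\<beta>=1..m. (fnorm (comm (B \<alpha>) (B \<beta>)))\<^sup>2) \<le> (\<Sum>\<alpha>=1..m. (fnorm (B \<alpha>))\<^sup>2)\<^sup>2)"

text \<open>In the next assertion and in the last one, \<open>A \<alpha>\<close> plays the role of \<open>B\<^sub>\<alpha>\<close> for \<open>2 \<le> \<alpha> \<le> m\<close>.\<close>

definition C2 :: bool where
  "C2 \<longleftrightarrow>
     (\<forall>(n::nat) (m::nat) (B :: real mat) (A :: nat \<Rightarrow> real mat).
        2 \<le> n \<longrightarrow> 2 \<le> m \<longrightarrow>
        B \<in> carrier_mat n n \<longrightarrow>
        (\<forall>\<alpha>\<in>{2..m}. A \<alpha> \<in> carrier_mat n n) \<longrightarrow>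
        (\<forall>\<alpha>\<in>{2..m}. \<forall>\<beta>\<in>{2..m}. \<alpha> \<noteq> \<beta> \<longrightarrow> mtrace (A \<alpha> * transpose_mat (A \<beta>)) = 0) \<longrightarrow>
        (\<forall>\<alpha>\<in>{2..m}. \<forall>\<beta>\<in>{2..m}. mtrace (A \<alpha> * comm B (A \<beta>)) = 0) \<longrightarrow>
        (\<Sum>\<alpha>=2..m. (fnorm (comm B (A \<alpha>)))\<^sup>2)
          \<le> (Max ((\<lambda>\<alpha>. (fnorm (A \<alpha>))\<^sup>2) ` {2..m}) + (\<Sum>\<alpha>=2..m. (fnorm (A \<alpha>))\<^sup>2)) * (fnorm B)\<^sup>2)"

definition C3 :: bool where
  "C3 \<longleftrightarrow>
     (\<forall>(n::nat) (X :: real mat).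
        2 \<le> n \<longrightarrow> X \<in> carrier_mat n n \<longrightarrow> fnorm X = 1 \<longrightarrow>
        lam n X 1 + lam n X 3 \<le> 3)"

definition C4 :: bool where
  "C4 \<longleftrightarrow>
     (\<forall>(n::nat) (X :: real mat).
        2 \<le> n \<longrightarrow> X \<in> carrier_mat n n \<longrightarrow> fnorm X = 1 \<longrightarrow>
        (\<forall>k\<in>{1..n\<^sup>2 div 2}. (\<Sum>i=1..2 * k. lam n X i) \<le> 2 * real k + 2))"

definition C5 :: bool where
  "C5 \<longleftrightarrow>
     (\<forall>(n::nat) (X :: real mat).
        2 \<le> n \<longrightarrow> X \<in> carrier_mat n n \<longrightarrow> fnorm X = 1 \<longrightarrow>
        weakly_majorized (eigenvalues_op n (T_op X))
          (replicate_mset 2 2 + replicate_mset (2 * n - 4) 1 + replicate_mset ((n - 1)\<^sup>2 + 1) 0))"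

definition C6 :: bool where
  "C6 \<longleftrightarrow>
     (\<forall>(n::nat) (m::nat) (B :: real mat) (A :: nat \<Rightarrow> real mat).
        2 \<le> n \<longrightarrow> 2 \<le> m \<longrightarrow>
        B \<in> carrier_mat n n \<longrightarrow>
        (\<forall>\<alpha>\<in>{2..m}. A \<alpha> \<in> carrier_mat n n) \<longrightarrow>
        (\<forall>\<alpha>\<in>{2..m}. \<forall>\<beta>\<in>{2..m}. \<alpha> \<noteq> \<beta> \<longrightarrow> mtrace (A \<alpha> * transpose_mat (A \<beta>)) = 0) \<longrightarrow>
        (\<Sum>\<alpha>=2..m. (fnorm (comm B (A \<alpha>)))\<^sup>2)
          \<le> (2 * Max ((\<lambda>\<alpha>. (fnorm (A \<alpha>))\<^sup>2) ` {2..m}) + (\<Sum>\<alpha>=2..m. (fnorm (A \<alpha>))\<^sup>2)) * (fnorm B)\<^sup>2)"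

end

theory Submission
  imports Defs "HOL-Analysis.Function_Topology"
begin

text \<open>
  Fix \<open>B\<close> and send \<open>Y\<close> to \<open>J Y = [B, Y]\<^sup>T\<close>.  Cyclicity of the trace gives
  \<open>\<langle>Y, J Z\<rangle> = Tr (Y [B, Z]) = - \<langle>J Y, Z\<rangle>\<close>, so \<open>J\<close> is skew-symmetric for the Frobenius inner product,
  and \<open>J\<^sup>T J = - J\<^sup>2\<close> is exactly \<open>T_op B\<close>.  Everything about the spectrum of \<open>T_op B\<close> is read off from
  the real normal form of \<open>J\<close> (\<open>skew_basis_exists\<close>): an orthonormal basis in which \<open>J\<close> is a direct sum
  of blocks with entries \<open>s\<^sub>i\<close> and \<open>- s\<^sub>i\<close>, plus a zero if the dimension is odd.  Hence the positive
  eigenvalues \<open>s\<^sub>i\<^sup>2\<close> of \<open>T_op B\<close> come in pairs.  The condition \<open>Tr (B\<^sub>\<alpha> [B, B\<^sub>\<beta>]) = 0\<close> says that the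
  span of the \<open>B\<^sub>\<alpha>\<close> is isotropic for \<open>J\<close>.

  Because of the pairs, the bounds on even partial sums of eigenvalues in \<open>C4\<close> interpolate to a bound
  \<open>k + 2\<close> on every partial sum.  Together with the estimate \<open>Tr (T_op B) \<le> 2 n \<parallel>B\<parallel>\<^sup>2\<close> for the long sums,
  this is \<open>C5\<close>, while \<open>C3\<close> is half of the case \<open>k = 2\<close>.

  By Ky Fan's inequality the largest value of \<open>\<Sum>\<parallel>J u\<parallel>\<^sup>2\<close> over orthonormal sets of \<open>k\<close> elements is the sum
  of the \<open>k\<close> largest eigenvalues; over isotropic ones it is half the sum of the \<open>2 k\<close> largest
  (\<open>isotropic_ky_fan\<close>), attained by taking one vector from each block.  So \<open>C6\<close> and \<open>C2\<close> for orthonormal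
  families are the bounds \<open>k + 2\<close> and \<open>k + 1\<close> on these two maxima, both equivalent to \<open>C4\<close>.
  Arbitrary norms cost nothing: a weighted sum \<open>\<Sum>b\<^sub>i (t\<^sub>i - 1)\<close> is at most \<open>max b\<close> times the sum of the
  positive terms \<open>t\<^sub>i - 1\<close>, and those indices form an orthonormal family again.

  For \<open>C1\<close>, an orthogonal change of the tuple \<open>(B\<^sub>\<alpha>)\<close> that diagonalizes its Gram matrix changes neither
  side of the inequality nor the hypothesis, so the \<open>B\<^sub>\<alpha>\<close> may be taken orthogonal.  With the
  directions fixed, the left side is a quadratic form in the squared norms.  At a maximum of this form
  on the simplex all rows that belong to positive coordinates give the same value, hence it suffices to
  bound the row of the largest coordinate (\<open>quadratic_form_le_square_sum\<close>), and for that row \<open>C2\<close>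
  applies, the maximum in \<open>C2\<close> being absorbed by the coordinate that the row leaves out.
\<close>

section \<open>Orthonormal sets in a coordinate space\<close>

lemma scalar_prod_self_nonneg: "0 \<le> v \<bullet> v" for v :: "real vec"
  by (simp add: scalar_prod_def sum_nonneg)

lemma scalar_prod_self_eq_0:
  fixes v :: "real vec"
  assumes "v \<in> carrier_vec N" "v \<bullet> v = 0"
  shows "v = 0\<^sub>v N"
proof -
  have "\<forall>i\<in>{0..<N}. v $ i * v $ i = 0"
    using assms by (subst sum_nonneg_eq_0_iff[symmetric]) (auto simp: scalar_prod_def)
  then show ?thesis using assms(1) by (intro eq_vecI) auto
qed

definition orthonormal :: "nat \<Rightarrow> real vec set \<Rightarrow> bool" where
  "orthonormal N U \<longleftrightarrow> finite U \<and> U \<subseteq> carrier_vec N \<and>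
     (\<forall>u\<in>U. \<forall>v\<in>U. u \<bullet> v = (if u = v then 1 else 0))"

lemma orthonormalD:
  assumes "orthonormal N U"
  shows "finite U" "u \<in> U \<Longrightarrow> u \<in> carrier_vec N"
    "u \<in> U \<Longrightarrow> u \<bullet> u = 1" "u \<in> U \<Longrightarrow> v \<in> U \<Longrightarrow> u \<bullet> v = (if u = v then 1 else 0)"
  using assms by (auto simp: orthonormal_def)

lemma orthonormal_empty: "orthonormal N {}"
  by (simp add: orthonormal_def)

lemma orthonormal_insert:
  assumes U: "orthonormal N U" and x: "x \<in> carrier_vec N" "x \<bullet> x = 1" "\<forall>u\<in>U. x \<bullet> u = 0"
  shows "orthonormal N (insert x U)" "x \<notin> U"
proof -
  show "x \<notin> U" using x by force
  have "u \<bullet> x = 0" if "u \<in> U" for u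
    using comm_scalar_prod[OF x(1) orthonormalD(2)[OF U that]] x(3) that by simp
  then show "orthonormal N (insert x U)"
    using U x \<open>x \<notin> U\<close> by (auto simp: orthonormal_def)
qed

lemma orthonormal_Un:
  assumes "orthonormal N U" "orthonormal N V" "\<forall>u\<in>U. \<forall>v\<in>V. u \<bullet> v = 0"
  shows "orthonormal N (U \<union> V)" "U \<inter> V = {}"
proof -
  show *: "U \<inter> V = {}"
  proof (rule ccontr)
    assume "U \<inter> V \<noteq> {}"
    then obtain u where "u \<in> U" "u \<in> V" by blast
    then have "u \<bullet> u = 0" "u \<bullet> u = 1" using assms orthonormalD(3) by blast+
    then show False by simp
  qed
  have vu: "v \<bullet> u = 0" if "u \<in> U" "v \<in> V" for u v
    using comm_scalar_prod[OF orthonormalD(2)[OF assms(1) that(1)] orthonormalD(2)[OF assms(2) that(2)]]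
      assms(3) that by simp
  have "u \<bullet> v = (if u = v then 1 else 0)" if uv: "u \<in> U \<union> V" "v \<in> U \<union> V" for u v
  proof -
    consider "u \<in> U" "v \<in> U" | "u \<in> V" "v \<in> V" | "u \<in> U" "v \<in> V" | "u \<in> V" "v \<in> U"
      using uv by blast
    then show ?thesis
    proof cases
      case 1 then show ?thesis by (rule orthonormalD(4)[OF assms(1)])
    next
      case 2 then show ?thesis by (rule orthonormalD(4)[OF assms(2)])
    next
      case 3
      then have "u \<noteq> v" using * by blast
      then show ?thesis using assms(3) 3 by simp
    next
      case 4
      then have "u \<noteq> v" using * by blast
      then show ?thesis using vu 4 by simp
    qed
  qed
  moreover have "finite (U \<union> V)" "U \<union> V \<subseteq> carrier_vec N"
    using assms(1,2) by (auto simp only: orthonormal_def)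
  ultimately show "orthonormal N (U \<union> V)" by (auto simp only: orthonormal_def)
qed

text \<open>
  The component of \<open>x\<close> orthogonal to the span of \<open>U\<close>, without forming that span: all later facts
  about projections (Bessel, Parseval, extension, Gram-Schmidt) are read off from its inner products.
\<close>

lemma orthonormal_residual:
  assumes U: "orthonormal N U" and x: "x \<in> carrier_vec N"
  shows "\<exists>r\<in>carrier_vec N. (\<forall>u\<in>U. r \<bullet> u = 0) \<and>
    r \<bullet> r = x \<bullet> x - (\<Sum>u\<in>U. (x \<bullet> u)\<^sup>2) \<and>
    (\<forall>y\<in>carrier_vec N. y \<bullet> r = y \<bullet> x - (\<Sum>u\<in>U. (x \<bullet> u) * (y \<bullet> u)))"
proof -
  define r where "r = vec N (\<lambda>i. x $ i - (\<Sum>u\<in>U. (x \<bullet> u) * u $ i))"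
  have r: "r \<in> carrier_vec N" by (simp add: r_def)
  have rdim: "dim_vec r = N" by (simp add: r_def)
  have ri: "r $ i = x $ i - (\<Sum>u\<in>U. (x \<bullet> u) * u $ i)" if "i < N" for i
    using that by (simp add: r_def)
  have *: "y \<bullet> r = y \<bullet> x - (\<Sum>u\<in>U. (x \<bullet> u) * (y \<bullet> u))" if y: "y \<in> carrier_vec N" for y
  proof -
    have "y \<bullet> r = (\<Sum>i<N. y $ i * x $ i) - (\<Sum>i<N. \<Sum>u\<in>U. y $ i * ((x \<bullet> u) * u $ i))"
      by (simp add: scalar_prod_def[of y r] rdim ri atLeast0LessThan right_diff_distrib
          sum_subtractf sum_distrib_left)
    also have "(\<Sum>i<N. \<Sum>u\<in>U. y $ i * ((x \<bullet> u) * u $ i)) = (\<Sum>u\<in>U. \<Sum>i<N. y $ i * ((x \<bullet> u) * u $ i))"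
      by (rule sum.swap)
    also have "\<dots> = (\<Sum>u\<in>U. (x \<bullet> u) * (y \<bullet> u))"
    proof (rule sum.cong[OF refl])
      fix u assume "u \<in> U"
      then have "dim_vec u = N" using orthonormalD(2)[OF U] by auto
      then show "(\<Sum>i<N. y $ i * ((x \<bullet> u) * u $ i)) = (x \<bullet> u) * (y \<bullet> u)"
        by (simp add: scalar_prod_def[of y u] sum_distrib_left atLeast0LessThan mult_ac)
    qed
    also have "(\<Sum>i<N. y $ i * x $ i) = y \<bullet> x"
      using x by (simp add: scalar_prod_def atLeast0LessThan)
    finally show ?thesis .
  qed
  have ru: "r \<bullet> u = 0" if u: "u \<in> U" for u
  proof -
    have uc: "u \<in> carrier_vec N" using orthonormalD(2)[OF U u] .
    have "(\<Sum>v\<in>U. (x \<bullet> v) * (u \<bullet> v)) = (\<Sum>v\<in>U. if v = u then x \<bullet> u else 0)"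
      by (rule sum.cong) (use U u in \<open>auto simp: orthonormal_def\<close>)
    also have "\<dots> = u \<bullet> x"
      using u orthonormalD(1)[OF U] comm_scalar_prod[OF uc x] by simp
    finally show ?thesis using *[OF uc] comm_scalar_prod[OF uc r] by simp
  qed
  have "r \<bullet> r = x \<bullet> r"
    using *[OF r] ru comm_scalar_prod[OF x r] by simp
  then have "r \<bullet> r = x \<bullet> x - (\<Sum>u\<in>U. (x \<bullet> u)\<^sup>2)"
    using *[OF x] by (simp add: power2_eq_square)
  then show ?thesis using r ru * by blast
qed

lemma bessel:
  assumes "orthonormal N U" "x \<in> carrier_vec N"
  shows "(\<Sum>u\<in>U. (x \<bullet> u)\<^sup>2) \<le> x \<bullet> x"
proof -
  obtain r where "r \<in> carrier_vec N" "\<forall>u\<in>U. r \<bullet> u = 0"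
    "r \<bullet> r = x \<bullet> x - (\<Sum>u\<in>U. (x \<bullet> u)\<^sup>2)"
    "\<forall>y\<in>carrier_vec N. y \<bullet> r = y \<bullet> x - (\<Sum>u\<in>U. (x \<bullet> u) * (y \<bullet> u))"
    using orthonormal_residual[OF assms] by blast
  then show ?thesis using scalar_prod_self_nonneg[of r] by linarith
qed

lemma sum_unit_vec_scalar_prod:
  fixes u :: "real vec"
  assumes "u \<in> carrier_vec N"
  shows "(\<Sum>i<N. (unit_vec N i \<bullet> u)\<^sup>2) = u \<bullet> u"
  using assms by (simp add: scalar_prod_def[of u u] atLeast0LessThan power2_eq_square)

text \<open>
  Sum Bessel's inequality over the coordinate vectors: the double sum of squared coordinates counts
  \<open>U\<close> in one order and is at most \<open>N\<close> in the other.
\<close>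

lemma orthonormal_card_le:
  assumes U: "orthonormal N U"
  shows "card U \<le> N"
proof -
  have "real (card U) = (\<Sum>u\<in>U. \<Sum>i<N. (unit_vec N i \<bullet> u)\<^sup>2)"
    using U by (simp add: sum_unit_vec_scalar_prod orthonormalD del: scalar_prod_left_unit)
  also have "\<dots> = (\<Sum>i<N. \<Sum>u\<in>U. (unit_vec N i \<bullet> u)\<^sup>2)" by (rule sum.swap)
  also have "\<dots> \<le> (\<Sum>i<N. 1)"
  proof (rule sum_mono)
    fix i assume "i \<in> {..<N}"
    then show "(\<Sum>u\<in>U. (unit_vec N i \<bullet> u)\<^sup>2) \<le> 1"
      using bessel[OF U, of "unit_vec N i"] by simp
  qed
  finally show ?thesis by simp
qed

lemma normalize_vec:
  fixes r :: "real vec"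
  assumes "r \<in> carrier_vec N" "r \<bullet> r \<noteq> 0"
  shows "((1 / sqrt (r \<bullet> r)) \<cdot>\<^sub>v r) \<bullet> ((1 / sqrt (r \<bullet> r)) \<cdot>\<^sub>v r) = 1"
proof -
  have "r \<bullet> r > 0" using assms scalar_prod_self_nonneg[of r] by linarith
  then show ?thesis using assms(1)
    by (simp add: smult_scalar_prod_distrib[of _ N] scalar_prod_smult_distrib[of _ N] field_simps)
qed

lemma normalize_perp:
  fixes r :: "real vec"
  assumes "orthonormal N U" "r \<in> carrier_vec N" "r \<bullet> r \<noteq> 0" "\<forall>u\<in>U. r \<bullet> u = 0"
  defines "s \<equiv> (1 / sqrt (r \<bullet> r)) \<cdot>\<^sub>v r"
  shows "s \<in> carrier_vec N" "s \<bullet> s = 1" "\<forall>u\<in>U. s \<bullet> u = 0"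
proof -
  show "s \<in> carrier_vec N" using assms(2) by (simp add: s_def)
  show "s \<bullet> s = 1" unfolding s_def by (rule normalize_vec[OF assms(2,3)])
  show "\<forall>u\<in>U. s \<bullet> u = 0"
    using assms(2,4) orthonormalD(2)[OF assms(1)]
    by (simp add: s_def smult_scalar_prod_distrib[of _ N])
qed

text \<open>
  The same double count shows that some coordinate vector has Bessel sum below \<open>1\<close>; its residual
  is nonzero and can be normalized.
\<close>

lemma orthonormal_extend:
  assumes U: "orthonormal N U" and card: "card U < N"
  obtains x where "x \<in> carrier_vec N" "x \<bullet> x = 1" "\<forall>u\<in>U. x \<bullet> u = 0"
proof -
  have "\<exists>i<N. (\<Sum>u\<in>U. (unit_vec N i \<bullet> u)\<^sup>2) < 1"
  proof (rule ccontr)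
    assume "\<not> ?thesis"
    then have ge: "1 \<le> (\<Sum>u\<in>U. (unit_vec N i \<bullet> u)\<^sup>2)" if "i < N" for i
      using that by (meson not_less)
    have "(\<Sum>i<N. 1) \<le> (\<Sum>i<N. \<Sum>u\<in>U. (unit_vec N i \<bullet> u)\<^sup>2)"
      by (intro sum_mono) (simp add: ge del: scalar_prod_left_unit)
    also have "\<dots> = (\<Sum>u\<in>U. \<Sum>i<N. (unit_vec N i \<bullet> u)\<^sup>2)" by (rule sum.swap)
    also have "\<dots> = real (card U)"
      using U by (simp add: sum_unit_vec_scalar_prod orthonormalD del: scalar_prod_left_unit)
    finally show False using card by simp
  qed
  then obtain i where i: "i < N" "(\<Sum>u\<in>U. (unit_vec N i \<bullet> u)\<^sup>2) < 1" by blast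
  obtain r where r: "r \<in> carrier_vec N" "\<forall>u\<in>U. r \<bullet> u = 0"
    "r \<bullet> r = unit_vec N i \<bullet> unit_vec N i - (\<Sum>u\<in>U. (unit_vec N i \<bullet> u)\<^sup>2)"
    "\<forall>y\<in>carrier_vec N.
       y \<bullet> r = y \<bullet> unit_vec N i - (\<Sum>u\<in>U. (unit_vec N i \<bullet> u) * (y \<bullet> u))"
    using orthonormal_residual[OF U unit_vec_carrier] by blast
  have "r \<bullet> r \<noteq> 0" using r(3) i by simp
  then show ?thesis
    using that normalize_perp[OF U r(1) _ r(2)] by blast
qed

text \<open>
  A nonzero residual would extend \<open>U\<close> to more than \<open>N\<close> orthonormal vectors.
\<close>

lemma parseval:
  assumes U: "orthonormal N U" and card: "card U = N"
    and x: "x \<in> carrier_vec N" and y: "y \<in> carrier_vec N"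
  shows "(\<Sum>u\<in>U. (x \<bullet> u) * (y \<bullet> u)) = x \<bullet> y"
proof -
  obtain r where r: "r \<in> carrier_vec N" "\<forall>u\<in>U. r \<bullet> u = 0"
    "r \<bullet> r = x \<bullet> x - (\<Sum>u\<in>U. (x \<bullet> u)\<^sup>2)"
    "\<forall>y\<in>carrier_vec N. y \<bullet> r = y \<bullet> x - (\<Sum>u\<in>U. (x \<bullet> u) * (y \<bullet> u))"
    using orthonormal_residual[OF U x] by blast
  have "r \<bullet> r = 0"
  proof (rule ccontr)
    assume n: "r \<bullet> r \<noteq> 0"
    let ?s = "(1 / sqrt (r \<bullet> r)) \<cdot>\<^sub>v r"
    have "?s \<in> carrier_vec N" "?s \<bullet> ?s = 1" "\<forall>u\<in>U. ?s \<bullet> u = 0"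
      using normalize_perp[OF U r(1) n r(2)] by auto
    from orthonormal_insert[OF U this] have "card (insert ?s U) \<le> N" "?s \<notin> U"
      using orthonormal_card_le by blast+
    then show False using card orthonormalD(1)[OF U] by simp
  qed
  then have "r = 0\<^sub>v N" using scalar_prod_self_eq_0 r by blast
  then show ?thesis using bspec[OF r(4) y] y comm_scalar_prod[OF x y] by simp
qed

text \<open>
  Gram-Schmidt in the form needed later: \<open>U\<close> spans the same space as \<open>G\<close>.  That \<open>G\<close> lies in the span
  of \<open>U\<close> is expressed by equality in Bessel's inequality, and that \<open>U\<close> lies in the span of \<open>G\<close> by the
  inclusion of the orthogonal complements.
\<close>

lemma orthonormal_span:
  assumes "finite G" "G \<subseteq> carrier_vec N"
  shows "\<exists>U. orthonormal N U \<and> card U \<le> card G \<and> (\<forall>g\<in>G. (\<Sum>u\<in>U. (g \<bullet> u)\<^sup>2) = g \<bullet> g) \<and>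
    (\<forall>x\<in>carrier_vec N. (\<forall>g\<in>G. x \<bullet> g = 0) \<longrightarrow> (\<forall>u\<in>U. x \<bullet> u = 0))"
  using assms
proof (induction G)
  case empty
  then show ?case by (intro exI[of _ "{}"]) (auto simp: orthonormal_empty)
next
  case (insert h G)
  then obtain U where U: "orthonormal N U" "card U \<le> card G"
    "\<forall>g\<in>G. (\<Sum>u\<in>U. (g \<bullet> u)\<^sup>2) = g \<bullet> g"
    "\<forall>x\<in>carrier_vec N. (\<forall>g\<in>G. x \<bullet> g = 0) \<longrightarrow> (\<forall>u\<in>U. x \<bullet> u = 0)" by auto
  have h: "h \<in> carrier_vec N" using insert by simp
  obtain r where r: "r \<in> carrier_vec N" "\<forall>u\<in>U. r \<bullet> u = 0"
    "r \<bullet> r = h \<bullet> h - (\<Sum>u\<in>U. (h \<bullet> u)\<^sup>2)"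
    "\<forall>y\<in>carrier_vec N. y \<bullet> r = y \<bullet> h - (\<Sum>u\<in>U. (h \<bullet> u) * (y \<bullet> u))"
    using orthonormal_residual[OF U(1) h] by blast
  show ?case
  proof (cases "r \<bullet> r = 0")
    case True
    show ?thesis
    proof (intro exI[of _ U] conjI)
      show "card U \<le> card (insert h G)" using U(2) insert.hyps by simp
      show "\<forall>g\<in>insert h G. (\<Sum>u\<in>U. (g \<bullet> u)\<^sup>2) = g \<bullet> g" using U(3) r(3) True by simp
    qed (use U(1,4) in blast)+
  next
    case False
    define s where "s = (1 / sqrt (r \<bullet> r)) \<cdot>\<^sub>v r"
    have pos: "r \<bullet> r > 0" using False scalar_prod_self_nonneg[of r] by linarith
    have s: "s \<in> carrier_vec N" "s \<bullet> s = 1" "\<forall>u\<in>U. s \<bullet> u = 0"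
      unfolding s_def using normalize_perp[OF U(1) r(1) False r(2)] by auto
    note ins = orthonormal_insert[OF U(1) s]
    have ys: "y \<bullet> s = (1 / sqrt (r \<bullet> r)) * (y \<bullet> r)" if "y \<in> carrier_vec N" for y
      using that r(1) by (simp add: s_def scalar_prod_smult_distrib[of _ N])
    have sum: "(\<Sum>u\<in>insert s U. (g \<bullet> u)\<^sup>2) = (g \<bullet> s)\<^sup>2 + (\<Sum>u\<in>U. (g \<bullet> u)\<^sup>2)" for g
      using ins(2) orthonormalD(1)[OF U(1)] by simp
    have hr: "h \<bullet> r = r \<bullet> r" using bspec[OF r(4) h] r(3) by (simp add: power2_eq_square)
    have "(h \<bullet> s)\<^sup>2 = r \<bullet> r"
      using pos by (simp add: ys[OF h] hr power_divide power2_eq_square)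
    then have hh: "(\<Sum>u\<in>insert s U. (h \<bullet> u)\<^sup>2) = h \<bullet> h" unfolding sum using r(3) by simp
    have gg: "(\<Sum>u\<in>insert s U. (g \<bullet> u)\<^sup>2) = g \<bullet> g" if "g \<in> G" for g
    proof (rule antisym)
      have g: "g \<in> carrier_vec N" using that insert by auto
      show "(\<Sum>u\<in>insert s U. (g \<bullet> u)\<^sup>2) \<le> g \<bullet> g" by (rule bessel[OF ins(1) g])
      show "g \<bullet> g \<le> (\<Sum>u\<in>insert s U. (g \<bullet> u)\<^sup>2)" unfolding sum using U(3) that by simp
    qed
    have perp: "\<forall>u\<in>insert s U. x \<bullet> u = 0"
      if x: "x \<in> carrier_vec N" "\<forall>g\<in>insert h G. x \<bullet> g = 0" for x
    proof -
      have "\<forall>u\<in>U. x \<bullet> u = 0" using U(4) x by blast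
      then show ?thesis using x bspec[OF r(4) x(1)] by (simp add: ys[OF x(1)])
    qed
    show ?thesis
    proof (intro exI[of _ "insert s U"] conjI)
      show "orthonormal N (insert s U)" by (rule ins(1))
      show "card (insert s U) \<le> card (insert h G)"
        using ins(2) insert.hyps U(2) orthonormalD(1)[OF U(1)] by simp
    qed (use hh gg perp in blast)+
  qed
qed

text \<open>
  Tychonoff for coordinate functions.  Vectors of variable length are not a topological type, so
  compactness arguments take place among functions on the naturals that vanish beyond the dimension.
\<close>

lemma compact_box:
  fixes S :: "nat \<Rightarrow> real set"
  assumes "\<And>i. compact (S i)"
  shows "compact {f. \<forall>i. f i \<in> S i}"
proof -
  have "compactin (product_topology (\<lambda>i. euclidean) UNIV) (PiE UNIV S)"
    using assms by (simp add: compactin_PiE)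
  moreover have "PiE UNIV S = {f. \<forall>i. f i \<in> S i}" by (auto simp: PiE_def Pi_def)
  ultimately show ?thesis by (simp add: euclidean_product_topology)
qed

lemma continuous_on_coordinate: "continuous_on A (\<lambda>f :: nat \<Rightarrow> real. f i)"
  by (rule continuous_on_subset[OF continuous_on_product_coordinates subset_UNIV])

text \<open>
  On the compact set of unit vectors orthogonal to \<open>U\<close> the quadratic form of \<open>M\<close> attains its maximum;
  homogeneity extends the bound to all vectors orthogonal to \<open>U\<close>.
\<close>

lemma rayleigh_max:
  fixes M :: "real mat"
  assumes M: "M \<in> carrier_mat N N" and U: "orthonormal N U" and card: "card U < N"
  shows "\<exists>x\<in>carrier_vec N. x \<bullet> x = 1 \<and> (\<forall>u\<in>U. x \<bullet> u = 0) \<and>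
    (\<forall>y\<in>carrier_vec N. (\<forall>u\<in>U. y \<bullet> u = 0) \<longrightarrow>
       y \<bullet> (M *\<^sub>v y) \<le> (x \<bullet> (M *\<^sub>v x)) * (y \<bullet> y))"
proof -
  define B where "B = {f :: nat \<Rightarrow> real. \<forall>i. f i \<in> (if i < N then {-1..1} else {0})}"
  define C where "C = {f :: nat \<Rightarrow> real. (\<Sum>i<N. f i * f i) = 1} \<inter> (\<Inter>u\<in>U. {f. (\<Sum>i<N. f i * u $ i) = 0})"
  define q where "q = (\<lambda>f. \<Sum>i<N. f i * (\<Sum>j<N. M $$ (i,j) * f j))"
  have "compact B" unfolding B_def by (rule compact_box) auto
  moreover have "closed C"
    unfolding C_def
    by (intro closed_Int closed_INT ballI closed_Collect_eq continuous_intros continuous_on_coordinate)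
  ultimately have comp: "compact (B \<inter> C)" by (rule compact_Int_closed)
  have ipv: "vec N f \<bullet> v = (\<Sum>i<N. f i * v $ i)" if "v \<in> carrier_vec N" for f and v :: "real vec"
    using that by (simp add: scalar_prod_def atLeast0LessThan)
  have ipq: "vec N f \<bullet> (M *\<^sub>v vec N f) = q f" for f
    using M by (simp add: q_def scalar_prod_def atLeast0LessThan)
  have ips: "vec N f \<bullet> vec N f = (\<Sum>i<N. f i * f i)" for f :: "nat \<Rightarrow> real"
    by (simp add: ipv)
  have inC: "(\<lambda>i. if i < N then y $ i else 0) \<in> B \<inter> C"
    if y: "y \<in> carrier_vec N" "y \<bullet> y = 1" "\<forall>u\<in>U. y \<bullet> u = 0" for y
  proof -
    let ?f = "\<lambda>i. if i < N then y $ i else 0"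
    have v: "vec N ?f = y" using y(1) by auto
    have s: "(\<Sum>i<N. ?f i * ?f i) = 1" using ips[of ?f] y v by simp
    have "\<bar>?f i\<bar> \<le> 1" if "i < N" for i
    proof -
      have "?f i * ?f i \<le> (\<Sum>i<N. ?f i * ?f i)"
        by (rule member_le_sum[of i "{..<N}" "\<lambda>i. ?f i * ?f i"]) (use that in auto)
      then show ?thesis unfolding s by (simp add: abs_square_le_1[symmetric] power2_eq_square)
    qed
    then have "?f \<in> B" by (auto simp: B_def abs_le_iff)
    moreover have "(\<Sum>i<N. ?f i * u $ i) = 0" if "u \<in> U" for u
      using ipv[OF orthonormalD(2)[OF U that], of ?f] v y(3) that by simp
    ultimately show ?thesis using s by (auto simp: C_def)
  qed
  obtain x0 where "x0 \<in> carrier_vec N" "x0 \<bullet> x0 = 1" "\<forall>u\<in>U. x0 \<bullet> u = 0"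
    using orthonormal_extend[OF U card] .
  from inC[OF this] have "B \<inter> C \<noteq> {}" by blast
  moreover have "continuous_on (B \<inter> C) q"
    unfolding q_def by (intro continuous_intros continuous_on_coordinate)
  ultimately obtain f where f: "f \<in> B \<inter> C" "\<And>g. g \<in> B \<inter> C \<Longrightarrow> q g \<le> q f"
    using continuous_attains_sup[OF comp] by metis
  show ?thesis
  proof (intro bexI[of _ "vec N f"] conjI ballI impI)
    show "vec N f \<in> carrier_vec N" by simp
    show "vec N f \<bullet> vec N f = 1" using f(1) by (simp add: ips C_def)
    show "vec N f \<bullet> u = 0" if "u \<in> U" for u
      using f(1) ipv orthonormalD(2)[OF U that] that by (auto simp: C_def)
    fix y assume y: "y \<in> carrier_vec N" "\<forall>u\<in>U. y \<bullet> u = 0"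
    show "y \<bullet> (M *\<^sub>v y) \<le> (vec N f \<bullet> (M *\<^sub>v vec N f)) * (y \<bullet> y)"
    proof (cases "y \<bullet> y = 0")
      case True
      then have "y = 0\<^sub>v N" using y scalar_prod_self_eq_0 by blast
      then show ?thesis using M True by simp
    next
      case False
      then have pos: "y \<bullet> y > 0" using scalar_prod_self_nonneg[of y] by linarith
      let ?c = "1 / sqrt (y \<bullet> y)"
      let ?z = "?c \<cdot>\<^sub>v y"
      have z: "?z \<in> carrier_vec N" "?z \<bullet> ?z = 1" "\<forall>u\<in>U. ?z \<bullet> u = 0"
        using normalize_perp[OF U y(1) False y(2)] by auto
      have v: "vec N (\<lambda>i. if i < N then ?z $ i else 0) = ?z" using z(1) by auto
      have "?z \<bullet> (M *\<^sub>v ?z) \<le> q f"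
        using f(2)[OF inC[OF z]] ipq[of "\<lambda>i. if i < N then ?z $ i else 0"] unfolding v by simp
      moreover have "?z \<bullet> (M *\<^sub>v ?z) = (?c * ?c) * (y \<bullet> (M *\<^sub>v y))"
        using M y(1) by (simp add: mult_mat_vec[of _ N N] smult_scalar_prod_distrib[of _ N]
            scalar_prod_smult_distrib[of _ N])
      ultimately show ?thesis using pos by (simp add: ipq field_simps)
    qed
  qed
qed

section \<open>Eigenvectors of symmetric and normal form of skew-symmetric matrices\<close>

lemma scalar_prod_comm_carrier:
  fixes x y :: "real vec"
  assumes "x \<in> carrier_vec N" "y \<in> carrier_vec N"
  shows "x \<bullet> y = y \<bullet> x"
  using comm_scalar_prod[OF assms] .

text \<open>
  The quadratic has the root \<open>t = 0\<close>, which must then be a minimum.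
\<close>

lemma quadratic_nonneg_imp_linear_0:
  fixes a b :: real
  assumes nonneg: "\<And>t. 0 \<le> 2 * t * a + t\<^sup>2 * b"
  shows "a = 0"
proof (rule ccontr)
  assume a: "a \<noteq> 0"
  \<comment> \<open>\<open>c\<close> dominates \<open>b\<close> and is positive, so \<open>t = - a / c\<close> minimizes \<open>2 t a + t\<^sup>2 c\<close>\<close>
  define c where "c = \<bar>b\<bar> + 1"
  define t where "t = - a / c"
  have c: "c > 0" "b \<le> c" by (auto simp: c_def)
  have "2 * t * a + t\<^sup>2 * b \<le> 2 * t * a + t\<^sup>2 * c"
    using c by (intro add_left_mono mult_left_mono) auto
  also have "\<dots> = - (a\<^sup>2 / c)"
    using c by (simp add: t_def field_simps power2_eq_square)
  also have "\<dots> < 0" using a c by simp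
  finally show False using nonneg[of t] by linarith
qed

text \<open>
  A maximizer \<open>x\<close> of the Rayleigh quotient on the orthogonal complement of \<open>U\<close> is an eigenvector when
  \<open>M\<close> preserves this complement: the quadratic form \<open>\<mu> (y \<bullet> y) - y \<bullet> M y\<close> is nonnegative there and vanishes
  at \<open>x\<close>, so its derivative at \<open>x\<close> in the direction \<open>z = \<mu> x - M x\<close>, which is \<open>2 (z \<bullet> z)\<close>, is zero.
\<close>

lemma eigenvector_in_complement:
  fixes M :: "real mat"
  assumes M: "M \<in> carrier_mat N N" and sym: "transpose_mat M = M"
    and U: "orthonormal N U" and card: "card U < N"
    and inv: "\<And>u y. u \<in> U \<Longrightarrow> y \<in> carrier_vec N \<Longrightarrow> \<forall>u\<in>U. y \<bullet> u = 0 \<Longrightarrow> (M *\<^sub>v y) \<bullet> u = 0"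
  shows "\<exists>x\<in>carrier_vec N. \<exists>\<mu>. x \<bullet> x = 1 \<and> (\<forall>u\<in>U. x \<bullet> u = 0) \<and> M *\<^sub>v x = \<mu> \<cdot>\<^sub>v x \<and>
    (\<forall>y\<in>carrier_vec N. (\<forall>u\<in>U. y \<bullet> u = 0) \<longrightarrow> y \<bullet> (M *\<^sub>v y) \<le> \<mu> * (y \<bullet> y))"
proof -
  obtain x where x: "x \<in> carrier_vec N" "x \<bullet> x = 1" "\<forall>u\<in>U. x \<bullet> u = 0"
    and mx: "\<forall>y\<in>carrier_vec N. (\<forall>u\<in>U. y \<bullet> u = 0) \<longrightarrow>
       y \<bullet> (M *\<^sub>v y) \<le> (x \<bullet> (M *\<^sub>v x)) * (y \<bullet> y)"
    using rayleigh_max[OF M U card] by blast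
  define \<mu> where "\<mu> = x \<bullet> (M *\<^sub>v x)"
  define z where "z = \<mu> \<cdot>\<^sub>v x - M *\<^sub>v x"
  have Mx: "M *\<^sub>v x \<in> carrier_vec N" using M x(1) by simp
  have z: "z \<in> carrier_vec N" using Mx x(1) by (simp add: z_def)
  have Mz: "M *\<^sub>v z \<in> carrier_vec N" using M z by simp
  have zu: "z \<bullet> u = 0" if "u \<in> U" for u
    using inv[OF that x(1,3)] x orthonormalD(2)[OF U that] that Mx
    by (simp add: z_def minus_scalar_prod_distrib[of _ N] smult_scalar_prod_distrib[of _ N])
  have xMz: "x \<bullet> (M *\<^sub>v z) = z \<bullet> (M *\<^sub>v x)"
    using transpose_vec_mult_scalar[OF M z x(1)] sym scalar_prod_comm_carrier[OF Mx z] by simp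
  have zz: "z \<bullet> z = \<mu> * (x \<bullet> z) - z \<bullet> (M *\<^sub>v x)"
    using z x(1) Mx scalar_prod_comm_carrier[OF x(1) z]
    by (subst (2) z_def) (simp add: scalar_prod_minus_distrib[of _ N] scalar_prod_smult_distrib[of _ N])
  have "0 \<le> 2 * t * (z \<bullet> z) + t\<^sup>2 * (\<mu> * (z \<bullet> z) - z \<bullet> (M *\<^sub>v z))" for t
  proof -
    define y where "y = x + t \<cdot>\<^sub>v z"
    have y: "y \<in> carrier_vec N" using x(1) z by (simp add: y_def)
    have "\<forall>u\<in>U. y \<bullet> u = 0"
      using zu x z orthonormalD(2)[OF U]
      by (simp add: y_def add_scalar_prod_distrib[of _ N] smult_scalar_prod_distrib[of _ N])
    then have "y \<bullet> (M *\<^sub>v y) \<le> \<mu> * (y \<bullet> y)" using mx y by (simp add: \<mu>_def)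
    moreover have "y \<bullet> y = 1 + 2 * t * (x \<bullet> z) + t\<^sup>2 * (z \<bullet> z)"
      using x z scalar_prod_comm_carrier[OF x(1) z]
      by (simp add: y_def add_scalar_prod_distrib[of _ N] smult_scalar_prod_distrib[of _ N]
          scalar_prod_add_distrib[of _ N] scalar_prod_smult_distrib[of _ N] power2_eq_square algebra_simps)
    moreover have "M *\<^sub>v y = M *\<^sub>v x + t \<cdot>\<^sub>v (M *\<^sub>v z)"
      using M x(1) z by (simp add: y_def mult_add_distrib_mat_vec[of _ N N] mult_mat_vec[of _ N N])
    then have "y \<bullet> (M *\<^sub>v y) = \<mu> + 2 * t * (z \<bullet> (M *\<^sub>v x)) + t\<^sup>2 * (z \<bullet> (M *\<^sub>v z))"
      using x z Mx Mz xMz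
      by (simp add: y_def add_scalar_prod_distrib[of _ N] smult_scalar_prod_distrib[of _ N]
          scalar_prod_add_distrib[of _ N] scalar_prod_smult_distrib[of _ N] power2_eq_square
          \<mu>_def algebra_simps)
    ultimately show ?thesis unfolding zz by (simp add: algebra_simps)
  qed
  then have "z \<bullet> z = 0" by (rule quadratic_nonneg_imp_linear_0)
  then have z0: "z = 0\<^sub>v N" using scalar_prod_self_eq_0 z by blast
  have "M *\<^sub>v x = \<mu> \<cdot>\<^sub>v x"
  proof (rule eq_vecI)
    fix i assume "i < dim_vec (\<mu> \<cdot>\<^sub>v x)"
    then have i: "i < N" using x(1) by simp
    have "z $ i = \<mu> * x $ i - (M *\<^sub>v x) $ i" using i x(1) M by (simp add: z_def)
    moreover have "z $ i = 0" using z0 i by simp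
    ultimately show "(M *\<^sub>v x) $ i = (\<mu> \<cdot>\<^sub>v x) $ i" using i x(1) by simp
  qed (use M x(1) in simp)
  then show ?thesis using x mx unfolding \<mu>_def by blast
qed

text \<open>
  Orthonormal vectors with an order, as needed for eigenbases; the set version serves where a subspace
  matters and the numbering does not.
\<close>

definition orthonormal_fam :: "nat \<Rightarrow> nat \<Rightarrow> (nat \<Rightarrow> real vec) \<Rightarrow> bool" where
  "orthonormal_fam N p e \<longleftrightarrow> (\<forall>a<p. e a \<in> carrier_vec N) \<and>
     (\<forall>a<p. \<forall>b<p. e a \<bullet> e b = (if a = b then 1 else 0))"

lemma orthonormal_famD:
  assumes "orthonormal_fam N p e"
  shows "a < p \<Longrightarrow> e a \<in> carrier_vec N" "a < p \<Longrightarrow> e a \<bullet> e a = 1"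
    "a < p \<Longrightarrow> b < p \<Longrightarrow> a \<noteq> b \<Longrightarrow> e a \<bullet> e b = 0"
  using assms by (auto simp: orthonormal_fam_def)

lemma orthonormal_fam_inj: 
  assumes "orthonormal_fam N p e"
  shows "inj_on e {..<p}"
proof (rule inj_onI)
  fix a b assume ab: "a \<in> {..<p}" "b \<in> {..<p}" "e a = e b"
  then have "e a \<bullet> e b = 1" using orthonormal_famD(2)[OF assms] by simp
  then show "a = b" using orthonormal_famD(3)[OF assms] ab(1,2) by fastforce
qed

lemma orthonormal_fam_image:
  assumes "orthonormal_fam N p e" "A \<subseteq> {..<p}"
  shows "orthonormal N (e ` A)" "card (e ` A) = card A" "inj_on e A"
proof -
  show inj: "inj_on e A" using orthonormal_fam_inj[OF assms(1)] assms(2) by (rule inj_on_subset)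
  show "card (e ` A) = card A" by (rule card_image[OF inj])
  have fin: "finite A" using assms(2) finite_subset by blast
  have "e a \<bullet> e b = (if e a = e b then 1 else 0)" if "a \<in> A" "b \<in> A" for a b
  proof (cases "a = b")
    case True
    then show ?thesis using orthonormal_famD(2)[OF assms(1), of b] that assms(2) by auto
  next
    case False
    then have "e a \<noteq> e b" using inj_onD[OF inj] that by blast
    moreover have "e a \<bullet> e b = 0"
      using orthonormal_famD(3)[OF assms(1) _ _ False] that assms(2) by blast
    ultimately show ?thesis by simp
  qed
  then show "orthonormal N (e ` A)"
    using assms fin by (auto simp: orthonormal_def orthonormal_fam_def)
qed

lemma orthonormal_fam_extend:
  assumes e: "orthonormal_fam N p e" and x: "x \<in> carrier_vec N" "x \<bullet> x = 1" "\<forall>a<p. x \<bullet> e a = 0"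
  shows "orthonormal_fam N (Suc p) (e(p := x))"
proof -
  have "e a \<bullet> x = 0" if "a < p" for a
    using scalar_prod_comm_carrier[OF x(1) orthonormal_famD(1)[OF e that]] x(3) that by simp
  then show ?thesis using e x by (auto simp: orthonormal_fam_def less_Suc_eq)
qed

lemma smult_eigen_scalar:
  fixes M :: "real mat"
  assumes M: "M \<in> carrier_mat N N" "transpose_mat M = M"
    and u: "u \<in> carrier_vec N" "M *\<^sub>v u = \<mu> \<cdot>\<^sub>v u" and y: "y \<in> carrier_vec N"
  shows "(M *\<^sub>v y) \<bullet> u = \<mu> * (y \<bullet> u)"
  using transpose_vec_mult_scalar[OF M(1) u(1) y] M(2) u y
  by (simp add: scalar_prod_smult_distrib[of _ N])

text \<open>
  The complement of a set of eigenvectors of a symmetric matrix is invariant, so eigenvectors can be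
  split off one at a time.
\<close>

theorem symmetric_eigenbasis:
  fixes M :: "real mat"
  assumes M: "M \<in> carrier_mat N N" "transpose_mat M = M"
  obtains e \<mu> where "orthonormal_fam N N e" "\<And>a. a < N \<Longrightarrow> M *\<^sub>v e a = \<mu> a \<cdot>\<^sub>v e a"
proof -
  have "\<exists>e \<mu>. orthonormal_fam N p e \<and> (\<forall>a<p. M *\<^sub>v e a = \<mu> a \<cdot>\<^sub>v e a)" if "p \<le> N" for p
    using that
  proof (induction p)
    case 0
    then show ?case by (auto simp: orthonormal_fam_def)
  next
    case (Suc p)
    then obtain e \<mu> where e: "orthonormal_fam N p e" and ev: "\<forall>a<p. M *\<^sub>v e a = \<mu> a \<cdot>\<^sub>v e a" by auto
    note im = orthonormal_fam_image[OF e subset_refl]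
    obtain x \<nu> where x: "x \<in> carrier_vec N" "x \<bullet> x = 1" "\<forall>u\<in>e ` {..<p}. x \<bullet> u = 0" "M *\<^sub>v x = \<nu> \<cdot>\<^sub>v x"
    proof -
      have "card (e ` {..<p}) < N" using im(2) Suc.prems by simp
      moreover have "(M *\<^sub>v y) \<bullet> u = 0"
        if "u \<in> e ` {..<p}" "y \<in> carrier_vec N" "\<forall>u\<in>e ` {..<p}. y \<bullet> u = 0" for u y
        using smult_eigen_scalar[OF M _ _ that(2)] that ev orthonormal_famD(1)[OF e] by auto
      ultimately show ?thesis using eigenvector_in_complement[OF M im(1)] that by blast
    qed
    have "orthonormal_fam N (Suc p) (e(p := x))"
      using orthonormal_fam_extend[OF e x(1,2)] x(3) by auto
    moreover have "\<forall>a<Suc p. M *\<^sub>v (e(p := x)) a = (\<mu>(p := \<nu>)) a \<cdot>\<^sub>v (e(p := x)) a"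
      using ev x(4) by (auto simp: less_Suc_eq)
    ultimately show ?case by blast
  qed
  from this[of N] show ?thesis using that by auto
qed

lemma skew_scalar_prod:
  fixes K :: "real mat"
  assumes K: "K \<in> carrier_mat N N" "transpose_mat K = - K"
    and x: "x \<in> carrier_vec N" and y: "y \<in> carrier_vec N"
  shows "(K *\<^sub>v x) \<bullet> y = - (x \<bullet> (K *\<^sub>v y))"
proof -
  have "(transpose_mat K *\<^sub>v x) \<bullet> y = x \<bullet> (K *\<^sub>v y)"
    by (rule transpose_vec_mult_scalar[OF K(1) y x])
  moreover have "transpose_mat K *\<^sub>v x = - (K *\<^sub>v x)"
    using K x by (simp add: uminus_mult_mat_vec)
  ultimately show ?thesis using K x y by simp
qed

lemma skew_scalar_prod_self:
  fixes K :: "real mat"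
  assumes K: "K \<in> carrier_mat N N" "transpose_mat K = - K" and x: "x \<in> carrier_vec N"
  shows "(K *\<^sub>v x) \<bullet> x = 0" "x \<bullet> (K *\<^sub>v x) = 0"
  using skew_scalar_prod[OF K x x] scalar_prod_comm_carrier[of x N "K *\<^sub>v x"] K x by auto

text \<open>
  Each step splits off a block of the form \<open>(0, - s; s, 0)\<close>.  Take a unit vector \<open>u\<close> on the orthogonal
  complement that maximizes \<open>\<parallel>K u\<parallel>\<^sup>2 = u \<bullet> K\<^sup>T K u\<close>; it is an eigenvector of \<open>K\<^sup>T K = - K\<^sup>2\<close> for
  \<open>\<mu> = s\<^sup>2\<close>, and \<open>w = K u / s\<close> completes the block.  If \<open>s = 0\<close>, then \<open>K\<close> vanishes on the whole complement and any
  unit \<open>w\<close> orthogonal to \<open>u\<close> will do.  The last conjunct records the maximality; it makes the \<open>s i\<close>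
  decrease.
\<close>

theorem skew_normal_form:
  fixes K :: "real mat"
  assumes K: "K \<in> carrier_mat N N" "transpose_mat K = - K" and p: "2 * p \<le> N"
  shows "\<exists>e s. orthonormal_fam N (2 * p) e \<and>
    (\<forall>i<p. 0 \<le> s i \<and> K *\<^sub>v e (2 * i) = s i \<cdot>\<^sub>v e (2 * i + 1) \<and>
       K *\<^sub>v e (2 * i + 1) = (- s i) \<cdot>\<^sub>v e (2 * i) \<and>
       (\<forall>y\<in>carrier_vec N. (\<forall>a<2 * i. y \<bullet> e a = 0) \<longrightarrow>
          (K *\<^sub>v y) \<bullet> (K *\<^sub>v y) \<le> (s i)\<^sup>2 * (y \<bullet> y)))"
  using p
proof (induction p)
  case 0
  then show ?case by (auto simp: orthonormal_fam_def)
next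
  case (Suc p)
  then have pN: "2 * p + 2 \<le> N" by simp
  have "2 * p \<le> N" using pN by simp
  from Suc.IH[OF this] obtain e s where e: "orthonormal_fam N (2 * p) e"
    and s0: "\<forall>i<p. 0 \<le> s i \<and> K *\<^sub>v e (2 * i) = s i \<cdot>\<^sub>v e (2 * i + 1) \<and>
       K *\<^sub>v e (2 * i + 1) = (- s i) \<cdot>\<^sub>v e (2 * i) \<and>
       (\<forall>y\<in>carrier_vec N. (\<forall>a<2 * i. y \<bullet> e a = 0) \<longrightarrow>
          (K *\<^sub>v y) \<bullet> (K *\<^sub>v y) \<le> (s i)\<^sup>2 * (y \<bullet> y))"
    by blast
  have s: "i < p \<Longrightarrow> 0 \<le> s i" "i < p \<Longrightarrow> K *\<^sub>v e (2 * i) = s i \<cdot>\<^sub>v e (2 * i + 1)"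
      "i < p \<Longrightarrow> K *\<^sub>v e (2 * i + 1) = (- s i) \<cdot>\<^sub>v e (2 * i)"
      "\<And>y. i < p \<Longrightarrow> y \<in> carrier_vec N \<Longrightarrow> \<forall>a<2 * i. y \<bullet> e a = 0 \<Longrightarrow>
          (K *\<^sub>v y) \<bullet> (K *\<^sub>v y) \<le> (s i)\<^sup>2 * (y \<bullet> y)" for i
    using s0 by blast+
  define M where "M = transpose_mat K * K"
  have M: "M \<in> carrier_mat N N" "transpose_mat M = M"
    using K(1) by (auto simp: M_def transpose_mult[of _ N N])
  have MK: "M *\<^sub>v y = - (K *\<^sub>v (K *\<^sub>v y))" if "y \<in> carrier_vec N" for y
    using K that by (simp add: M_def assoc_mult_mat_vec[of _ N N _ N] uminus_mult_mat_vec)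
  have Kc: "K *\<^sub>v y \<in> carrier_vec N" if "y \<in> carrier_vec N" for y using K that by simp
  have yMy: "y \<bullet> (M *\<^sub>v y) = (K *\<^sub>v y) \<bullet> (K *\<^sub>v y)" if "y \<in> carrier_vec N" for y
    using skew_scalar_prod[OF K that Kc[OF that]] MK[OF that] carrier_vecD[OF that]
      carrier_vecD[OF Kc[OF Kc[OF that]]] by simp
  let ?U = "e ` {..<2 * p}"
  note im = orthonormal_fam_image[OF e subset_refl]
  have perp: "(K *\<^sub>v y) \<bullet> e a = 0"
    if y: "y \<in> carrier_vec N" "\<forall>a<2 * p. y \<bullet> e a = 0" and a: "a < 2 * p" for y a
  proof -
    have ec: "e b \<in> carrier_vec N" if "b < 2 * p" for b using orthonormal_famD(1)[OF e that] .
    define i where "i = a div 2"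
    have i: "i < p" "a = 2 * i \<or> a = 2 * i + 1" using a unfolding i_def by auto
    then have "2 * i < 2 * p" "2 * i + 1 < 2 * p" by auto
    then have "y \<bullet> (K *\<^sub>v e a) = 0"
      using i(2) s(2,3)[OF i(1)] y ec by (auto simp: scalar_prod_smult_distrib[of _ N])
    then show ?thesis using skew_scalar_prod[OF K y(1) ec[OF a]] by simp
  qed
  obtain u \<mu> where u: "u \<in> carrier_vec N" "u \<bullet> u = 1" "\<forall>v\<in>?U. u \<bullet> v = 0" "M *\<^sub>v u = \<mu> \<cdot>\<^sub>v u"
    and mx: "\<forall>y\<in>carrier_vec N. (\<forall>v\<in>?U. y \<bullet> v = 0) \<longrightarrow> y \<bullet> (M *\<^sub>v y) \<le> \<mu> * (y \<bullet> y)"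
  proof -
    have "card ?U < N" using im(2) pN by simp
    moreover have "(M *\<^sub>v y) \<bullet> v = 0"
      if v: "v \<in> ?U" and y: "y \<in> carrier_vec N" "\<forall>v\<in>?U. y \<bullet> v = 0" for v y
    proof -
      obtain a where a: "a < 2 * p" "v = e a" using v by auto
      have 1: "\<forall>a<2 * p. (K *\<^sub>v y) \<bullet> e a = 0" using perp y by auto
      have "(K *\<^sub>v (K *\<^sub>v y)) \<bullet> v = 0" using perp[OF Kc[OF y(1)] 1 a(1)] a(2) by simp
      then show ?thesis
        using MK[OF y(1)] carrier_vecD[OF Kc[OF Kc[OF y(1)]]]
          carrier_vecD[OF orthonormal_famD(1)[OF e a(1)]] a(2) by simp
    qed
    ultimately show ?thesis using eigenvector_in_complement[OF M im(1)] that by blast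
  qed
  have uMu: "(K *\<^sub>v u) \<bullet> (K *\<^sub>v u) = \<mu>"
    using yMy[OF u(1)] u by (simp add: scalar_prod_smult_distrib[of _ N])
  then have \<mu>0: "0 \<le> \<mu>" using scalar_prod_self_nonneg by metis
  have ue: "\<forall>a<2 * p. u \<bullet> e a = 0" using u(3) by auto
  obtain w where w: "w \<in> carrier_vec N" "w \<bullet> w = 1" "\<forall>a<2 * p. w \<bullet> e a = 0" "w \<bullet> u = 0"
    "K *\<^sub>v u = sqrt \<mu> \<cdot>\<^sub>v w" "K *\<^sub>v w = (- sqrt \<mu>) \<cdot>\<^sub>v u"
  proof (cases "\<mu> = 0")
    case True
    have "K *\<^sub>v u = 0\<^sub>v N" using scalar_prod_self_eq_0[OF Kc[OF u(1)]] uMu True by simp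
    have "card (insert u ?U) < N" "orthonormal N (insert u ?U)"
      using orthonormal_insert[OF im(1) u(1-3)] im(2) pN by auto
    then obtain w where w: "w \<in> carrier_vec N" "w \<bullet> w = 1" "\<forall>v\<in>insert u ?U. w \<bullet> v = 0"
      using orthonormal_extend by blast
    have "(K *\<^sub>v w) \<bullet> (K *\<^sub>v w) \<le> 0"
      using mx w yMy[OF w(1)] True by auto
    then have "(K *\<^sub>v w) \<bullet> (K *\<^sub>v w) = 0" using scalar_prod_self_nonneg[of "K *\<^sub>v w"] by linarith
    then have "K *\<^sub>v w = 0\<^sub>v N" using scalar_prod_self_eq_0[OF Kc[OF w(1)]] by simp
    moreover have "0 \<cdot>\<^sub>v v = 0\<^sub>v N" if "v \<in> carrier_vec N" for v :: "real vec"
      using that by (intro eq_vecI) auto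
    ultimately show ?thesis using that[of w] w u(1) True \<open>K *\<^sub>v u = 0\<^sub>v N\<close> by simp
  next
    case False
    then have pos: "0 < sqrt \<mu>" using \<mu>0 by simp
    define w where "w = (1 / sqrt \<mu>) \<cdot>\<^sub>v (K *\<^sub>v u)"
    have w: "w \<in> carrier_vec N" using Kc[OF u(1)] by (simp add: w_def)
    have wy: "w \<bullet> y = (1 / sqrt \<mu>) * ((K *\<^sub>v u) \<bullet> y)" if "y \<in> carrier_vec N" for y
      using Kc[OF u(1)] that by (simp add: w_def smult_scalar_prod_distrib[of _ N])
    have "w \<bullet> w = (1 / sqrt \<mu>) * ((1 / sqrt \<mu>) * \<mu>)"
      using wy[OF w] uMu Kc[OF u(1)] by (simp add: w_def scalar_prod_smult_distrib[of _ N])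
    then have "w \<bullet> w = 1" using \<mu>0 False by (simp add: field_simps)
    moreover have "\<forall>a<2 * p. w \<bullet> e a = 0"
      using wy orthonormal_famD(1)[OF e] perp[OF u(1) ue] by simp
    moreover have "w \<bullet> u = 0" using wy[OF u(1)] skew_scalar_prod_self[OF K u(1)] by simp
    moreover have "K *\<^sub>v u = sqrt \<mu> \<cdot>\<^sub>v w"
      using pos Kc[OF u(1)] by (simp add: w_def smult_smult_assoc)
    moreover have "K *\<^sub>v w = (- sqrt \<mu>) \<cdot>\<^sub>v u"
    proof -
      have "K *\<^sub>v (K *\<^sub>v u) = - (\<mu> \<cdot>\<^sub>v u)"
        using MK[OF u(1)] u(4) by (metis uminus_uminus_vec)
      then have "K *\<^sub>v w = (1 / sqrt \<mu>) \<cdot>\<^sub>v (- (\<mu> \<cdot>\<^sub>v u))"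
        using K u(1) by (simp add: w_def mult_mat_vec[of _ N N])
      also have "\<dots> = (- sqrt \<mu>) \<cdot>\<^sub>v u"
      proof -
        have "1 / sqrt \<mu> * (- (\<mu> * c)) = - sqrt \<mu> * c" for c
        proof -
          have "1 / sqrt \<mu> * (- (\<mu> * c)) = - (\<mu> / sqrt \<mu>) * c" by simp
          then show ?thesis using real_div_sqrt[OF \<mu>0] by simp
        qed
        then show ?thesis using u(1) by (intro eq_vecI) auto
      qed
      finally show ?thesis .
    qed
    ultimately show ?thesis using that w by blast
  qed
  define e' where "e' = (e(2 * p := u))(Suc (2 * p) := w)"
  define s' where "s' = s(p := sqrt \<mu>)"
  have e'_old: "e' a = e a" if "a < 2 * p" for a using that by (simp add: e'_def)
  have e'_new: "e' (2 * p) = u" "e' (2 * p + 1) = w" by (simp_all add: e'_def)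
  have e1: "orthonormal_fam N (Suc (2 * p)) (e(2 * p := u))"
    by (rule orthonormal_fam_extend[OF e u(1,2) ue])
  have "\<forall>a<Suc (2 * p). w \<bullet> (e(2 * p := u)) a = 0"
    using w(3,4) by (simp add: less_Suc_eq)
  from orthonormal_fam_extend[OF e1 w(1,2) this] have e': "orthonormal_fam N (2 * Suc p) e'"
    unfolding e'_def mult_Suc_right add_2_eq_Suc .
  have "0 \<le> s' i \<and> K *\<^sub>v e' (2 * i) = s' i \<cdot>\<^sub>v e' (2 * i + 1) \<and>
       K *\<^sub>v e' (2 * i + 1) = (- s' i) \<cdot>\<^sub>v e' (2 * i) \<and>
       (\<forall>y\<in>carrier_vec N. (\<forall>a<2 * i. y \<bullet> e' a = 0) \<longrightarrow>
          (K *\<^sub>v y) \<bullet> (K *\<^sub>v y) \<le> (s' i)\<^sup>2 * (y \<bullet> y))" if i: "i < Suc p" for i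
  proof (cases "i = p")
    case True
    show ?thesis unfolding True e'_new
    proof (intro conjI ballI impI)
      fix y assume y: "y \<in> carrier_vec N" "\<forall>a<2 * p. y \<bullet> e' a = 0"
      then have "\<forall>v\<in>?U. y \<bullet> v = 0" using e'_old by auto
      then have "y \<bullet> (M *\<^sub>v y) \<le> \<mu> * (y \<bullet> y)" using mx y(1) by blast
      then show "(K *\<^sub>v y) \<bullet> (K *\<^sub>v y) \<le> (s' p)\<^sup>2 * (y \<bullet> y)"
        using yMy[OF y(1)] \<mu>0 by (simp add: s'_def)
    qed (use w \<mu>0 in \<open>auto simp: s'_def\<close>)
  next
    case False
    then have i: "i < p" using i by simp
    have "2 * i < 2 * p" "2 * i + 1 < 2 * p" using i by auto
    note old = e'_old[OF this(1)] e'_old[OF this(2)]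
    show ?thesis unfolding old
    proof (intro conjI ballI impI)
      fix y assume y: "y \<in> carrier_vec N" "\<forall>a<2 * i. y \<bullet> e' a = 0"
      then have "\<forall>a<2 * i. y \<bullet> e a = 0" using e'_old i by auto
      from s(4)[OF i y(1) this] show "(K *\<^sub>v y) \<bullet> (K *\<^sub>v y) \<le> (s' i)\<^sup>2 * (y \<bullet> y)"
        using False by (simp add: s'_def)
    qed (use s(1-3)[OF i] False in \<open>auto simp: s'_def\<close>)
  qed
  then show ?case using e' by blast
qed

section \<open>Ky Fan inequality and eigenvalue lists\<close>

lemma sum_fam_image:
  assumes "orthonormal_fam N N e"
  shows "(\<Sum>u\<in>e ` {..<N}. f u) = (\<Sum>a<N. f (e a))"
  using orthonormal_fam_image(3)[OF assms subset_refl] by (simp add: sum.reindex)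

lemma parseval_fam:
  assumes e: "orthonormal_fam N N e" and "x \<in> carrier_vec N" "y \<in> carrier_vec N"
  shows "(\<Sum>a<N. (x \<bullet> e a) * (y \<bullet> e a)) = x \<bullet> y"
  using parseval[OF orthonormal_fam_image(1)[OF e subset_refl] _ assms(2,3)]
    orthonormal_fam_image(2)[OF e subset_refl] sum_fam_image[OF e, of "\<lambda>u. (x \<bullet> u) * (y \<bullet> u)"] by simp

text \<open>
  Weights between \<open>0\<close> and \<open>1\<close> of total mass \<open>k\<close> do best on the first \<open>k\<close> entries of a decreasing
  sequence: subtract the threshold \<open>\<mu> (k - 1)\<close> and compare term by term.
\<close>

lemma weighted_sum_le_prefix_sum:
  fixes \<mu> w :: "nat \<Rightarrow> real"
  assumes anti: "\<And>a b. a \<le> b \<Longrightarrow> b < N \<Longrightarrow> \<mu> b \<le> \<mu> a"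
    and w: "\<And>a. a < N \<Longrightarrow> 0 \<le> w a" "\<And>a. a < N \<Longrightarrow> w a \<le> 1"
    and k: "(\<Sum>a<N. w a) = real k" "k \<le> N"
  shows "(\<Sum>a<N. \<mu> a * w a) \<le> (\<Sum>a<k. \<mu> a)"
proof (cases "k = 0")
  case True
  then have "\<forall>a\<in>{..<N}. w a = 0"
    using k(1) w(1) by (subst sum_nonneg_eq_0_iff[symmetric]) auto
  then show ?thesis using True by simp
next
  case False
  \<comment> \<open>the threshold separating the first \<open>k\<close> entries from the rest\<close>
  define t where "t = \<mu> (k - 1)"
  have split: "{..<N} = {..<k} \<union> {k..<N}" "{..<k} \<inter> {k..<N} = {}" using k(2) by auto
  have "(\<Sum>a<N. \<mu> a * w a) - t * real k = (\<Sum>a<N. (\<mu> a - t) * w a)"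
    by (simp add: left_diff_distrib sum_subtractf sum_distrib_left k(1)[symmetric])
  also have "\<dots> \<le> (\<Sum>a<N. if a < k then \<mu> a - t else 0)"
  proof (rule sum_mono)
    fix a assume a: "a \<in> {..<N}"
    show "(\<mu> a - t) * w a \<le> (if a < k then \<mu> a - t else 0)"
    proof (cases "a < k")
      case True
      then have "0 \<le> \<mu> a - t" using anti[of a "k - 1"] False k(2) by (simp add: t_def)
      then show ?thesis using mult_left_mono[of "w a" 1 "\<mu> a - t"] w(2)[of a] a True by simp
    next
      case out: False
      then have "\<mu> a - t \<le> 0" using anti[of "k - 1" a] a by (simp add: t_def)
      then show ?thesis using w(1)[of a] a out by (simp add: mult_nonpos_nonneg)
    qed
  qed
  also have "\<dots> = (\<Sum>a<k. \<mu> a - t)"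
    unfolding split(1) by (subst sum.union_disjoint) (use split(2) in auto)
  also have "\<dots> = (\<Sum>a<k. \<mu> a) - t * real k" by (simp add: sum_subtractf)
  finally show ?thesis by simp
qed

text \<open>
  In the eigenbasis the left side is a weighted sum of the eigenvalues, where \<open>\<mu> a\<close> has as weight the
  squared length of the projection of \<open>e a\<close> to the span of \<open>U\<close>.  These weights are at most \<open>1\<close> by Bessel
  and add up to \<open>card U\<close> by Parseval.
\<close>

theorem ky_fan:
  fixes M :: "real mat"
  assumes M: "M \<in> carrier_mat N N" "transpose_mat M = M"
    and e: "orthonormal_fam N N e" and ev: "\<And>a. a < N \<Longrightarrow> M *\<^sub>v e a = \<mu> a \<cdot>\<^sub>v e a"
    and anti: "\<And>a b. a \<le> b \<Longrightarrow> b < N \<Longrightarrow> \<mu> b \<le> \<mu> a"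
    and U: "orthonormal N U"
  shows "(\<Sum>u\<in>U. u \<bullet> (M *\<^sub>v u)) \<le> (\<Sum>a<card U. \<mu> a)"
proof -
  define w where "w a = (\<Sum>u\<in>U. (e a \<bullet> u)\<^sup>2)" for a
  have "u \<bullet> (M *\<^sub>v u) = (\<Sum>a<N. \<mu> a * (e a \<bullet> u)\<^sup>2)" if "u \<in> U" for u
  proof -
    have u: "u \<in> carrier_vec N" using orthonormalD(2)[OF U that] .
    have Mu: "M *\<^sub>v u \<in> carrier_vec N" using M u by simp
    have "u \<bullet> (M *\<^sub>v u) = (\<Sum>a<N. (u \<bullet> e a) * ((M *\<^sub>v u) \<bullet> e a))"
      by (rule parseval_fam[OF e u Mu, symmetric])
    also have "\<dots> = (\<Sum>a<N. \<mu> a * (e a \<bullet> u)\<^sup>2)"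
    proof (rule sum.cong[OF refl])
      fix a assume "a \<in> {..<N}"
      then have a: "a < N" "e a \<in> carrier_vec N" using orthonormal_famD(1)[OF e] by auto
      show "(u \<bullet> e a) * ((M *\<^sub>v u) \<bullet> e a) = \<mu> a * (e a \<bullet> u)\<^sup>2"
        using smult_eigen_scalar[OF M a(2) ev[OF a(1)] u] scalar_prod_comm_carrier[OF u a(2)]
        by (simp add: power2_eq_square)
    qed
    finally show ?thesis .
  qed
  then have "(\<Sum>u\<in>U. u \<bullet> (M *\<^sub>v u)) = (\<Sum>u\<in>U. \<Sum>a<N. \<mu> a * (e a \<bullet> u)\<^sup>2)" by simp
  also have "\<dots> = (\<Sum>a<N. \<Sum>u\<in>U. \<mu> a * (e a \<bullet> u)\<^sup>2)" by (rule sum.swap)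
  also have "\<dots> = (\<Sum>a<N. \<mu> a * w a)" by (simp add: w_def sum_distrib_left)
  also have "\<dots> \<le> (\<Sum>a<card U. \<mu> a)"
  proof (rule weighted_sum_le_prefix_sum)
    show "w a \<le> 1" if "a < N" for a
      using bessel[OF U orthonormal_famD(1)[OF e that]] orthonormal_famD(2)[OF e that]
      by (simp add: w_def)
    have "(\<Sum>a<N. w a) = (\<Sum>u\<in>U. \<Sum>a<N. (e a \<bullet> u)\<^sup>2)" unfolding w_def by (rule sum.swap)
    also have "\<dots> = (\<Sum>u\<in>U. 1)"
    proof (rule sum.cong[OF refl])
      fix u assume u: "u \<in> U"
      have uc: "u \<in> carrier_vec N" using orthonormalD(2)[OF U u] .
      have "(\<Sum>a<N. (e a \<bullet> u)\<^sup>2) = (\<Sum>a<N. (u \<bullet> e a) * (u \<bullet> e a))"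
        by (rule sum.cong[OF refl])
          (use scalar_prod_comm_carrier[OF uc] orthonormal_famD(1)[OF e] in \<open>auto simp: power2_eq_square\<close>)
      then show "(\<Sum>a<N. (e a \<bullet> u)\<^sup>2) = 1"
        using parseval_fam[OF e uc uc] orthonormalD(3)[OF U u] by simp
    qed
    finally show "(\<Sum>a<N. w a) = real (card U)" by simp
  qed (use anti orthonormal_card_le[OF U] in \<open>auto simp: w_def sum_nonneg\<close>)
  finally show ?thesis .
qed

text \<open>
  Both sides are the trace, computed in the eigenbasis and in the standard basis.
\<close>

lemma sum_eigenvalues:
  fixes M :: "real mat"
  assumes M: "M \<in> carrier_mat N N"
    and e: "orthonormal_fam N N e" and ev: "\<And>a. a < N \<Longrightarrow> M *\<^sub>v e a = \<mu> a \<cdot>\<^sub>v e a"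
  shows "(\<Sum>a<N. \<mu> a) = (\<Sum>i<N. M $$ (i, i))"
proof -
  have col: "M $$ (i, i) = (\<Sum>a<N. \<mu> a * (e a $ i * e a $ i))" if i: "i < N" for i
  proof -
    have "M $$ (i, i) = unit_vec N i \<bullet> row M i" using M i by simp
    also have "\<dots> = (\<Sum>a<N. (unit_vec N i \<bullet> e a) * (row M i \<bullet> e a))"
      by (rule parseval_fam[OF e _ , symmetric]) (use M in auto)
    also have "\<dots> = (\<Sum>a<N. \<mu> a * (e a $ i * e a $ i))"
    proof (rule sum.cong[OF refl])
      fix a assume "a \<in> {..<N}"
      then have a: "a < N" "e a \<in> carrier_vec N" using orthonormal_famD(1)[OF e] by auto
      have "row M i \<bullet> e a = (M *\<^sub>v e a) $ i" using M i by simp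
      then show "(unit_vec N i \<bullet> e a) * (row M i \<bullet> e a) = \<mu> a * (e a $ i * e a $ i)"
        using a i ev[OF a(1)] by simp
    qed
    finally show ?thesis .
  qed
  have "(\<Sum>i<N. M $$ (i, i)) = (\<Sum>i<N. \<Sum>a<N. \<mu> a * (e a $ i * e a $ i))" using col by simp
  also have "\<dots> = (\<Sum>a<N. \<Sum>i<N. \<mu> a * (e a $ i * e a $ i))" by (rule sum.swap)
  also have "\<dots> = (\<Sum>a<N. \<mu> a * (e a \<bullet> e a))"
  proof (rule sum.cong[OF refl])
    fix a assume "a \<in> {..<N}"
    then have "dim_vec (e a) = N" using orthonormal_famD(1)[OF e] by auto
    then show "(\<Sum>i<N. \<mu> a * (e a $ i * e a $ i)) = \<mu> a * (e a \<bullet> e a)"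
      by (simp add: scalar_prod_def sum_distrib_left atLeast0LessThan)
  qed
  also have "\<dots> = (\<Sum>a<N. \<mu> a)" using orthonormal_famD(2)[OF e] by simp
  finally show ?thesis by simp
qed

text \<open>
  The eigenbasis, as the columns of an orthogonal matrix, makes \<open>M\<close> similar to a diagonal matrix.  This
  ties the algebraic multiplicities to the geometric eigenbasis.
\<close>

theorem proots_char_poly_eigenbasis:
  fixes M :: "real mat"
  assumes M: "M \<in> carrier_mat N N"
    and e: "orthonormal_fam N N e" and ev: "\<And>a. a < N \<Longrightarrow> M *\<^sub>v e a = \<mu> a \<cdot>\<^sub>v e a"
  shows "proots (char_poly M) = mset (map \<mu> [0..<N])"
proof -
  define P where "P = mat N N (\<lambda>(i, a). e a $ i)"
  define D where "D = mat N N (\<lambda>(i, a). if i = a then \<mu> a else 0)"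
  have P: "P \<in> carrier_mat N N" and D: "D \<in> carrier_mat N N" by (auto simp: P_def D_def)
  have colP: "col P a = e a" if "a < N" for a
    using that orthonormal_famD(1)[OF e that] by (auto simp: P_def)
  have PP: "transpose_mat P * P = 1\<^sub>m N"
  proof (rule eq_matI)
    fix a b assume "a < dim_row (1\<^sub>m N)" "b < dim_col (1\<^sub>m N)"
    then have ab: "a < N" "b < N" by auto
    then show "(transpose_mat P * P) $$ (a, b) = 1\<^sub>m N $$ (a, b)"
      using P colP orthonormal_famD(2,3)[OF e] by simp
  qed (use P in auto)
  then have PP': "P * transpose_mat P = 1\<^sub>m N"
    using mat_mult_left_right_inverse[of "transpose_mat P" N P] P by simp
  have MP: "M * P = P * D"
  proof (rule eq_matI)
    fix i a assume "i < dim_row (P * D)" "a < dim_col (P * D)"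
    then have ia: "i < N" "a < N" using P D by auto
    have "(M * P) $$ (i, a) = (M *\<^sub>v e a) $ i"
      using M P ia colP by simp
    also have "\<dots> = \<mu> a * e a $ i"
      using ev[OF ia(2)] ia orthonormal_famD(1)[OF e ia(2)] by simp
    also have "\<dots> = (P * D) $$ (i, a)"
    proof -
      have "(P * D) $$ (i, a) = (\<Sum>j<N. e j $ i * (if j = a then \<mu> a else 0))"
        using ia by (simp add: P_def D_def scalar_prod_def atLeast0LessThan)
      also have "\<dots> = (\<Sum>j<N. if j = a then e a $ i * \<mu> a else 0)"
        by (rule sum.cong) auto
      finally show ?thesis using ia by simp
    qed
    finally show "(M * P) $$ (i, a) = (P * D) $$ (i, a)" .
  qed (use M P D in auto)
  have "M = M * (P * transpose_mat P)" using M PP' by simp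
  also have "\<dots> = P * D * transpose_mat P"
    using M P D MP assoc_mult_mat[of M N N P N "transpose_mat P" N] by simp
  finally have "similar_mat M D"
    by (intro similar_matI[of _ _ P "transpose_mat P" N]) (use M P D PP PP' in auto)
  then have "char_poly M = char_poly D" by (rule char_poly_similar)
  also have "\<dots> = (\<Prod>a\<leftarrow>diag_mat D. [:- a, 1:])"
    by (rule char_poly_upper_triangular[OF D]) (auto simp: upper_triangular_def D_def)
  also have "diag_mat D = map \<mu> [0..<N]" by (auto simp: diag_mat_def D_def)
  finally have "proots (char_poly M) = proots (\<Prod>p\<leftarrow>map (\<lambda>a. [:- \<mu> a, 1:]) [0..<N]. p)"
    by (simp add: comp_def)
  also have "\<dots> = sum_list (map proots (map (\<lambda>a. [:- \<mu> a, 1:]) [0..<N]))"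
    by (rule proots_prod_list) auto
  also have "\<dots> = sum_list (map (\<lambda>a. {#\<mu> a#}) [0..<N])" by (simp add: comp_def)
  also have "\<dots> = mset (map \<mu> [0..<N])"
    by (induction N) auto
  finally show ?thesis .
qed

lemma decr_mset_antitone:
  fixes \<mu> :: "nat \<Rightarrow> real"
  assumes anti: "\<And>a b. a \<le> b \<Longrightarrow> b < N \<Longrightarrow> \<mu> b \<le> \<mu> a"
  shows "decr (mset (map \<mu> [0..<N])) = map \<mu> [0..<N]"
proof -
  have "sorted (rev (map \<mu> [0..<N]))"
    unfolding sorted_rev_iff_nth_mono using anti by auto
  then have "sort (map \<mu> [0..<N]) = rev (map \<mu> [0..<N])"
    by (intro properties_for_sort) auto
  then show ?thesis
    by (simp only: decr_def sorted_list_of_multiset_mset rev_rev_ident)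
qed

section \<open>Bases adapted to a skew-symmetric matrix\<close>

text \<open>
  The eigenvalues of \<open>K\<^sup>T K\<close> in decreasing order, when \<open>s i\<close> belongs to the \<open>i\<close>-th block of \<open>K\<close>: each
  \<open>(s i)\<^sup>2\<close> occurs at the positions \<open>2 i\<close> and \<open>2 i + 1\<close>.  The value \<open>0\<close> covers the unpaired last
  position for odd \<open>N\<close>, and also all positions beyond \<open>N\<close>, so that partial sums of any length
  make sense.
\<close>

definition gram_eigenvalue :: "nat \<Rightarrow> (nat \<Rightarrow> real) \<Rightarrow> nat \<Rightarrow> real" where
  "gram_eigenvalue N s a = (if a div 2 < N div 2 then (s (a div 2))\<^sup>2 else 0)"

definition skew_basis :: "nat \<Rightarrow> real mat \<Rightarrow> (nat \<Rightarrow> real vec) \<Rightarrow> (nat \<Rightarrow> real) \<Rightarrow> bool" where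
  "skew_basis N K e s \<longleftrightarrow> orthonormal_fam N N e \<and>
     (\<forall>i<N div 2. 0 \<le> s i \<and> K *\<^sub>v e (2 * i) = s i \<cdot>\<^sub>v e (2 * i + 1) \<and>
        K *\<^sub>v e (2 * i + 1) = (- s i) \<cdot>\<^sub>v e (2 * i)) \<and>
     (\<forall>i j. i \<le> j \<longrightarrow> j < N div 2 \<longrightarrow> s j \<le> s i) \<and>
     (odd N \<longrightarrow> K *\<^sub>v e (N - 1) = 0\<^sub>v N)"

text \<open>
  The blocks of \<open>skew_normal_form\<close> exhaust the space up to one unit vector \<open>z\<close> if \<open>N\<close> is odd.  Then
  \<open>K z\<close> is orthogonal to all blocks, since they are invariant, and to \<open>z\<close>, since \<open>K\<close> is skew.
\<close>

theorem skew_basis_exists: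
  fixes K :: "real mat"
  assumes K: "K \<in> carrier_mat N N" "transpose_mat K = - K"
  shows "\<exists>e s. skew_basis N K e s"
proof -
  define p where "p = N div 2"
  have p: "2 * p \<le> N" by (simp add: p_def)
  obtain e s where e: "orthonormal_fam N (2 * p) e"
    and s0: "\<forall>i<p. 0 \<le> s i \<and> K *\<^sub>v e (2 * i) = s i \<cdot>\<^sub>v e (2 * i + 1) \<and>
       K *\<^sub>v e (2 * i + 1) = (- s i) \<cdot>\<^sub>v e (2 * i) \<and>
       (\<forall>y\<in>carrier_vec N. (\<forall>a<2 * i. y \<bullet> e a = 0) \<longrightarrow>
          (K *\<^sub>v y) \<bullet> (K *\<^sub>v y) \<le> (s i)\<^sup>2 * (y \<bullet> y))"
    using skew_normal_form[OF K p] by blast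
  have anti: "s j \<le> s i" if ij: "i \<le> j" "j < p" for i j
  proof -
    have j: "2 * j < 2 * p" "2 * j + 1 < 2 * p" using ij by auto
    have perp: "\<forall>a<2 * i. e (2 * j) \<bullet> e a = 0"
      using orthonormal_famD(3)[OF e j(1)] ij by auto
    have "(K *\<^sub>v e (2 * j)) \<bullet> (K *\<^sub>v e (2 * j)) \<le> (s i)\<^sup>2 * (e (2 * j) \<bullet> e (2 * j))"
      using s0 perp le_less_trans[OF ij] orthonormal_famD(1)[OF e j(1)] by blast
    moreover have "(K *\<^sub>v e (2 * j)) \<bullet> (K *\<^sub>v e (2 * j)) = (s j)\<^sup>2"
      using s0 ij orthonormal_famD(1,2)[OF e j(2)]
      by (simp add: smult_scalar_prod_distrib[of _ N] scalar_prod_smult_distrib[of _ N] power2_eq_square)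
    ultimately have "(s j)\<^sup>2 \<le> (s i)\<^sup>2" using orthonormal_famD(2)[OF e j(1)] by simp
    then show ?thesis using s0 ij by (meson le_less_trans power2_le_imp_le)
  qed
  show ?thesis
  proof (cases "even N")
    case True
    then have "N = 2 * p" by (simp add: p_def)
    then have "orthonormal_fam N N e" using e by simp
    then have "skew_basis N K e s"
      unfolding skew_basis_def p_def[symmetric] using s0 anti True by blast
    then show ?thesis by blast
  next
    case False
    then have N: "N = Suc (2 * p)" by (simp add: p_def)
    note im = orthonormal_fam_image[OF e subset_refl]
    have "card (e ` {..<2 * p}) < N" using im(2) N by simp
    then obtain z where z: "z \<in> carrier_vec N" "z \<bullet> z = 1" "\<forall>u\<in>e ` {..<2 * p}. z \<bullet> u = 0"
      using orthonormal_extend[OF im(1)] by blast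
    have ze: "\<forall>a<2 * p. z \<bullet> e a = 0" using z(3) by auto
    define f where "f = e(2 * p := z)"
    have f: "orthonormal_fam N N f"
      using orthonormal_fam_extend[OF e z(1,2) ze] unfolding f_def N[symmetric] .
    have fe: "f a = e a" if "a < 2 * p" for a using that by (simp add: f_def)
    have fz: "f (2 * p) = z" by (simp add: f_def)
    have Kz: "K *\<^sub>v z \<in> carrier_vec N" using K z(1) by simp
    have Kzf: "(K *\<^sub>v z) \<bullet> f a = 0" if a: "a < N" for a
    proof (cases "a = 2 * p")
      case True
      then show ?thesis using fz skew_scalar_prod_self[OF K z(1)] by simp
    next
      case False
      then have a2: "a < 2 * p" using a N by simp
      define i where "i = a div 2"
      have i: "i < p" "a = 2 * i \<or> a = 2 * i + 1" using a2 unfolding i_def by auto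
      then have i2: "2 * i < 2 * p" "2 * i + 1 < 2 * p" by auto
      have "z \<bullet> (K *\<^sub>v e a) = 0"
        using i(2) s0 i(1) ze i2 z(1) orthonormal_famD(1)[OF e]
        by (auto simp: scalar_prod_smult_distrib[of _ N])
      then show ?thesis
        using skew_scalar_prod[OF K z(1) orthonormal_famD(1)[OF e a2]] fe[OF a2] by simp
    qed
    have "(K *\<^sub>v z) \<bullet> (K *\<^sub>v z) = 0"
      using parseval_fam[OF f Kz Kz] Kzf by simp
    then have "K *\<^sub>v f (N - 1) = 0\<^sub>v N"
      using scalar_prod_self_eq_0[OF Kz] fz N by simp
    moreover have "\<forall>i<p. 0 \<le> s i \<and> K *\<^sub>v f (2 * i) = s i \<cdot>\<^sub>v f (2 * i + 1) \<and>
        K *\<^sub>v f (2 * i + 1) = (- s i) \<cdot>\<^sub>v f (2 * i)"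
    proof (intro allI impI)
      fix i assume i: "i < p"
      then have "2 * i < 2 * p" "2 * i + 1 < 2 * p" by auto
      then show "0 \<le> s i \<and> K *\<^sub>v f (2 * i) = s i \<cdot>\<^sub>v f (2 * i + 1) \<and>
        K *\<^sub>v f (2 * i + 1) = (- s i) \<cdot>\<^sub>v f (2 * i)" using s0 i fe by metis
    qed
    ultimately have "skew_basis N K f s"
      unfolding skew_basis_def p_def[symmetric] using f anti by blast
    then show ?thesis by blast
  qed
qed

context
  fixes N K e s
  assumes K: "K \<in> carrier_mat N N" "transpose_mat K = - K" and basis: "skew_basis N K e s"
begin

lemma skew_fam: "orthonormal_fam N N e"
  using basis by (simp add: skew_basis_def)

lemma skew_gram_carrier: "transpose_mat K * K \<in> carrier_mat N N"
  "transpose_mat (transpose_mat K * K) = transpose_mat K * K"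
  using K(1) by (auto simp: transpose_mult[of _ N N])

lemma skew_gram_mult:
  assumes "y \<in> carrier_vec N"
  shows "(transpose_mat K * K) *\<^sub>v y = - (K *\<^sub>v (K *\<^sub>v y))"
  using K assms by (simp add: assoc_mult_mat_vec[of _ N N _ N] uminus_mult_mat_vec)

lemma skew_gram_quadratic:
  assumes y: "y \<in> carrier_vec N"
  shows "y \<bullet> ((transpose_mat K * K) *\<^sub>v y) = (K *\<^sub>v y) \<bullet> (K *\<^sub>v y)"
proof -
  have c: "K *\<^sub>v y \<in> carrier_vec N" "K *\<^sub>v (K *\<^sub>v y) \<in> carrier_vec N" using K y by auto
  show ?thesis
    using skew_scalar_prod[OF K y c(1)] skew_gram_mult[OF y] carrier_vecD[OF y] carrier_vecD[OF c(2)]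
    by simp
qed

lemma skew_pair:
  assumes "i < N div 2"
  shows "0 \<le> s i" "K *\<^sub>v e (2 * i) = s i \<cdot>\<^sub>v e (2 * i + 1)"
    "K *\<^sub>v e (2 * i + 1) = (- s i) \<cdot>\<^sub>v e (2 * i)"
  using basis assms by (auto simp: skew_basis_def)

lemma skew_gram_eigen:
  assumes a: "a < N"
  shows "(transpose_mat K * K) *\<^sub>v e a = gram_eigenvalue N s a \<cdot>\<^sub>v e a"
proof -
  have ea: "e a \<in> carrier_vec N" using orthonormal_famD(1)[OF skew_fam a] .
  show ?thesis
  proof (cases "a div 2 < N div 2")
    case True
    define i where "i = a div 2"
    have i: "i < N div 2" "a = 2 * i \<or> a = 2 * i + 1" using True unfolding i_def by auto
    then have i2: "2 * i < N" "2 * i + 1 < N" by auto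
    have c: "e (2 * i) \<in> carrier_vec N" "e (2 * i + 1) \<in> carrier_vec N"
      using orthonormal_famD(1)[OF skew_fam] i2 by auto
    have "K *\<^sub>v (K *\<^sub>v e a) = - ((s i)\<^sup>2 \<cdot>\<^sub>v e a)"
      using i(2) skew_pair[OF i(1)] K c
      by (auto simp: mult_mat_vec[of _ N N] power2_eq_square intro!: eq_vecI)
    then show ?thesis using skew_gram_mult[OF ea] True ea by (simp add: gram_eigenvalue_def i_def)
  next
    case False
    then have "odd N" "a = N - 1" using a by presburger+
    then have "K *\<^sub>v e a = 0\<^sub>v N" using basis by (simp add: skew_basis_def)
    then have "K *\<^sub>v (K *\<^sub>v e a) = 0\<^sub>v N" using K by (auto intro!: eq_vecI)
    then show ?thesis using skew_gram_mult[OF ea] False ea by (auto simp: gram_eigenvalue_def)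
  qed
qed

lemma gram_eigenvalue_antitone: "a \<le> b \<Longrightarrow> gram_eigenvalue N s b \<le> gram_eigenvalue N s a"
proof -
  assume "a \<le> b"
  then have ab: "a div 2 \<le> b div 2" by (rule div_le_mono)
  show ?thesis
  proof (cases "b div 2 < N div 2")
    case True
    then have "s (b div 2) \<le> s (a div 2)" using basis ab by (simp add: skew_basis_def)
    then show ?thesis using skew_pair(1)[OF True] ab True by (simp add: gram_eigenvalue_def power_mono)
  next
    case False
    then show ?thesis by (simp add: gram_eigenvalue_def)
  qed
qed

lemma skew_ky_fan:
  assumes U: "orthonormal N U"
  shows "(\<Sum>u\<in>U. (K *\<^sub>v u) \<bullet> (K *\<^sub>v u)) \<le> (\<Sum>a<card U. gram_eigenvalue N s a)"
proof -
  have "(\<Sum>u\<in>U. (K *\<^sub>v u) \<bullet> (K *\<^sub>v u)) = (\<Sum>u\<in>U. u \<bullet> ((transpose_mat K * K) *\<^sub>v u))"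
    using skew_gram_quadratic orthonormalD(2)[OF U] by simp
  also have "\<dots> \<le> (\<Sum>a<card U. gram_eigenvalue N s a)"
    by (rule ky_fan[OF skew_gram_carrier skew_fam skew_gram_eigen gram_eigenvalue_antitone U])
  finally show ?thesis .
qed

lemma gram_eigenvalue_nonneg: "0 \<le> gram_eigenvalue N s a"
  by (simp add: gram_eigenvalue_def)

lemma gram_eigenvalue_beyond: "N \<le> a \<Longrightarrow> gram_eigenvalue N s a = 0"
  by (auto simp: gram_eigenvalue_def dest: div_le_mono[of N a 2])

text \<open>
  Let \<open>F\<close> be an orthonormal basis of the span of \<open>K U\<close>; isotropy makes \<open>U \<union> F\<close> orthonormal.  As \<open>K\<close> is
  skew, \<open>F\<close> contributes at least as much as \<open>U\<close>: the matrix coefficients of \<open>K\<close> between \<open>U\<close> and \<open>F\<close>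
  account for all of \<open>K U\<close> but only for a part of \<open>K F\<close>.  Ky Fan for \<open>U \<union> F\<close>, which has at most
  \<open>2 card U\<close> elements, gives the bound.
\<close>

theorem isotropic_ky_fan:
  assumes U: "orthonormal N U" and iso: "\<forall>u\<in>U. \<forall>v\<in>U. u \<bullet> (K *\<^sub>v v) = 0"
  shows "2 * (\<Sum>u\<in>U. (K *\<^sub>v u) \<bullet> (K *\<^sub>v u)) \<le> (\<Sum>a<2 * card U. gram_eigenvalue N s a)"
proof -
  let ?G = "(\<lambda>u. K *\<^sub>v u) ` U"
  have G: "finite ?G" "?G \<subseteq> carrier_vec N" using orthonormalD(1,2)[OF U] K by auto
  obtain F where F: "orthonormal N F" "card F \<le> card ?G"
    and FG: "\<forall>g\<in>?G. (\<Sum>f\<in>F. (g \<bullet> f)\<^sup>2) = g \<bullet> g"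
    and perp: "\<forall>x\<in>carrier_vec N. (\<forall>g\<in>?G. x \<bullet> g = 0) \<longrightarrow> (\<forall>f\<in>F. x \<bullet> f = 0)"
    using orthonormal_span[OF G] by blast
  have cardF: "card F \<le> card U" using F(2) card_image_le[OF orthonormalD(1)[OF U], of "(*\<^sub>v) K"] by linarith
  \<comment> \<open>isotropy: \<open>U\<close> is orthogonal to \<open>K U\<close>, hence to its span\<close>
  have UF: "\<forall>u\<in>U. \<forall>f\<in>F. u \<bullet> f = 0" using perp iso orthonormalD(2)[OF U] by simp
  note un = orthonormal_Un[OF U F(1) UF]
  have "(\<Sum>u\<in>U. (K *\<^sub>v u) \<bullet> (K *\<^sub>v u)) = (\<Sum>u\<in>U. \<Sum>f\<in>F. ((K *\<^sub>v u) \<bullet> f)\<^sup>2)"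
    using FG by simp
  also have "\<dots> = (\<Sum>f\<in>F. \<Sum>u\<in>U. ((K *\<^sub>v u) \<bullet> f)\<^sup>2)" by (rule sum.swap)
  also have "\<dots> \<le> (\<Sum>f\<in>F. (K *\<^sub>v f) \<bullet> (K *\<^sub>v f))"
  proof (rule sum_mono)
    fix f assume f: "f \<in> F"
    have fc: "f \<in> carrier_vec N" using orthonormalD(2)[OF F(1) f] .
    have Kf: "K *\<^sub>v f \<in> carrier_vec N" using K fc by simp
    have "(\<Sum>u\<in>U. ((K *\<^sub>v u) \<bullet> f)\<^sup>2) = (\<Sum>u\<in>U. ((K *\<^sub>v f) \<bullet> u)\<^sup>2)"
    proof (rule sum.cong[OF refl])
      fix u assume "u \<in> U"
      then have u: "u \<in> carrier_vec N" using orthonormalD(2)[OF U] by simp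
      show "((K *\<^sub>v u) \<bullet> f)\<^sup>2 = ((K *\<^sub>v f) \<bullet> u)\<^sup>2"
        using skew_scalar_prod[OF K u fc] scalar_prod_comm_carrier[OF u Kf] by simp
    qed
    also have "\<dots> \<le> (K *\<^sub>v f) \<bullet> (K *\<^sub>v f)" by (rule bessel[OF U Kf])
    finally show "(\<Sum>u\<in>U. ((K *\<^sub>v u) \<bullet> f)\<^sup>2) \<le> (K *\<^sub>v f) \<bullet> (K *\<^sub>v f)" .
  qed
  finally have "2 * (\<Sum>u\<in>U. (K *\<^sub>v u) \<bullet> (K *\<^sub>v u))
      \<le> (\<Sum>u\<in>U. (K *\<^sub>v u) \<bullet> (K *\<^sub>v u)) + (\<Sum>f\<in>F. (K *\<^sub>v f) \<bullet> (K *\<^sub>v f))" by simp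
  also have "\<dots> = (\<Sum>u\<in>U \<union> F. (K *\<^sub>v u) \<bullet> (K *\<^sub>v u))"
    by (rule sum.union_disjoint[symmetric]) (use un(2) orthonormalD(1) U F(1) in auto)
  also have "\<dots> \<le> (\<Sum>a<card (U \<union> F). gram_eigenvalue N s a)" by (rule skew_ky_fan[OF un(1)])
  also have "\<dots> \<le> (\<Sum>a<2 * card U. gram_eigenvalue N s a)"
  proof (rule sum_mono2)
    have "card (U \<union> F) \<le> 2 * card U" using card_Un_le[of U F] cardF by linarith
    then show "{..<card (U \<union> F)} \<subseteq> {..<2 * card U}" by auto
  qed (auto simp: gram_eigenvalue_nonneg)
  finally show ?thesis .
qed

end

section \<open>The transposed commutator as a skew-symmetric matrix\<close>

text \<open>
  Reading a matrix row by row turns the Frobenius inner product into the scalar product; the indexing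
  is the one of \<^const>\<open>matrix_of_op\<close>.
\<close>

definition vecm :: "nat \<Rightarrow> real mat \<Rightarrow> real vec" where
  "vecm n Y = vec (n * n) (\<lambda>p. Y $$ (p div n, p mod n))"

definition matv :: "nat \<Rightarrow> real vec \<Rightarrow> real mat" where
  "matv n x = mat n n (\<lambda>(i, j). x $ (i * n + j))"

text \<open>
  The matrix of the skew-symmetric map \<open>Y \<mapsto> [B, Y]\<^sup>T\<close>.
\<close>

definition ad_transpose :: "nat \<Rightarrow> real mat \<Rightarrow> real mat" where
  "ad_transpose n B = matrix_of_op n (\<lambda>Y. transpose_mat (comm B Y))"

lemma index_less:
  fixes i j n :: nat
  assumes "i < n" "j < n"
  shows "i * n + j < n * n"
proof -
  have "i * n + j < (i + 1) * n" using assms by simp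
  also have "\<dots> \<le> n * n" using assms by (intro mult_right_mono) auto
  finally show ?thesis .
qed

lemma index_div_mod:
  fixes p n :: nat
  assumes "p < n * n"
  shows "p div n < n" "p mod n < n"
proof -
  have "n > 0" using assms by (cases n) auto
  then show "p div n < n" "p mod n < n" using assms by (auto simp: less_mult_imp_div_less)
qed

lemma sum_index_pairs:
  fixes f :: "nat \<Rightarrow> nat \<Rightarrow> real"
  shows "(\<Sum>p<n * n. f (p div n) (p mod n)) = (\<Sum>i<n. \<Sum>j<n. f i j)"
  unfolding sum.cartesian_product
  by (rule sum.reindex_bij_witness[of _ "\<lambda>(i, j). i * n + j" "\<lambda>p. (p div n, p mod n)"])
    (use index_div_mod index_less in auto)

lemma vecm_carrier [simp]: "vecm n Y \<in> carrier_vec (n * n)"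
  by (simp add: vecm_def)

lemma matv_carrier [simp]: "matv n x \<in> carrier_mat n n"
  by (simp add: matv_def)

lemma matv_vecm: "Y \<in> carrier_mat n n \<Longrightarrow> matv n (vecm n Y) = Y"
  by (rule eq_matI) (auto simp: matv_def vecm_def index_less)

lemma vecm_matv: "x \<in> carrier_vec (n * n) \<Longrightarrow> vecm n (matv n x) = x"
  by (rule eq_vecI) (auto simp: matv_def vecm_def index_div_mod)

lemma vecm_scalar_prod: "vecm n X \<bullet> vecm n Y = (\<Sum>i<n. \<Sum>j<n. X $$ (i, j) * Y $$ (i, j))"
  using sum_index_pairs[of "\<lambda>i j. X $$ (i, j) * Y $$ (i, j)" n]
  by (simp add: vecm_def scalar_prod_def atLeast0LessThan)

lemma mtrace_mult:
  assumes "X \<in> carrier_mat n n" "Y \<in> carrier_mat n n"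
  shows "mtrace (X * Y) = vecm n X \<bullet> vecm n (transpose_mat Y)"
  using assms unfolding vecm_scalar_prod by (simp add: mtrace_def scalar_prod_def atLeast0LessThan)

lemma mtrace_mult_transpose:
  assumes "X \<in> carrier_mat n n" "Y \<in> carrier_mat n n"
  shows "mtrace (X * transpose_mat Y) = vecm n X \<bullet> vecm n Y"
  using mtrace_mult[of X n "transpose_mat Y"] assms by simp

lemma fnorm_square:
  assumes "X \<in> carrier_mat n n"
  shows "(fnorm X)\<^sup>2 = vecm n X \<bullet> vecm n X"
  using mtrace_mult_transpose[OF assms assms] scalar_prod_self_nonneg by (simp add: fnorm_def)

lemma comm_carrier [simp]:
  "X \<in> carrier_mat n n \<Longrightarrow> Y \<in> carrier_mat n n \<Longrightarrow> comm X Y \<in> carrier_mat n n"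
  unfolding comm_def by (intro minus_carrier_mat mult_carrier_mat)

lemma comm_entry:
  assumes "X \<in> carrier_mat n n" "Y \<in> carrier_mat n n" "i < n" "j < n"
  shows "comm X Y $$ (i, j) = (\<Sum>k<n. X $$ (i, k) * Y $$ (k, j)) - (\<Sum>k<n. Y $$ (i, k) * X $$ (k, j))"
  using assms by (simp add: comm_def scalar_prod_def atLeast0LessThan)

lemma unit_matrix_carrier [simp]: "unit_matrix n k l \<in> carrier_mat n n"
  by (simp add: unit_matrix_def)

lemma comm_unit_matrix:
  assumes B: "B \<in> carrier_mat n n" and ij: "i < n" "j < n" and kl: "k < n" "l < n"
  shows "comm B (unit_matrix n k l) $$ (i, j) =
    (if j = l then B $$ (i, k) else 0) - (if i = k then B $$ (l, j) else 0)"
proof -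
  have "(\<Sum>r<n. B $$ (i, r) * unit_matrix n k l $$ (r, j)) =
      (\<Sum>r<n. if r = k then (if j = l then B $$ (i, k) else 0) else 0)"
    by (rule sum.cong) (use ij in \<open>auto simp: unit_matrix_def\<close>)
  moreover have "(\<Sum>r<n. unit_matrix n k l $$ (i, r) * B $$ (r, j)) =
      (\<Sum>r<n. if r = l then (if i = k then B $$ (l, j) else 0) else 0)"
    by (rule sum.cong) (use ij in \<open>auto simp: unit_matrix_def\<close>)
  ultimately show ?thesis using comm_entry[OF B unit_matrix_carrier ij, of k l] kl by simp
qed

lemma ad_transpose_carrier [simp]: "ad_transpose n B \<in> carrier_mat (n * n) (n * n)"
  by (simp add: ad_transpose_def matrix_of_op_def)

lemma ad_transpose_entry:
  assumes B: "B \<in> carrier_mat n n" and p: "p < n * n" and q: "q < n * n"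
  shows "ad_transpose n B $$ (p, q) =
    (if p div n = q mod n then B $$ (p mod n, q div n) else 0) -
    (if p mod n = q div n then B $$ (q mod n, p div n) else 0)"
proof -
  let ?C = "comm B (unit_matrix n (q div n) (q mod n))"
  have "ad_transpose n B $$ (p, q) = transpose_mat ?C $$ (p div n, p mod n)"
    using p q by (simp add: ad_transpose_def matrix_of_op_def)
  also have "\<dots> = ?C $$ (p mod n, p div n)"
    using carrier_matD[OF comm_carrier[OF B unit_matrix_carrier]] index_div_mod[OF p] by simp
  finally show ?thesis
    using comm_unit_matrix[OF B index_div_mod(2,1)[OF p] index_div_mod[OF q]] by simp
qed

lemma ad_transpose_skew:
  assumes B: "B \<in> carrier_mat n n"
  shows "transpose_mat (ad_transpose n B) = - ad_transpose n B"
proof (rule eq_matI)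
  fix p q assume "p < dim_row (- ad_transpose n B)" "q < dim_col (- ad_transpose n B)"
  then have pq: "p < n * n" "q < n * n"
    using carrier_matD[OF ad_transpose_carrier[of n B]] by simp_all
  then show "transpose_mat (ad_transpose n B) $$ (p, q) = (- ad_transpose n B) $$ (p, q)"
    using carrier_matD[OF ad_transpose_carrier[of n B]]
    by (simp add: ad_transpose_entry[OF B])
qed (use carrier_matD[OF ad_transpose_carrier[of n B]] in simp_all)

lemma ad_transpose_vecm:
  assumes B: "B \<in> carrier_mat n n" and Y: "Y \<in> carrier_mat n n"
  shows "ad_transpose n B *\<^sub>v vecm n Y = vecm n (transpose_mat (comm B Y))"
proof (rule eq_vecI)
  note dims = carrier_matD[OF ad_transpose_carrier[of n B]]
  fix p assume "p < dim_vec (vecm n (transpose_mat (comm B Y)))"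
  then have p: "p < n * n" by (simp add: vecm_def)
  define i j where "i = p div n" and "j = p mod n"
  have ij: "i < n" "j < n" using index_div_mod[OF p] by (auto simp: i_def j_def)
  have "(ad_transpose n B *\<^sub>v vecm n Y) $ p =
      (\<Sum>q<n * n. ((if i = q mod n then B $$ (j, q div n) else 0) -
        (if j = q div n then B $$ (q mod n, i) else 0)) * Y $$ (q div n, q mod n))"
    unfolding i_def j_def
    using p dims by (simp add: scalar_prod_def atLeast0LessThan ad_transpose_entry[OF B] vecm_def)
  also have "\<dots> = (\<Sum>k<n. \<Sum>l<n. ((if i = l then B $$ (j, k) else 0) -
        (if j = k then B $$ (l, i) else 0)) * Y $$ (k, l))"
    by (rule sum_index_pairs)
  also have "\<dots> = (\<Sum>k<n. \<Sum>l<n. if i = l then B $$ (j, k) * Y $$ (k, l) else 0) -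
      (\<Sum>k<n. \<Sum>l<n. if j = k then Y $$ (k, l) * B $$ (l, i) else 0)"
    unfolding sum_subtractf[symmetric]
    by (intro sum.cong refl) (auto simp: left_diff_distrib)
  also have "(\<Sum>k<n. \<Sum>l<n. if i = l then B $$ (j, k) * Y $$ (k, l) else 0) =
      (\<Sum>k<n. B $$ (j, k) * Y $$ (k, i))"
    using ij by simp
  also have "(\<Sum>k<n. \<Sum>l<n. if j = k then Y $$ (k, l) * B $$ (l, i) else 0) =
      (\<Sum>l<n. Y $$ (j, l) * B $$ (l, i))"
    using ij by (subst sum.swap) simp
  finally have "(ad_transpose n B *\<^sub>v vecm n Y) $ p = comm B Y $$ (j, i)"
    using comm_entry[OF B Y ij(2,1)] by simp
  then show "(ad_transpose n B *\<^sub>v vecm n Y) $ p = vecm n (transpose_mat (comm B Y)) $ p"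
    using p ij carrier_matD[OF comm_carrier[OF B Y]] by (simp add: vecm_def i_def j_def)
qed (use carrier_matD[OF ad_transpose_carrier[of n B]] in \<open>simp add: vecm_def\<close>)

lemma comm_norm:
  assumes B: "B \<in> carrier_mat n n" and Y: "Y \<in> carrier_mat n n"
  shows "(fnorm (comm B Y))\<^sup>2 = (ad_transpose n B *\<^sub>v vecm n Y) \<bullet> (ad_transpose n B *\<^sub>v vecm n Y)"
proof -
  note C = comm_carrier[OF B Y]
  have "vecm n (comm B Y) \<bullet> vecm n (comm B Y) =
      vecm n (transpose_mat (comm B Y)) \<bullet> vecm n (transpose_mat (comm B Y))"
    unfolding vecm_scalar_prod using C by (subst sum.swap) simp
  then show ?thesis using fnorm_square[OF C] by (simp add: ad_transpose_vecm[OF B Y])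
qed

lemma mtrace_mult_comm:
  assumes "A \<in> carrier_mat n n" and B: "B \<in> carrier_mat n n" and Y: "Y \<in> carrier_mat n n"
  shows "mtrace (A * comm B Y) = vecm n A \<bullet> (ad_transpose n B *\<^sub>v vecm n Y)"
  using mtrace_mult[OF assms(1) comm_carrier[OF B Y]] by (simp add: ad_transpose_vecm[OF B Y])

text \<open>
  This identity turns \<open>[X\<^sup>T, [X, Y]]\<close> into minus the square of \<open>Y \<mapsto> [X, Y]\<^sup>T\<close>.
\<close>

lemma comm_transpose:
  assumes X: "X \<in> carrier_mat n n" and Z: "Z \<in> carrier_mat n n"
  shows "transpose_mat (comm X (transpose_mat Z)) = - comm (transpose_mat X) Z"
proof (rule eq_matI)
  have c: "comm X (transpose_mat Z) \<in> carrier_mat n n" "comm (transpose_mat X) Z \<in> carrier_mat n n"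
    using X Z by auto
  fix i j assume "i < dim_row (- comm (transpose_mat X) Z)" "j < dim_col (- comm (transpose_mat X) Z)"
  then have ij: "i < n" "j < n" using carrier_matD[OF c(2)] by auto
  then show "transpose_mat (comm X (transpose_mat Z)) $$ (i, j) = (- comm (transpose_mat X) Z) $$ (i, j)"
    using X Z carrier_matD[OF c(1)] carrier_matD[OF c(2)]
      comm_entry[of X n "transpose_mat Z" j i] comm_entry[of "transpose_mat X" n Z i j]
    by (simp add: mult.commute)
qed (use X Z carrier_matD[OF comm_carrier[of "transpose_mat X" n Z]]
    carrier_matD[OF comm_carrier[of X n "transpose_mat Z"]] in simp_all)

text \<open>
  \<open>T_op X\<close> is minus the square of the skew-symmetric map \<open>Y \<mapsto> [X, Y]\<^sup>T\<close>.
\<close>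

lemma matrix_of_T_op:
  assumes X: "X \<in> carrier_mat n n"
  shows "matrix_of_op n (T_op X) = transpose_mat (ad_transpose n X) * ad_transpose n X"
proof (rule eq_matI)
  let ?K = "ad_transpose n X"
  note K = ad_transpose_carrier[of n X]
  fix p q assume "p < dim_row (transpose_mat ?K * ?K)" "q < dim_col (transpose_mat ?K * ?K)"
  then have p: "p < n * n" and q: "q < n * n" using carrier_matD[OF K] by auto
  define Y where "Y = unit_matrix n (q div n) (q mod n)"
  have Y: "Y \<in> carrier_mat n n" by (simp add: Y_def)
  have C: "comm X Y \<in> carrier_mat n n" using X Y by simp
  have D: "comm (transpose_mat X) (comm X Y) \<in> carrier_mat n n" using X C by simp
  have u: "vecm n Y = unit_vec (n * n) q"
  proof (rule eq_vecI)
    fix r assume "r < dim_vec (unit_vec (n * n) q)"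
    then have r: "r < n * n" by simp
    have "r = q \<longleftrightarrow> r div n = q div n \<and> r mod n = q mod n" by (metis div_mult_mod_eq)
    then show "vecm n Y $ r = unit_vec (n * n) q $ r"
      using r q index_div_mod[OF r] by (auto simp: vecm_def Y_def unit_matrix_def unit_vec_def)
  qed (simp add: vecm_def)
  have KK: "?K *\<^sub>v (?K *\<^sub>v vecm n Y) = vecm n (- T_op X Y)"
    using comm_transpose[OF X C] by (simp add: ad_transpose_vecm[OF X] Y C T_op_def)
  have "(transpose_mat ?K * ?K) $$ (p, q) = ((transpose_mat ?K * ?K) *\<^sub>v unit_vec (n * n) q) $ p"
  proof -
    have entry: "M $$ (p, q) = (M *\<^sub>v unit_vec (n * n) q) $ p"
      if "M \<in> carrier_mat (n * n) (n * n)" for M :: "real mat"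
      using that p q by simp
    show ?thesis
      by (rule entry, rule mult_carrier_mat[OF transpose_carrier_mat[THEN iffD2, OF K] K])
  qed
  also have "(transpose_mat ?K * ?K) *\<^sub>v unit_vec (n * n) q = - (?K *\<^sub>v (?K *\<^sub>v vecm n Y))"
    using K by (simp add: assoc_mult_mat_vec[of _ "n * n" "n * n" _ "n * n"] uminus_mult_mat_vec
        carrier_matD[OF K] ad_transpose_skew[OF X] u)
  also have "\<dots> $ p = T_op X Y $$ (p div n, p mod n)"
    unfolding KK using p index_div_mod[OF p] D by (simp add: vecm_def T_op_def)
  finally show "matrix_of_op n (T_op X) $$ (p, q) = (transpose_mat ?K * ?K) $$ (p, q)"
    using p q by (simp add: matrix_of_op_def Y_def)
qed (use carrier_matD[OF ad_transpose_carrier[of n X]] in \<open>simp_all add: matrix_of_op_def\<close>)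

text \<open>
  The squared Hilbert-Schmidt norm of \<open>Y \<mapsto> [B, Y]\<close> is \<open>2 n \<parallel>B\<parallel>\<^sup>2 - 2 (Tr B)\<^sup>2\<close>.
\<close>

lemma trace_ad_transpose_le:
  assumes B: "B \<in> carrier_mat n n"
  shows "(\<Sum>q<n * n. (transpose_mat (ad_transpose n B) * ad_transpose n B) $$ (q, q)) \<le> 2 * real n * (fnorm B)\<^sup>2"
proof -
  let ?K = "ad_transpose n B"
  note K = carrier_matD[OF ad_transpose_carrier[of n B]]
  define f where "f i j k l = ((if i = l then B $$ (j, k) else 0) - (if j = k then B $$ (l, i) else 0))\<^sup>2"
    for i j k l
  have "(\<Sum>q<n * n. (transpose_mat ?K * ?K) $$ (q, q)) = (\<Sum>q<n * n. \<Sum>p<n * n. (?K $$ (p, q))\<^sup>2)"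
    using K by (simp add: scalar_prod_def atLeast0LessThan power2_eq_square)
  also have "\<dots> = (\<Sum>q<n * n. \<Sum>p<n * n. f (p div n) (p mod n) (q div n) (q mod n))"
    by (intro sum.cong refl) (simp add: ad_transpose_entry[OF B] f_def)
  also have "\<dots> = (\<Sum>q<n * n. \<Sum>i<n. \<Sum>j<n. f i j (q div n) (q mod n))"
    by (intro sum.cong refl sum_index_pairs)
  also have "\<dots> = (\<Sum>k<n. \<Sum>l<n. \<Sum>i<n. \<Sum>j<n. f i j k l)"
    by (rule sum_index_pairs)
  also have "\<dots> = (\<Sum>k<n. \<Sum>l<n. \<Sum>i<n. \<Sum>j<n.
      (if i = l then (B $$ (j, k))\<^sup>2 else 0) + (if j = k then (B $$ (l, i))\<^sup>2 else 0)
      - 2 * (if i = l then if j = k then B $$ (j, k) * B $$ (l, i) else 0 else 0))"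
    by (intro sum.cong refl) (auto simp: f_def power2_diff)
  also have "\<dots> = (\<Sum>k<n. \<Sum>l<n. (\<Sum>j<n. (B $$ (j, k))\<^sup>2)) + (\<Sum>k<n. \<Sum>l<n. \<Sum>i<n. (B $$ (l, i))\<^sup>2)
      - 2 * (\<Sum>k<n. \<Sum>l<n. B $$ (k, k) * B $$ (l, l))"
  proof -
    have "(\<Sum>i<n. \<Sum>j<n. if i = l then (B $$ (j, k))\<^sup>2 else 0) = (\<Sum>j<n. (B $$ (j, k))\<^sup>2)"
      if "l < n" for k l
      using that by (subst sum.swap) simp
    moreover have "(\<Sum>i<n. \<Sum>j<n. if i = l then if j = k then B $$ (j, k) * B $$ (l, i) else 0 else 0)
        = B $$ (k, k) * B $$ (l, l)" if "k < n" "l < n" for k l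
      using that by (subst sum.swap) simp
    ultimately show ?thesis
      by (simp add: sum.distrib sum_subtractf sum_distrib_left[symmetric])
  qed
  also have "\<dots> = 2 * real n * (fnorm B)\<^sup>2 - 2 * (\<Sum>k<n. B $$ (k, k))\<^sup>2"
  proof -
    have "(\<Sum>k<n. \<Sum>j<n. (B $$ (j, k))\<^sup>2) = (fnorm B)\<^sup>2"
      unfolding fnorm_square[OF B] vecm_scalar_prod
      unfolding power2_eq_square by (rule sum.swap)
    moreover have "(\<Sum>l<n. \<Sum>i<n. (B $$ (l, i))\<^sup>2) = (fnorm B)\<^sup>2"
      unfolding fnorm_square[OF B] vecm_scalar_prod
      unfolding power2_eq_square ..
    ultimately show ?thesis
      by (simp add: sum_distrib_left[symmetric] sum_distrib_right[symmetric]
          power2_eq_square[of "\<Sum>k<n. B $$ (k, k)"])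
  qed
  finally show ?thesis by simp
qed

section \<open>Partial sums of eigenvalues and weak majorization\<close>

lemma decr_eigenvalues:
  assumes X: "X \<in> carrier_mat n n" and b: "skew_basis (n * n) (ad_transpose n X) e s"
  shows "eigenvalues_op n (T_op X) = mset (map (gram_eigenvalue (n * n) s) [0..<n * n])"
    "decr (eigenvalues_op n (T_op X)) = map (gram_eigenvalue (n * n) s) [0..<n * n]"
proof -
  note K = ad_transpose_carrier[of n X] ad_transpose_skew[OF X]
  show *: "eigenvalues_op n (T_op X) = mset (map (gram_eigenvalue (n * n) s) [0..<n * n])"
    unfolding eigenvalues_op_def matrix_of_T_op[OF X]
    by (rule proots_char_poly_eigenbasis[OF skew_gram_carrier(1)[OF K b] skew_fam[OF K b]
          skew_gram_eigen[OF K b]])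
  show "decr (eigenvalues_op n (T_op X)) = map (gram_eigenvalue (n * n) s) [0..<n * n]"
    unfolding * by (rule decr_mset_antitone[OF gram_eigenvalue_antitone[OF K b]])
qed

lemma skew_basis_ad_exists:
  assumes X: "X \<in> carrier_mat n n"
  obtains e s where "skew_basis (n * n) (ad_transpose n X) e s"
  using skew_basis_exists[OF ad_transpose_carrier ad_transpose_skew[OF X]] by blast

lemma lam_gram_eigenvalue:
  assumes "X \<in> carrier_mat n n" "skew_basis (n * n) (ad_transpose n X) e s" "i < n * n"
  shows "lam n X (Suc i) = gram_eigenvalue (n * n) s i"
  using assms decr_eigenvalues(2)[OF assms(1,2)] by (simp add: lam_def)

lemma sum_lam:
  assumes "X \<in> carrier_mat n n" "skew_basis (n * n) (ad_transpose n X) e s" "k \<le> n * n"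
  shows "(\<Sum>i=1..k. lam n X i) = (\<Sum>a<k. gram_eigenvalue (n * n) s a)"
proof -
  have "(\<Sum>i=1..k. lam n X i) = (\<Sum>i<k. lam n X (Suc i))" by (simp add: sum.atLeast1_atMost_eq)
  also have "\<dots> = (\<Sum>a<k. gram_eigenvalue (n * n) s a)"
    by (rule sum.cong[OF refl]) (use assms lam_gram_eigenvalue[OF assms(1,2)] in auto)
  finally show ?thesis .
qed

lemma C4I:
  assumes "\<And>n X e s k. 2 \<le> n \<Longrightarrow> X \<in> carrier_mat n n \<Longrightarrow> fnorm X = 1 \<Longrightarrow>
    skew_basis (n * n) (ad_transpose n X) e s \<Longrightarrow> 1 \<le> k \<Longrightarrow> k \<le> (n * n) div 2 \<Longrightarrow>
    (\<Sum>a<2 * k. gram_eigenvalue (n * n) s a) \<le> 2 * real k + 2"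
  shows C4
  unfolding C4_def
proof (intro allI impI ballI)
  fix n :: nat and X k assume h: "2 \<le> n" "X \<in> carrier_mat n n" "fnorm X = 1" "k \<in> {1..n\<^sup>2 div 2}"
  obtain e s where b: "skew_basis (n * n) (ad_transpose n X) e s" using skew_basis_ad_exists[OF h(2)] .
  have k: "1 \<le> k" "k \<le> (n * n) div 2" "2 * k \<le> n * n" using h(4) by (auto simp: power2_eq_square)
  show "(\<Sum>i=1..2 * k. lam n X i) \<le> 2 * real k + 2"
    unfolding sum_lam[OF h(2) b k(3)] by (rule assms[OF h(1-3) b k(1,2)])
qed

text \<open>
  The restriction \<open>2 k \<le> n\<^sup>2\<close> of \<open>C4\<close> disappears, because all entries beyond the last pair are zero.
\<close>

lemma C4_even_prefix:
  assumes C4 "2 \<le> n" "X \<in> carrier_mat n n" "fnorm X = 1"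
    and b: "skew_basis (n * n) (ad_transpose n X) e s"
  shows "(\<Sum>a<2 * k. gram_eigenvalue (n * n) s a) \<le> 2 * real k + 2"
proof -
  have small: "(\<Sum>a<2 * k. gram_eigenvalue (n * n) s a) \<le> 2 * real k + 2" if k: "k \<le> (n * n) div 2" for k
  proof (cases "k = 0")
    case False
    then have "k \<in> {1..n\<^sup>2 div 2}" "2 * k \<le> n * n" using k by (auto simp: power2_eq_square)
    then show ?thesis using assms(1-4) sum_lam[OF assms(3) b] unfolding C4_def by metis
  qed simp
  define p where "p = (n * n) div 2"
  show ?thesis
  proof (cases "k \<le> p")
    case True
    then show ?thesis using small by (simp add: p_def)
  next
    case False
    have "(\<Sum>a<2 * k. gram_eigenvalue (n * n) s a) = (\<Sum>a<2 * p. gram_eigenvalue (n * n) s a)"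
    proof (rule sum.mono_neutral_right)
      show "\<forall>a\<in>{..<2 * k} - {..<2 * p}. gram_eigenvalue (n * n) s a = 0"
      proof
        fix a assume "a \<in> {..<2 * k} - {..<2 * p}"
        then have "\<not> a div 2 < p" by auto
        then show "gram_eigenvalue (n * n) s a = 0" by (simp add: gram_eigenvalue_def p_def)
      qed
    qed (use False in auto)
    also have "\<dots> \<le> 2 * real p + 2" by (rule small) (simp add: p_def)
    finally show ?thesis using False by simp
  qed
qed

text \<open>
  An odd partial sum is the mean of the two neighbouring even ones, since the two eigenvalues of a
  pair agree.
\<close>

lemma C4_prefix:
  assumes "C4" "2 \<le> n" "X \<in> carrier_mat n n" "fnorm X = 1"
    and b: "skew_basis (n * n) (ad_transpose n X) e s"
  shows "(\<Sum>a<k. gram_eigenvalue (n * n) s a) \<le> real k + 2"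
proof (cases "even k")
  case True
  then obtain j where "k = 2 * j" by (auto elim: evenE)
  then show ?thesis using C4_even_prefix[OF assms, of j] by simp
next
  case False
  then obtain j where j: "k = 2 * j + 1" by (auto elim: oddE)
  have "gram_eigenvalue (n * n) s (2 * j) = gram_eigenvalue (n * n) s (2 * j + 1)" by (simp add: gram_eigenvalue_def)
  then show ?thesis
    using C4_even_prefix[OF assms, of j] C4_even_prefix[OF assms, of "Suc j"] j by simp
qed

lemma total_eigenvalue_sum:
  assumes X: "X \<in> carrier_mat n n" and b: "skew_basis (n * n) (ad_transpose n X) e s"
  shows "(\<Sum>a<k. gram_eigenvalue (n * n) s a) \<le> 2 * real n * (fnorm X)\<^sup>2"
proof -
  note K = ad_transpose_carrier[of n X] ad_transpose_skew[OF X]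
  have "(\<Sum>a<k. gram_eigenvalue (n * n) s a) \<le> (\<Sum>a<max k (n * n). gram_eigenvalue (n * n) s a)"
    by (rule sum_mono2) (auto simp: gram_eigenvalue_def)
  also have "\<dots> = (\<Sum>a<n * n. gram_eigenvalue (n * n) s a)"
    by (rule sum.mono_neutral_right) (auto intro: gram_eigenvalue_beyond[OF K b])
  also have "\<dots> = (\<Sum>q<n * n. (transpose_mat (ad_transpose n X) * ad_transpose n X) $$ (q, q))"
    by (rule sum_eigenvalues[OF skew_gram_carrier(1)[OF K b] skew_fam[OF K b] skew_gram_eigen[OF K b]])
  also have "\<dots> \<le> 2 * real n * (fnorm X)\<^sup>2" by (rule trace_ad_transpose_le[OF X])
  finally show ?thesis .
qed

text \<open>
  The decreasing rearrangement of \<open>{2\<^sup>2, 1\<^bsup>2n-4\<^esup>, 0\<^bsup>(n-1)\<^sup>2+1\<^esup>}\<close>.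
\<close>

definition majorant :: "nat \<Rightarrow> nat \<Rightarrow> real" where
  "majorant n i = (if i < 2 then 2 else if i < 2 * n - 2 then 1 else 0)"

lemma decr_majorant:
  assumes n: "2 \<le> n"
  shows "replicate_mset 2 2 + replicate_mset (2 * n - 4) 1 + replicate_mset ((n - 1)\<^sup>2 + 1) 0
      = mset (map (majorant n) [0..<n * n])"
    "decr (replicate_mset 2 2 + replicate_mset (2 * n - 4) 1 + replicate_mset ((n - 1)\<^sup>2 + 1) 0)
      = map (majorant n) [0..<n * n]"
proof -
  obtain m where m: "n = m + 2" using n by (metis le_Suc_ex add.commute)
  have le: "2 \<le> 2 * n - 2" "2 * n - 2 \<le> n * n" using n by (auto simp: m)
  have len: "n * n - (2 * n - 2) = (n - 1)\<^sup>2 + 1" by (simp add: m power2_eq_square algebra_simps)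
  have const: "map (majorant n) [i..<j] = replicate (j - i) c"
    if "\<And>l. i \<le> l \<Longrightarrow> l < j \<Longrightarrow> majorant n l = c" for i j c
    using that by (intro nth_equalityI) auto
  have "[0..<n * n] = [0..<2] @ [2..<2 * n - 2] @ [2 * n - 2..<n * n]"
  proof -
    have "[i..<k] = [i..<j] @ [j..<k]" if "i \<le> j" "j \<le> k" for i j k :: nat
      using upt_add_eq_append[of i j "k - j"] that by simp
    from this[of 0 2 "n * n"] this[of 2 "2 * n - 2" "n * n"] show ?thesis using le by simp
  qed
  then have "map (majorant n) [0..<n * n] =
      replicate 2 2 @ replicate (2 * n - 4) 1 @ replicate ((n - 1)\<^sup>2 + 1) 0"
    using const[of 0 2 2] const[of 2 "2 * n - 2" 1] const[of "2 * n - 2" "n * n" 0] le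
    by (simp only: map_append len) (auto simp: majorant_def)
  then show *: "replicate_mset 2 2 + replicate_mset (2 * n - 4) 1 + replicate_mset ((n - 1)\<^sup>2 + 1) 0
      = mset (map (majorant n) [0..<n * n])"
    by (simp only: mset_append mset_replicate add.assoc)
  show "decr (replicate_mset 2 2 + replicate_mset (2 * n - 4) 1 + replicate_mset ((n - 1)\<^sup>2 + 1) 0)
      = map (majorant n) [0..<n * n]"
    unfolding * by (rule decr_mset_antitone) (auto simp: majorant_def)
qed

text \<open>
  The entry \<open>majorant n i\<close> counts how many of the conditions \<open>i < 2\<close> and \<open>i < 2 n - 2\<close> hold.
\<close>

lemma sum_majorant:
  assumes n: "2 \<le> n"
  shows "(\<Sum>i<k. majorant n i) = real (min 2 k) + real (min (2 * n - 2) k)"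
proof (induction k)
  case (Suc k)
  then show ?case using n by (auto simp: majorant_def min_def)
qed simp

text \<open>
  The partial sums of the majorant are \<open>2\<close>, then \<open>k + 2\<close>, and \<open>2 n\<close> from \<open>k = 2 n - 2\<close> on.  The first
  two ranges follow from \<open>C4\<close>, the last one is the unconditional trace bound.  Conversely these partial
  sums never exceed \<open>k + 2\<close>.
\<close>

lemma C4_iff_C5: "C4 \<longleftrightarrow> C5"
proof
  assume c: C4
  show C5
    unfolding C5_def
  proof (intro allI impI)
    fix n :: nat and X assume h: "2 \<le> n" "X \<in> carrier_mat n n" "fnorm X = 1"
    obtain e s where b: "skew_basis (n * n) (ad_transpose n X) e s" using skew_basis_ad_exists[OF h(2)] .
    let ?N = "replicate_mset 2 2 + replicate_mset (2 * n - 4) 1 + replicate_mset ((n - 1)\<^sup>2 + 1) (0::real)"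
    have size: "size ?N = n * n" "size (eigenvalues_op n (T_op X)) = n * n"
      unfolding decr_majorant(1)[OF h(1)] decr_eigenvalues(1)[OF h(2) b] by simp_all
    have "(\<Sum>i<k. decr (eigenvalues_op n (T_op X)) ! i) \<le> (\<Sum>i<k. decr ?N ! i)"
      if k: "k \<in> {1..n * n}" for k
    proof -
      have l: "(\<Sum>i<k. decr (eigenvalues_op n (T_op X)) ! i) = (\<Sum>i<k. gram_eigenvalue (n * n) s i)"
        unfolding decr_eigenvalues(2)[OF h(2) b] by (rule sum.cong) (use k in auto)
      have r: "(\<Sum>i<k. decr ?N ! i) = (\<Sum>i<k. majorant n i)"
        unfolding decr_majorant(2)[OF h(1)] by (rule sum.cong) (use k in auto)
      have "(\<Sum>i<k. gram_eigenvalue (n * n) s i) \<le> real (min 2 k) + real (min (2 * n - 2) k)"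
      proof -
        consider "k = 1" | "2 \<le> k" "k \<le> 2 * n - 2" | "2 * n - 2 < k" using k by force
        then show ?thesis
        proof cases
          case 1
          have "gram_eigenvalue (n * n) s 0 = gram_eigenvalue (n * n) s 1" by (simp add: gram_eigenvalue_def)
          then show ?thesis using C4_even_prefix[OF c h b, of 1] 1 h(1)
            by (simp add: numeral_2_eq_2)
        next
          case 2
          then show ?thesis using C4_prefix[OF c h b, of k] by simp
        next
          case 3
          then show ?thesis using total_eigenvalue_sum[OF h(2) b, of k] h(1,3) by simp
        qed
      qed
      then show ?thesis unfolding l r sum_majorant[OF h(1)] .
    qed
    then show "weakly_majorized (eigenvalues_op n (T_op X)) ?N"
      unfolding weakly_majorized_def size by blast
  qed
next
  assume c: C5
  show C4
  proof (rule C4I)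
    fix n :: nat and X e s k
    assume h: "2 \<le> n" "X \<in> carrier_mat n n" "fnorm X = 1"
      and b: "skew_basis (n * n) (ad_transpose n X) e s" and k: "1 \<le> k" "k \<le> n * n div 2"
    let ?N = "replicate_mset 2 2 + replicate_mset (2 * n - 4) 1 + replicate_mset ((n - 1)\<^sup>2 + 1) (0::real)"
    have size: "size ?N = n * n" unfolding decr_majorant(1)[OF h(1)] by simp
    have k2: "2 * k \<in> {1..n * n}" using k by auto
    have "weakly_majorized (eigenvalues_op n (T_op X)) ?N" using c h unfolding C5_def by blast
    then have "(\<Sum>i<2 * k. decr (eigenvalues_op n (T_op X)) ! i) \<le> (\<Sum>i<2 * k. decr ?N ! i)"
      unfolding weakly_majorized_def size using k2 by blast
    also have "(\<Sum>i<2 * k. decr ?N ! i) = (\<Sum>i<2 * k. majorant n i)"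
      unfolding decr_majorant(2)[OF h(1)] by (rule sum.cong) (use k2 in auto)
    also have "\<dots> \<le> 2 * real k + 2" unfolding sum_majorant[OF h(1)] by linarith
    also have "(\<Sum>i<2 * k. decr (eigenvalues_op n (T_op X)) ! i) = (\<Sum>a<2 * k. gram_eigenvalue (n * n) s a)"
      unfolding decr_eigenvalues(2)[OF h(2) b] by (rule sum.cong) (use k2 in auto)
    finally show "(\<Sum>a<2 * k. gram_eigenvalue (n * n) s a) \<le> 2 * real k + 2" by simp
  qed
qed

lemma C4_imp_C3:
  assumes C4
  shows C3
  unfolding C3_def
proof (intro allI impI)
  fix n :: nat and X assume h: "2 \<le> n" "X \<in> carrier_mat n n" "fnorm X = 1"
  obtain e s where b: "skew_basis (n * n) (ad_transpose n X) e s" using skew_basis_ad_exists[OF h(2)] .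
  have "2 * 2 \<le> n * n" using h(1) by (intro mult_mono) auto
  then have N: "0 < n * n" "2 < n * n" using h(1) by auto
  have "gram_eigenvalue (n * n) s 1 = gram_eigenvalue (n * n) s 0" "gram_eigenvalue (n * n) s 3 = gram_eigenvalue (n * n) s 2"
    by (simp_all add: gram_eigenvalue_def)
  then have "2 * (gram_eigenvalue (n * n) s 0 + gram_eigenvalue (n * n) s 2) = (\<Sum>a<2 * 2. gram_eigenvalue (n * n) s a)"
    by (simp add: numeral_eq_Suc)
  also have "\<dots> \<le> 6" using C4_even_prefix[OF assms h b, of 2] by simp
  finally show "lam n X 1 + lam n X 3 \<le> 3"
    using lam_gram_eigenvalue[OF h(2) b N(1)] lam_gram_eigenvalue[OF h(2) b N(2)] by (simp add: numeral_eq_Suc)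
qed

section \<open>Commutator inequalities for orthogonal families\<close>

text \<open>
  Only the indices with \<open>t i > 1\<close> can make \<open>\<Sum>b i (t i - 1)\<close> positive; there \<open>b i\<close> may be replaced by its
  bound \<open>M\<close>, and the rest is the unweighted bound for that set of indices.
\<close>

lemma weighted_bound:
  fixes b t :: "'i \<Rightarrow> real"
  assumes I: "finite I" and b: "\<And>i. i \<in> I \<Longrightarrow> 0 \<le> b i" "\<And>i. i \<in> I \<Longrightarrow> b i \<le> M" and M: "0 \<le> M" and c: "0 \<le> c"
    and bound: "\<And>F. F \<subseteq> I \<Longrightarrow> \<forall>i\<in>F. 0 < b i \<Longrightarrow> (\<Sum>i\<in>F. t i) \<le> real (card F) + c"
  shows "(\<Sum>i\<in>I. b i * t i) \<le> c * M + (\<Sum>i\<in>I. b i)"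
proof -
  define F where "F = {i \<in> I. 0 < b i \<and> 1 < t i}"
  have F: "F \<subseteq> I" "finite F" using I by (auto simp: F_def)
  have "(\<Sum>i\<in>I. b i * t i) - (\<Sum>i\<in>I. b i) = (\<Sum>i\<in>I. b i * (t i - 1))"
    by (simp add: right_diff_distrib sum_subtractf)
  also have "\<dots> \<le> (\<Sum>i\<in>I. if i \<in> F then M * (t i - 1) else 0)"
  proof (rule sum_mono)
    fix i assume i: "i \<in> I"
    show "b i * (t i - 1) \<le> (if i \<in> F then M * (t i - 1) else 0)"
    proof (cases "i \<in> F")
      case True
      then show ?thesis using b(2)[OF i] by (auto simp: F_def intro!: mult_right_mono)
    next
      case False
      then show ?thesis using b(1)[OF i] i by (auto simp: F_def mult_le_0_iff)
    qed
  qed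
  also have "\<dots> = M * ((\<Sum>i\<in>F. t i) - real (card F))"
    using I F by (simp add: sum.inter_restrict[symmetric] Int_absorb1 sum_distrib_left[symmetric] sum_subtractf)
  also have "\<dots> \<le> M * c"
    using bound[OF F(1)] M by (intro mult_left_mono) (auto simp: F_def)
  finally show ?thesis by (simp add: mult.commute)
qed

lemma normalized_orthogonal_family:
  fixes a :: "'i \<Rightarrow> real vec"
  assumes F: "finite F" and a: "\<And>i. i \<in> F \<Longrightarrow> a i \<in> carrier_vec N" "\<And>i. i \<in> F \<Longrightarrow> 0 < a i \<bullet> a i"
    and orth: "\<And>i j. i \<in> F \<Longrightarrow> j \<in> F \<Longrightarrow> i \<noteq> j \<Longrightarrow> a i \<bullet> a j = 0"
  defines "u \<equiv> \<lambda>i. (1 / sqrt (a i \<bullet> a i)) \<cdot>\<^sub>v a i"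
  shows "orthonormal N (u ` F)" "inj_on u F"
proof -
  have uc: "u i \<in> carrier_vec N" if "i \<in> F" for i using a(1)[OF that] by (simp add: u_def)
  have uu: "u i \<bullet> u i = 1" if "i \<in> F" for i
    unfolding u_def by (rule normalize_vec[OF a(1)[OF that]]) (use a(2)[OF that] in simp)
  have uo: "u i \<bullet> u j = 0" if "i \<in> F" "j \<in> F" "i \<noteq> j" for i j
    using a(1)[OF that(1)] a(1)[OF that(2)] orth[OF that]
    by (simp add: u_def smult_scalar_prod_distrib[of _ N] scalar_prod_smult_distrib[of _ N])
  show inj: "inj_on u F"
  proof (rule inj_onI)
    fix i j assume "i \<in> F" "j \<in> F" "u i = u j"
    then show "i = j" using uu[of j] uo[of i j] by force
  qed
  show "orthonormal N (u ` F)"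
    unfolding orthonormal_def
  proof (intro conjI ballI)
    fix x y assume "x \<in> u ` F" "y \<in> u ` F"
    then obtain i j where ij: "i \<in> F" "j \<in> F" "x = u i" "y = u j" by blast
    then show "x \<bullet> y = (if x = y then 1 else 0)"
      using uu uo inj_onD[OF inj _ ij(1,2)] by (cases "i = j") auto
  qed (use F uc in auto)
qed

text \<open>
  A bound for orthonormal sets of multiples of the \<open>a i\<close> passes to the \<open>a i\<close> themselves.  Vanishing \<open>a i\<close>
  contribute nothing and stay out of the orthonormal sets.
\<close>

lemma orthogonal_weighted_bound:
  fixes K :: "real mat" and a :: "'i \<Rightarrow> real vec"
  assumes K: "K \<in> carrier_mat N N" and I: "finite I"
    and a: "\<And>i. i \<in> I \<Longrightarrow> a i \<in> carrier_vec N" "\<And>i. i \<in> I \<Longrightarrow> a i \<bullet> a i \<le> M"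
    and orth: "\<And>i j. i \<in> I \<Longrightarrow> j \<in> I \<Longrightarrow> i \<noteq> j \<Longrightarrow> a i \<bullet> a j = 0"
    and M: "0 \<le> M" and c: "0 \<le> c"
    and bound: "\<And>U. orthonormal N U \<Longrightarrow>
      (\<And>u. u \<in> U \<Longrightarrow> \<exists>i\<in>I. \<exists>r. u = r \<cdot>\<^sub>v a i) \<Longrightarrow>
      (\<Sum>u\<in>U. (K *\<^sub>v u) \<bullet> (K *\<^sub>v u)) \<le> real (card U) + c"
  shows "(\<Sum>i\<in>I. (K *\<^sub>v a i) \<bullet> (K *\<^sub>v a i)) \<le> c * M + (\<Sum>i\<in>I. a i \<bullet> a i)"
proof -
  define t where "t i = ((K *\<^sub>v a i) \<bullet> (K *\<^sub>v a i)) / (a i \<bullet> a i)" for i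
  have "(K *\<^sub>v a i) \<bullet> (K *\<^sub>v a i) = (a i \<bullet> a i) * t i" if "i \<in> I" for i
  proof (cases "a i \<bullet> a i = 0")
    case True
    then have "a i = 0\<^sub>v N" using scalar_prod_self_eq_0 a(1)[OF that] by blast
    then have "K *\<^sub>v a i = 0\<^sub>v N" using K by (auto intro!: eq_vecI)
    then show ?thesis using True by simp
  qed (simp add: t_def)
  then have "(\<Sum>i\<in>I. (K *\<^sub>v a i) \<bullet> (K *\<^sub>v a i)) = (\<Sum>i\<in>I. (a i \<bullet> a i) * t i)" by simp
  also have "\<dots> \<le> c * M + (\<Sum>i\<in>I. a i \<bullet> a i)"
  proof (rule weighted_bound[OF I _ a(2) M c])
    fix F assume F: "F \<subseteq> I" "\<forall>i\<in>F. 0 < a i \<bullet> a i"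
    define u where "u i = (1 / sqrt (a i \<bullet> a i)) \<cdot>\<^sub>v a i" for i
    have fin: "finite F" using F(1) I finite_subset by blast
    have U: "orthonormal N (u ` F)" "inj_on u F"
    proof -
      have "a i \<in> carrier_vec N" "0 < a i \<bullet> a i" if "i \<in> F" for i using that F a(1) by auto
      moreover have "a i \<bullet> a j = 0" if "i \<in> F" "j \<in> F" "i \<noteq> j" for i j using that F(1) orth by blast
      ultimately show "orthonormal N (u ` F)" "inj_on u F"
        unfolding u_def using normalized_orthogonal_family[OF fin, of a N] by blast+
    qed
    have "t i = (K *\<^sub>v u i) \<bullet> (K *\<^sub>v u i)" if i: "i \<in> F" for i
    proof -
      have ai: "a i \<in> carrier_vec N" "0 < a i \<bullet> a i" using F i a(1) by auto
      then have "K *\<^sub>v a i \<in> carrier_vec N" using K by simp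
      then show ?thesis using ai K
        by (simp add: u_def t_def mult_mat_vec[of _ N N] smult_scalar_prod_distrib[of _ N]
            scalar_prod_smult_distrib[of _ N] field_simps)
    qed
    then have "(\<Sum>i\<in>F. t i) = (\<Sum>x\<in>u ` F. (K *\<^sub>v x) \<bullet> (K *\<^sub>v x))"
      by (simp add: sum.reindex[OF U(2)])
    also have "\<dots> \<le> real (card (u ` F)) + c"
      by (rule bound[OF U(1)]) (use F(1) in \<open>auto simp: u_def\<close>)
    also have "card (u ` F) = card F" by (rule card_image[OF U(2)])
    finally show "(\<Sum>i\<in>F. t i) \<le> real (card F) + c" .
  qed (use scalar_prod_self_nonneg in auto)
  finally show ?thesis .
qed

lemma fnorm_smult:
  assumes "B \<in> carrier_mat n n"
  shows "(fnorm (c \<cdot>\<^sub>m B))\<^sup>2 = c\<^sup>2 * (fnorm B)\<^sup>2"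
proof -
  have "vecm n (c \<cdot>\<^sub>m B) = c \<cdot>\<^sub>v vecm n B"
    by (rule eq_vecI) (use assms index_div_mod in \<open>auto simp: vecm_def\<close>)
  then show ?thesis
    using fnorm_square[OF assms] fnorm_square[OF smult_carrier_mat[OF assms, of c]]
    by (simp add: power2_eq_square)
qed

lemma comm_smult_left:
  assumes "B \<in> carrier_mat n n" "Y \<in> carrier_mat n n"
  shows "comm (c \<cdot>\<^sub>m B) Y = c \<cdot>\<^sub>m comm B Y"
proof -
  have "comm (c \<cdot>\<^sub>m B) Y = c \<cdot>\<^sub>m (B * Y) - c \<cdot>\<^sub>m (Y * B)"
    using assms by (simp add: comm_def mult_smult_distrib[of _ n n] mult_smult_assoc_mat[of _ n n])
  also have "\<dots> = c \<cdot>\<^sub>m comm B Y"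
    using assms by (intro eq_matI) (auto simp: comm_def right_diff_distrib)
  finally show ?thesis .
qed

lemma mtrace_smult: "C \<in> carrier_mat n n \<Longrightarrow> mtrace (c \<cdot>\<^sub>m C) = c * mtrace C"
  by (auto simp: mtrace_def sum_distrib_left)

lemma fnorm_0D:
  assumes "B \<in> carrier_mat n n" "fnorm B = 0"
  shows "B = 0\<^sub>m n n"
proof -
  have "vecm n B = 0\<^sub>v (n * n)"
    using fnorm_square[OF assms(1)] assms(2) scalar_prod_self_eq_0[OF vecm_carrier] by simp
  then have "B = matv n (0\<^sub>v (n * n))" using matv_vecm[OF assms(1)] by simp
  also have "\<dots> = 0\<^sub>m n n" by (rule eq_matI) (auto simp: matv_def index_less)
  finally show ?thesis .
qed

text \<open>
  The common reduction of \<open>C2\<close> (with \<open>c = 1\<close>) and \<open>C6\<close> (with \<open>c = 2\<close>) to a matrix \<open>X\<close> of norm \<open>1\<close>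
  and to orthonormal sets.  The assumption may use that \<open>X\<close> and the members of \<open>U\<close> are multiples of the given
  matrices; this is how isotropy is inherited.
\<close>

lemma commutator_family_bound:
  fixes A :: "nat \<Rightarrow> real mat"
  assumes B: "B \<in> carrier_mat n n" and m: "2 \<le> m"
    and A: "\<And>\<alpha>. \<alpha> \<in> {2..m} \<Longrightarrow> A \<alpha> \<in> carrier_mat n n"
    and orth: "\<And>\<alpha> \<beta>. \<alpha> \<in> {2..m} \<Longrightarrow> \<beta> \<in> {2..m} \<Longrightarrow> \<alpha> \<noteq> \<beta> \<Longrightarrow> mtrace (A \<alpha> * transpose_mat (A \<beta>)) = 0"
    and c: "0 \<le> c"
    and bound: "\<And>X U. X \<in> carrier_mat n n \<Longrightarrow> fnorm X = 1 \<Longrightarrow> \<exists>r. X = r \<cdot>\<^sub>m B \<Longrightarrow> orthonormal (n * n) U \<Longrightarrow>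
      (\<And>u. u \<in> U \<Longrightarrow> \<exists>\<alpha>\<in>{2..m}. \<exists>r. u = r \<cdot>\<^sub>v vecm n (A \<alpha>)) \<Longrightarrow>
      (\<Sum>u\<in>U. (ad_transpose n X *\<^sub>v u) \<bullet> (ad_transpose n X *\<^sub>v u)) \<le> real (card U) + c"
  shows "(\<Sum>\<alpha>=2..m. (fnorm (comm B (A \<alpha>)))\<^sup>2)
          \<le> (c * Max ((\<lambda>\<alpha>. (fnorm (A \<alpha>))\<^sup>2) ` {2..m}) + (\<Sum>\<alpha>=2..m. (fnorm (A \<alpha>))\<^sup>2)) * (fnorm B)\<^sup>2"
proof -
  define M where "M = Max ((\<lambda>\<alpha>. (fnorm (A \<alpha>))\<^sup>2) ` {2..m})"
  have M: "(fnorm (A \<alpha>))\<^sup>2 \<le> M" if "\<alpha> \<in> {2..m}" for \<alpha>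
    unfolding M_def by (rule Max_ge) (use that in auto)
  have M0: "0 \<le> M" using M[of 2] m by (meson atLeastAtMost_iff le_refl order_trans zero_le_power2)
  show ?thesis
  proof (cases "fnorm B = 0")
    case True
    have "fnorm (comm B (A \<alpha>)) = 0" if "\<alpha> \<in> {2..m}" for \<alpha>
    proof -
      have "comm B (A \<alpha>) = comm (0 \<cdot>\<^sub>m B) (A \<alpha>)"
        using fnorm_0D[OF B True] by (metis smult_zero_mat zero_carrier_mat)
      then have "(fnorm (comm B (A \<alpha>)))\<^sup>2 = 0"
        using comm_smult_left[OF B A[OF that], of 0] fnorm_smult[OF comm_carrier[OF B A[OF that]], of 0] by simp
      then show ?thesis by simp
    qed
    then show ?thesis using True by simp
  next
    case False
    define X where "X = (1 / fnorm B) \<cdot>\<^sub>m B"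
    have X: "X \<in> carrier_mat n n" using B by (simp add: X_def)
    have "(fnorm X)\<^sup>2 = 1" using False fnorm_smult[OF B] by (simp add: X_def power_divide)
    moreover have "0 \<le> fnorm X"
      using mtrace_mult_transpose[OF X X] scalar_prod_self_nonneg by (simp add: fnorm_def)
    ultimately have X1: "fnorm X = 1" by (simp add: power2_eq_1_iff)
    let ?K = "ad_transpose n X"
    have "(\<Sum>\<alpha>=2..m. (?K *\<^sub>v vecm n (A \<alpha>)) \<bullet> (?K *\<^sub>v vecm n (A \<alpha>)))
        \<le> c * M + (\<Sum>\<alpha>=2..m. vecm n (A \<alpha>) \<bullet> vecm n (A \<alpha>))"
    proof (rule orthogonal_weighted_bound[of _ "n * n"])
      show "vecm n (A \<alpha>) \<bullet> vecm n (A \<alpha>) \<le> M" if "\<alpha> \<in> {2..m}" for \<alpha>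
        using M[OF that] fnorm_square[OF A[OF that]] by simp
      show "vecm n (A \<alpha>) \<bullet> vecm n (A \<beta>) = 0" if "\<alpha> \<in> {2..m}" "\<beta> \<in> {2..m}" "\<alpha> \<noteq> \<beta>" for \<alpha> \<beta>
        using orth[OF that] mtrace_mult_transpose[OF A[OF that(1)] A[OF that(2)]] by simp
      show "(\<Sum>u\<in>U. (?K *\<^sub>v u) \<bullet> (?K *\<^sub>v u)) \<le> real (card U) + c"
        if "orthonormal (n * n) U" "\<And>u. u \<in> U \<Longrightarrow> \<exists>\<alpha>\<in>{2..m}. \<exists>r. u = r \<cdot>\<^sub>v vecm n (A \<alpha>)" for U
        by (rule bound[OF X X1 _ that]) (auto simp: X_def)
    qed (use M0 c in auto)
    also have "(\<Sum>\<alpha>=2..m. vecm n (A \<alpha>) \<bullet> vecm n (A \<alpha>)) = (\<Sum>\<alpha>=2..m. (fnorm (A \<alpha>))\<^sup>2)"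
      by (rule sum.cong[OF refl]) (use fnorm_square[OF A] in simp)
    also have "(\<Sum>\<alpha>=2..m. (?K *\<^sub>v vecm n (A \<alpha>)) \<bullet> (?K *\<^sub>v vecm n (A \<alpha>)))
        = (\<Sum>\<alpha>=2..m. (fnorm (comm B (A \<alpha>)))\<^sup>2 / (fnorm B)\<^sup>2)"
    proof (rule sum.cong[OF refl])
      fix \<alpha> assume a: "\<alpha> \<in> {2..m}"
      have "(fnorm (comm X (A \<alpha>)))\<^sup>2 = (fnorm (comm B (A \<alpha>)))\<^sup>2 / (fnorm B)\<^sup>2"
        unfolding X_def comm_smult_left[OF B A[OF a]] fnorm_smult[OF comm_carrier[OF B A[OF a]]]
        by (simp add: power_divide)
      then show "(?K *\<^sub>v vecm n (A \<alpha>)) \<bullet> (?K *\<^sub>v vecm n (A \<alpha>)) = (fnorm (comm B (A \<alpha>)))\<^sup>2 / (fnorm B)\<^sup>2"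
        using comm_norm[OF X A[OF a]] by simp
    qed
    finally show ?thesis
      using False by (simp add: sum_divide_distrib[symmetric] divide_le_eq M_def)
  qed
qed

lemma C4_imp_C6:
  assumes C4
  shows C6
  unfolding C6_def
proof (intro allI impI)
  fix n m :: nat and B :: "real mat" and A :: "nat \<Rightarrow> real mat"
  assume h: "2 \<le> n" "2 \<le> m" "B \<in> carrier_mat n n" "\<forall>\<alpha>\<in>{2..m}. A \<alpha> \<in> carrier_mat n n"
    "\<forall>\<alpha>\<in>{2..m}. \<forall>\<beta>\<in>{2..m}. \<alpha> \<noteq> \<beta> \<longrightarrow> mtrace (A \<alpha> * transpose_mat (A \<beta>)) = 0"
  show "(\<Sum>\<alpha>=2..m. (fnorm (comm B (A \<alpha>)))\<^sup>2)
          \<le> (2 * Max ((\<lambda>\<alpha>. (fnorm (A \<alpha>))\<^sup>2) ` {2..m}) + (\<Sum>\<alpha>=2..m. (fnorm (A \<alpha>))\<^sup>2)) * (fnorm B)\<^sup>2"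
  proof (rule commutator_family_bound[OF h(3,2)])
    fix X U assume X: "X \<in> carrier_mat n n" "fnorm X = 1" and U: "orthonormal (n * n) U"
    obtain e s where b: "skew_basis (n * n) (ad_transpose n X) e s" using skew_basis_ad_exists[OF X(1)] .
    show "(\<Sum>u\<in>U. (ad_transpose n X *\<^sub>v u) \<bullet> (ad_transpose n X *\<^sub>v u)) \<le> real (card U) + 2"
      using skew_ky_fan[OF ad_transpose_carrier ad_transpose_skew[OF X(1)] b U]
        C4_prefix[OF assms h(1) X b, of "card U"] by linarith
  qed (use h in auto)
qed

lemma C4_imp_C2:
  assumes C4
  shows C2
  unfolding C2_def
proof (intro allI impI)
  fix n m :: nat and B :: "real mat" and A :: "nat \<Rightarrow> real mat"
  assume h: "2 \<le> n" "2 \<le> m" "B \<in> carrier_mat n n" "\<forall>\<alpha>\<in>{2..m}. A \<alpha> \<in> carrier_mat n n"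
    "\<forall>\<alpha>\<in>{2..m}. \<forall>\<beta>\<in>{2..m}. \<alpha> \<noteq> \<beta> \<longrightarrow> mtrace (A \<alpha> * transpose_mat (A \<beta>)) = 0"
    and iso: "\<forall>\<alpha>\<in>{2..m}. \<forall>\<beta>\<in>{2..m}. mtrace (A \<alpha> * comm B (A \<beta>)) = 0"
  have "(\<Sum>\<alpha>=2..m. (fnorm (comm B (A \<alpha>)))\<^sup>2)
          \<le> (1 * Max ((\<lambda>\<alpha>. (fnorm (A \<alpha>))\<^sup>2) ` {2..m}) + (\<Sum>\<alpha>=2..m. (fnorm (A \<alpha>))\<^sup>2)) * (fnorm B)\<^sup>2"
  proof (rule commutator_family_bound[OF h(3,2)])
    fix X U assume X: "X \<in> carrier_mat n n" "fnorm X = 1" "\<exists>r. X = r \<cdot>\<^sub>m B" and U: "orthonormal (n * n) U"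
      and UA: "\<And>u. u \<in> U \<Longrightarrow> \<exists>\<alpha>\<in>{2..m}. \<exists>r. u = r \<cdot>\<^sub>v vecm n (A \<alpha>)"
    let ?K = "ad_transpose n X"
    obtain e s where b: "skew_basis (n * n) ?K e s" using skew_basis_ad_exists[OF X(1)] .
    obtain c where c: "X = c \<cdot>\<^sub>m B" using X(3) by blast
    have "u \<bullet> (?K *\<^sub>v v) = 0" if "u \<in> U" "v \<in> U" for u v
    proof -
      obtain \<alpha> \<beta> p q where ab: "\<alpha> \<in> {2..m}" "\<beta> \<in> {2..m}" "u = p \<cdot>\<^sub>v vecm n (A \<alpha>)" "v = q \<cdot>\<^sub>v vecm n (A \<beta>)"
        using UA[OF \<open>u \<in> U\<close>] UA[OF \<open>v \<in> U\<close>] by blast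
      have AA: "A \<alpha> \<in> carrier_mat n n" "A \<beta> \<in> carrier_mat n n" using ab h(4) by auto
      have Kv: "?K *\<^sub>v vecm n (A \<beta>) \<in> carrier_vec (n * n)" 
        by (rule mult_mat_vec_carrier[OF ad_transpose_carrier vecm_carrier])
      have "vecm n (A \<alpha>) \<bullet> (?K *\<^sub>v vecm n (A \<beta>)) = mtrace (A \<alpha> * comm X (A \<beta>))"
        by (rule mtrace_mult_comm[OF AA(1) X(1) AA(2), symmetric])
      also have "\<dots> = mtrace (c \<cdot>\<^sub>m (A \<alpha> * comm B (A \<beta>)))"
        unfolding c comm_smult_left[OF h(3) AA(2)]
        using AA comm_carrier[OF h(3) AA(2)] by (simp add: mult_smult_distrib[of _ n n _ n])
      also have "\<dots> = c * mtrace (A \<alpha> * comm B (A \<beta>))"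
      proof -
        have "A \<alpha> * comm B (A \<beta>) \<in> carrier_mat n n"
          by (rule mult_carrier_mat[OF AA(1) comm_carrier[OF h(3) AA(2)]])
        then show ?thesis by (rule mtrace_smult)
      qed
      also have "\<dots> = 0" using iso ab by simp
      finally show ?thesis
        using Kv by (simp add: ab mult_mat_vec[OF ad_transpose_carrier vecm_carrier]
            smult_scalar_prod_distrib[of _ "n * n"] scalar_prod_smult_distrib[of _ "n * n"])
    qed
    then have "2 * (\<Sum>u\<in>U. (?K *\<^sub>v u) \<bullet> (?K *\<^sub>v u)) \<le> (\<Sum>a<2 * card U. gram_eigenvalue (n * n) s a)"
      by (intro isotropic_ky_fan[OF ad_transpose_carrier ad_transpose_skew[OF X(1)] b U]) blast
    then show "(\<Sum>u\<in>U. (?K *\<^sub>v u) \<bullet> (?K *\<^sub>v u)) \<le> real (card U) + 1"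
      using C4_even_prefix[OF assms h(1) X(1,2) b, of "card U"] by linarith
  qed (use h in auto)
  then show "(\<Sum>\<alpha>=2..m. (fnorm (comm B (A \<alpha>)))\<^sup>2)
          \<le> (Max ((\<lambda>\<alpha>. (fnorm (A \<alpha>))\<^sup>2) ` {2..m}) + (\<Sum>\<alpha>=2..m. (fnorm (A \<alpha>))\<^sup>2)) * (fnorm B)\<^sup>2"
    by simp
qed

lemma fnorm_matv:
  assumes "x \<in> carrier_vec (n * n)"
  shows "(fnorm (matv n x))\<^sup>2 = x \<bullet> x"
  using fnorm_square[OF matv_carrier, of n x] vecm_matv[OF assms] by simp

lemma comm_matv:
  assumes "B \<in> carrier_mat n n" "x \<in> carrier_vec (n * n)"
  shows "(fnorm (comm B (matv n x)))\<^sup>2 = (ad_transpose n B *\<^sub>v x) \<bullet> (ad_transpose n B *\<^sub>v x)"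
  using comm_norm[OF assms(1) matv_carrier] vecm_matv[OF assms(2)] by simp

lemma shift_sum: "(\<Sum>\<alpha>=2..Suc k. f (\<alpha> - 2)) = (\<Sum>i<k. f i)" for f :: "nat \<Rightarrow> real"
  by (rule sum.reindex_bij_witness[of _ "\<lambda>i. i + 2" "\<lambda>\<alpha>. \<alpha> - 2"]) auto

lemma skew_norm_eigen:
  assumes "K \<in> carrier_mat N N" "transpose_mat K = - K" "skew_basis N K e s" "a < N"
  shows "(K *\<^sub>v e a) \<bullet> (K *\<^sub>v e a) = gram_eigenvalue N s a"
proof -
  note fam = skew_fam[OF assms(1-3)]
  have "(K *\<^sub>v e a) \<bullet> (K *\<^sub>v e a) = e a \<bullet> (gram_eigenvalue N s a \<cdot>\<^sub>v e a)"
    using skew_gram_quadratic[OF assms(1-3) orthonormal_famD(1)[OF fam assms(4)]]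
      skew_gram_eigen[OF assms] by simp
  also have "\<dots> = gram_eigenvalue N s a"
    using orthonormal_famD(1,2)[OF fam assms(4)] by (simp add: scalar_prod_smult_distrib[of _ N])
  finally show ?thesis .
qed

text \<open>
  An orthonormal family, numbered from \<open>2\<close> as in \<open>C2\<close> and \<open>C6\<close>.
\<close>

lemma unit_family:
  assumes e: "orthonormal_fam (n * n) (n * n) e"
    and g: "g ` {..<k} \<subseteq> {..<n * n}" "inj_on g {..<k}" and k: "1 \<le> k"
    and A: "\<And>\<alpha>. A \<alpha> = matv n (e (g (\<alpha> - 2)))"
  shows "Max ((\<lambda>\<alpha>. (fnorm (A \<alpha>))\<^sup>2) ` {2..Suc k}) = 1"
    "(\<Sum>\<alpha>=2..Suc k. (fnorm (A \<alpha>))\<^sup>2) = real k"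
    "\<forall>\<alpha>\<in>{2..Suc k}. \<forall>\<beta>\<in>{2..Suc k}. \<alpha> \<noteq> \<beta> \<longrightarrow> mtrace (A \<alpha> * transpose_mat (A \<beta>)) = 0"
proof -
  have less: "g (\<alpha> - 2) < n * n" if "\<alpha> \<in> {2..Suc k}" for \<alpha> using g(1) that by force
  have one: "(fnorm (A \<alpha>))\<^sup>2 = 1" if "\<alpha> \<in> {2..Suc k}" for \<alpha>
    using orthonormal_famD(1,2)[OF e less[OF that]] by (simp add: A fnorm_matv)
  then have "(\<lambda>\<alpha>. (fnorm (A \<alpha>))\<^sup>2) ` {2..Suc k} = {1}" using k by force
  then show "Max ((\<lambda>\<alpha>. (fnorm (A \<alpha>))\<^sup>2) ` {2..Suc k}) = 1" by simp
  show "(\<Sum>\<alpha>=2..Suc k. (fnorm (A \<alpha>))\<^sup>2) = real k" using one by simp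
  show "\<forall>\<alpha>\<in>{2..Suc k}. \<forall>\<beta>\<in>{2..Suc k}. \<alpha> \<noteq> \<beta> \<longrightarrow> mtrace (A \<alpha> * transpose_mat (A \<beta>)) = 0"
  proof (intro ballI impI)
    fix \<alpha> \<beta> assume ab: "\<alpha> \<in> {2..Suc k}" "\<beta> \<in> {2..Suc k}" "\<alpha> \<noteq> \<beta>"
    then have "g (\<alpha> - 2) \<noteq> g (\<beta> - 2)" using inj_onD[OF g(2), of "\<alpha> - 2" "\<beta> - 2"] by force
    then show "mtrace (A \<alpha> * transpose_mat (A \<beta>)) = 0"
      using orthonormal_famD(1)[OF e less[OF ab(1)]] orthonormal_famD(1)[OF e less[OF ab(2)]]
        orthonormal_famD(3)[OF e less[OF ab(1)] less[OF ab(2)]]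
      by (simp add: A mtrace_mult_transpose[OF matv_carrier matv_carrier] vecm_matv)
  qed
qed

text \<open>
  Test \<open>C6\<close> on the first \<open>2 k\<close> eigenvectors.
\<close>

lemma C6_imp_C4:
  assumes C6
  shows C4
proof (rule C4I)
  fix n :: nat and X e s k
  assume h: "2 \<le> n" "X \<in> carrier_mat n n" "fnorm X = 1"
    and b: "skew_basis (n * n) (ad_transpose n X) e s" and k: "1 \<le> k" "k \<le> n * n div 2"
  note K = ad_transpose_carrier[of n X] ad_transpose_skew[OF h(2)]
  note fam = skew_fam[OF K b]
  define A where "A \<alpha> = matv n (e (\<alpha> - 2))" for \<alpha> :: nat
  have k2: "(\<lambda>i. i) ` {..<2 * k} \<subseteq> {..<n * n}" "inj_on (\<lambda>i. i) {..<2 * k}" "1 \<le> 2 * k" using k by auto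
  note u = unit_family[where g = "\<lambda>i. i", OF fam k2 A_def]
  have "2 \<le> Suc (2 * k)" "\<forall>\<alpha>\<in>{2..Suc (2 * k)}. A \<alpha> \<in> carrier_mat n n" using k by (auto simp: A_def)
  then have "(\<Sum>\<alpha>=2..Suc (2 * k). (fnorm (comm X (A \<alpha>)))\<^sup>2)
      \<le> (2 * Max ((\<lambda>\<alpha>. (fnorm (A \<alpha>))\<^sup>2) ` {2..Suc (2 * k)})
          + (\<Sum>\<alpha>=2..Suc (2 * k). (fnorm (A \<alpha>))\<^sup>2)) * (fnorm X)\<^sup>2"
    using assms h(1,2) u(3) unfolding C6_def by blast
  also have "\<dots> = 2 * real k + 2"
    by (subst u(1), subst u(2), subst h(3)) simp
  also have "(\<Sum>\<alpha>=2..Suc (2 * k). (fnorm (comm X (A \<alpha>)))\<^sup>2)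
      = (\<Sum>\<alpha>=2..Suc (2 * k). gram_eigenvalue (n * n) s (\<alpha> - 2))"
  proof (rule sum.cong[OF refl])
    fix \<alpha> assume "\<alpha> \<in> {2..Suc (2 * k)}"
    then have "\<alpha> - 2 < n * n" using k2(1) by force
    then show "(fnorm (comm X (A \<alpha>)))\<^sup>2 = gram_eigenvalue (n * n) s (\<alpha> - 2)"
      using comm_matv[OF h(2)] orthonormal_famD(1)[OF fam] skew_norm_eigen[OF K b] by (simp add: A_def)
  qed
  also have "\<dots> = (\<Sum>a<2 * k. gram_eigenvalue (n * n) s a)" by (rule shift_sum)
  finally show "(\<Sum>a<2 * k. gram_eigenvalue (n * n) s a) \<le> 2 * real k + 2" .
qed

text \<open>
  Test \<open>C2\<close> on the first vector of each of the first \<open>k\<close> blocks; these vectors are isotropic since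
  \<open>[X, -]\<^sup>T\<close> sends each of them to a multiple of its partner in the block.
\<close>

lemma C2_imp_C4:
  assumes C2
  shows C4
proof (rule C4I)
  fix n :: nat and X e s k
  assume h: "2 \<le> n" "X \<in> carrier_mat n n" "fnorm X = 1"
    and b: "skew_basis (n * n) (ad_transpose n X) e s" and k: "1 \<le> k" "k \<le> n * n div 2"
  let ?K = "ad_transpose n X"
  note K = ad_transpose_carrier[of n X] ad_transpose_skew[OF h(2)]
  note fam = skew_fam[OF K b]
  define A where "A \<alpha> = matv n (e (2 * (\<alpha> - 2)))" for \<alpha> :: nat
  have k2: "(\<lambda>i. 2 * i) ` {..<k} \<subseteq> {..<n * n}" "inj_on (\<lambda>i. 2 * i) {..<k}" using k by (auto simp: inj_on_def)
  note u = unit_family[where g = "\<lambda>i. 2 * i", OF fam k2 k(1) A_def]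
  have iso: "mtrace (A \<alpha> * comm X (A \<beta>)) = 0" if "\<alpha> \<in> {2..Suc k}" "\<beta> \<in> {2..Suc k}" for \<alpha> \<beta>
  proof -
    define i j where "i = \<alpha> - 2" and "j = \<beta> - 2"
    have ij: "i < n * n div 2" "j < n * n div 2" using that k by (auto simp: i_def j_def)
    then have l: "2 * i < n * n" "2 * j < n * n" "2 * j + 1 < n * n" by auto
    have ne: "2 * i \<noteq> 2 * j + 1" by presburger
    have "mtrace (A \<alpha> * comm X (A \<beta>)) = e (2 * i) \<bullet> (?K *\<^sub>v e (2 * j))"
      using mtrace_mult_comm[OF matv_carrier h(2) matv_carrier, of "e (2 * i)" "e (2 * j)"]
        orthonormal_famD(1)[OF fam l(1)] orthonormal_famD(1)[OF fam l(2)]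
      by (simp add: A_def vecm_matv i_def j_def)
    also have "\<dots> = 0"
      using skew_pair(2)[OF K b ij(2)] orthonormal_famD(1)[OF fam l(1)] orthonormal_famD(1)[OF fam l(3)]
        orthonormal_famD(3)[OF fam l(1,3) ne] by (simp add: scalar_prod_smult_distrib[of _ "n * n"])
    finally show ?thesis .
  qed
  have "2 \<le> Suc k" "\<forall>\<alpha>\<in>{2..Suc k}. A \<alpha> \<in> carrier_mat n n" using k by (auto simp: A_def)
  then have "(\<Sum>\<alpha>=2..Suc k. (fnorm (comm X (A \<alpha>)))\<^sup>2)
      \<le> (Max ((\<lambda>\<alpha>. (fnorm (A \<alpha>))\<^sup>2) ` {2..Suc k})
          + (\<Sum>\<alpha>=2..Suc k. (fnorm (A \<alpha>))\<^sup>2)) * (fnorm X)\<^sup>2"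
    using assms h(1,2) u(3) iso unfolding C2_def by blast
  also have "\<dots> = real k + 1"
    by (subst u(1), subst u(2), subst h(3)) simp
  also have "(\<Sum>\<alpha>=2..Suc k. (fnorm (comm X (A \<alpha>)))\<^sup>2)
      = (\<Sum>\<alpha>=2..Suc k. gram_eigenvalue (n * n) s (2 * (\<alpha> - 2)))"
  proof (rule sum.cong[OF refl])
    fix \<alpha> assume "\<alpha> \<in> {2..Suc k}"
    then have "2 * (\<alpha> - 2) < n * n" using k2(1) by force
    then show "(fnorm (comm X (A \<alpha>)))\<^sup>2 = gram_eigenvalue (n * n) s (2 * (\<alpha> - 2))"
      using comm_matv[OF h(2)] orthonormal_famD(1)[OF fam] skew_norm_eigen[OF K b] by (simp add: A_def)
  qed
  also have "\<dots> = (\<Sum>i<k. gram_eigenvalue (n * n) s (2 * i))"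
    by (rule shift_sum[of "\<lambda>i. gram_eigenvalue (n * n) s (2 * i)"])
  finally have "2 * (\<Sum>i<k. gram_eigenvalue (n * n) s (2 * i)) \<le> 2 * real k + 2" by simp
  moreover have "(\<Sum>a<2 * k. gram_eigenvalue (n * n) s a) = 2 * (\<Sum>i<k. gram_eigenvalue (n * n) s (2 * i))"
  proof (induction k)
    case (Suc k)
    have "gram_eigenvalue (n * n) s (Suc (2 * k)) = gram_eigenvalue (n * n) s (2 * k)" by (simp add: gram_eigenvalue_def)
    then show ?case using Suc by simp
  qed simp
  ultimately show "(\<Sum>a<2 * k. gram_eigenvalue (n * n) s a) \<le> 2 * real k + 2" by simp
qed

section \<open>From one row to all pairs of commutators\<close>

text \<open>
  The first-order condition at a maximum \<open>x\<close> of a quadratic form on the simplex, in the direction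
  \<open>x - e\<^sub>\<alpha>\<close> which moves mass away from the coordinate \<open>\<alpha>\<close>.  That direction is admissible as soon as
  \<open>x \<alpha> > 0\<close>.
\<close>

lemma simplex_maximum_first_order:
  fixes C :: "nat \<Rightarrow> nat \<Rightarrow> real" and x :: "nat \<Rightarrow> real"
  assumes \<alpha>: "\<alpha> < m" and sym: "\<And>a b. C a b = C b a"
  defines "F \<equiv> \<lambda>f. \<Sum>a<m. \<Sum>b<m. C a b * f a * f b"
    and "g \<equiv> \<Sum>b<m. C \<alpha> b * x b"
  assumes max: "\<And>t. 0 < t \<Longrightarrow> t \<le> \<epsilon> \<Longrightarrow> F (\<lambda>b. (1 + t) * x b - (if b = \<alpha> then t else 0)) \<le> F x"
    and \<epsilon>: "0 < \<epsilon>"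
  shows "F x \<le> g"
proof (rule ccontr)
  assume "\<not> F x \<le> g"
  then have gap: "0 < F x - g" by simp
  have expand: "F (\<lambda>b. (1 + t) * x b - (if b = \<alpha> then t else 0))
      = (1 + t)\<^sup>2 * F x - 2 * t * (1 + t) * g + t\<^sup>2 * C \<alpha> \<alpha>" for t
  proof -
    have "F (\<lambda>b. (1 + t) * x b - (if b = \<alpha> then t else 0))
      = (\<Sum>a<m. \<Sum>b<m. (1 + t)\<^sup>2 * (C a b * x a * x b)
          - (if b = \<alpha> then t * (1 + t) * (C a b * x a) else 0)
          - (if a = \<alpha> then t * (1 + t) * (C a b * x b) else 0)
          + (if a = \<alpha> then if b = \<alpha> then t\<^sup>2 * C a b else 0 else 0))"
      unfolding F_def by (intro sum.cong refl) (auto simp: algebra_simps power2_eq_square)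
    also have "\<dots> = (1 + t)\<^sup>2 * F x - t * (1 + t) * (\<Sum>a<m. C a \<alpha> * x a)
        - t * (1 + t) * g + t\<^sup>2 * C \<alpha> \<alpha>"
    proof -
      have "(\<Sum>a<m. \<Sum>b<m. if a = \<alpha> then t * (1 + t) * (C a b * x b) else 0)
          = t * (1 + t) * g"
        using \<alpha> by (subst sum.swap) (simp add: g_def sum_distrib_left)
      moreover have "(\<Sum>a<m. \<Sum>b<m. if a = \<alpha> then if b = \<alpha> then t\<^sup>2 * C a b else 0 else 0)
          = t\<^sup>2 * C \<alpha> \<alpha>"
        using \<alpha> by (subst sum.swap) simp
      moreover have "(\<Sum>a<m. \<Sum>b<m. if b = \<alpha> then t * (1 + t) * (C a b * x a) else 0)
          = t * (1 + t) * (\<Sum>a<m. C a \<alpha> * x a)"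
        using \<alpha> by (simp add: sum_distrib_left)
      moreover have "(\<Sum>a<m. \<Sum>b<m. (1 + t)\<^sup>2 * (C a b * x a * x b)) = (1 + t)\<^sup>2 * F x"
        by (simp add: F_def sum_distrib_left)
      ultimately show ?thesis by (simp add: sum.distrib sum_subtractf)
    qed
    also have "(\<Sum>a<m. C a \<alpha> * x a) = g" unfolding g_def by (simp add: sym[of _ \<alpha>])
    finally show ?thesis by (simp add: algebra_simps)
  qed
  \<comment> \<open>an upper bound, made positive by the summand 1, for the second-order coefficient; \<open>t\<close> is then so small that the gap wins\<close>
  define D where "D = \<bar>2 * g - C \<alpha> \<alpha> - F x\<bar> + 1"
  define t where "t = min \<epsilon> ((F x - g) / D)"
  have D: "0 < D" "2 * g - C \<alpha> \<alpha> - F x \<le> D" by (auto simp: D_def)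
  have t: "0 < t" "t \<le> \<epsilon>" "t * D \<le> F x - g"
    using \<epsilon> gap D(1) by (auto simp: t_def field_simps min_def)
  have "(1 + t)\<^sup>2 * F x - 2 * t * (1 + t) * g + t\<^sup>2 * C \<alpha> \<alpha> \<le> F x"
    using max[OF t(1,2)] unfolding expand .
  then have "t * (2 * (F x - g)) \<le> t * (t * (2 * g - C \<alpha> \<alpha> - F x))"
    by (simp add: algebra_simps power2_eq_square)
  then have "2 * (F x - g) \<le> t * (2 * g - C \<alpha> \<alpha> - F x)" using t(1) by simp
  also have "\<dots> \<le> t * D" using t(1) D(2) by (intro mult_left_mono) auto
  also have "\<dots> \<le> F x - g" by (rule t(3))
  finally have "F x - g \<le> 0" by simp
  then show False using gap by simp
qed

text \<open>
  The row estimate is needed only at a maximal coordinate of the argument: at a maximum of the form on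
  the simplex, the row of any positive coordinate is at least the value of the form, so the row of the
  largest coordinate controls it.
\<close>

theorem quadratic_form_le_square_sum:
  fixes C :: "nat \<Rightarrow> nat \<Rightarrow> real"
  assumes sym: "\<And>a b. C a b = C b a"
    and bound: "\<And>x \<alpha>. \<alpha> < m \<Longrightarrow> (\<And>b. b < m \<Longrightarrow> 0 \<le> x b \<and> x b \<le> x \<alpha>) \<Longrightarrow>
      (\<Sum>b<m. C \<alpha> b * x b) \<le> (\<Sum>b<m. x b)"
    and y: "\<And>b. b < m \<Longrightarrow> 0 \<le> y b"
  shows "(\<Sum>a<m. \<Sum>b<m. C a b * y a * y b) \<le> (\<Sum>b<m. y b)\<^sup>2"
proof (cases "(\<Sum>b<m. y b) = 0")
  case True
  then have "y b = 0" if "b < m" for b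
    using sum_nonneg_eq_0_iff[of "{..<m}" y] y that by auto
  then show ?thesis by simp
next
  case False
  define Y where "Y = (\<Sum>b<m. y b)"
  have "0 \<le> Y" unfolding Y_def by (rule sum_nonneg) (use y in auto)
  then have Y: "0 < Y" using False by (simp add: Y_def)
  define F where "F f = (\<Sum>a<m. \<Sum>b<m. C a b * f a * f b)" for f
  define S where "S = {f :: nat \<Rightarrow> real. \<forall>i. f i \<in> (if i < m then {0..1} else {0})} \<inter> {f. (\<Sum>i<m. f i) = 1}"
  have S_I: "(\<lambda>i. if i < m then f i else 0) \<in> S" if f: "\<And>i. i < m \<Longrightarrow> 0 \<le> f i" "(\<Sum>i<m. f i) = 1" for f
  proof -
    have "f i \<le> 1" if "i < m" for i
      using member_le_sum[of i "{..<m}" f] f that by auto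
    then show ?thesis using f by (auto simp: S_def)
  qed
  have F_cong: "F (\<lambda>i. if i < m then f i else 0) = F f" for f
    unfolding F_def by (intro sum.cong refl) auto
  have "compact S"
    unfolding S_def
    by (intro compact_Int_closed compact_box closed_Collect_eq continuous_intros continuous_on_coordinate) auto
  moreover have yS: "(\<lambda>i. if i < m then y i / Y else 0) \<in> S"
    by (rule S_I) (use y Y in \<open>auto simp: sum_divide_distrib[symmetric] Y_def\<close>)
  moreover have "continuous_on S F"
    unfolding F_def by (intro continuous_intros continuous_on_coordinate)
  ultimately obtain x where x: "x \<in> S" "\<And>f. f \<in> S \<Longrightarrow> F f \<le> F x"
    using continuous_attains_sup[of S F] by (metis empty_iff)
  have x0: "0 \<le> x b" if "b < m" for b
  proof -
    have "x b \<in> (if b < m then {0..1} else {0})" using x(1) by (simp add: S_def)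
    then show ?thesis using that by simp
  qed
  have x1: "(\<Sum>b<m. x b) = 1" using x(1) by (simp add: S_def)
  have "m \<noteq> 0" using x1 by (intro notI) simp
  then have ne: "x ` {..<m} \<noteq> {}" by auto
  obtain \<alpha> where \<alpha>: "\<alpha> < m" "\<And>b. b < m \<Longrightarrow> x b \<le> x \<alpha>"
    using Max_in[OF _ ne] Max_ge[of "x ` {..<m}"] by (metis (no_types, lifting) finite_imageI finite_lessThan imageE image_eqI lessThan_iff)
  have pos: "0 < x \<alpha>"
  proof (rule ccontr)
    assume "\<not> 0 < x \<alpha>"
    then have "x b = 0" if "b < m" for b using \<alpha>(2)[OF that] x0[OF that] by linarith
    then show False using x1 by simp
  qed
  have "F x \<le> (\<Sum>b<m. C \<alpha> b * x b)"
    unfolding F_def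
  proof (rule simplex_maximum_first_order[OF \<alpha>(1) sym _ pos], fold F_def)
    fix t assume t: "0 < t" "t \<le> x \<alpha>"
    let ?f = "\<lambda>b. (1 + t) * x b - (if b = \<alpha> then t else 0)"
    have "(\<lambda>i. if i < m then ?f i else 0) \<in> S"
    proof (rule S_I)
      show "0 \<le> ?f i" if "i < m" for i
      proof -
        have "0 \<le> t * x i" using t x0[OF that] by simp
        moreover have "(1 + t) * x i = x i + t * x i" by (simp add: algebra_simps)
        moreover have "(if i = \<alpha> then t else 0) \<le> x i" using t(2) x0[OF that] by auto
        ultimately show ?thesis by linarith
      qed
      show "(\<Sum>i<m. ?f i) = 1"
        using \<alpha>(1) x1 by (simp add: sum_subtractf sum_distrib_left[symmetric])
    qed
    then show "F ?f \<le> F x" using x(2) F_cong by metis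
  qed
  also have "\<dots> \<le> (\<Sum>b<m. x b)" by (rule bound[OF \<alpha>(1)]) (use x0 \<alpha>(2) in auto)
  finally have "F x \<le> 1" using x1 by simp
  then have "F (\<lambda>i. y i / Y) \<le> 1" using x(2)[OF yS] F_cong[of "\<lambda>i. y i / Y"] by simp
  moreover have "F (\<lambda>i. y i / Y) = F y / Y\<^sup>2"
    by (simp add: F_def sum_divide_distrib power2_eq_square)
  ultimately show ?thesis using Y by (simp add: F_def Y_def[symmetric] divide_le_eq)
qed

lemma fnorm_square_entries:
  assumes "X \<in> carrier_mat n n"
  shows "(fnorm X)\<^sup>2 = (\<Sum>i<n. \<Sum>j<n. (X $$ (i, j))\<^sup>2)"
  unfolding fnorm_square[OF assms] vecm_scalar_prod by (simp add: power2_eq_square)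

text \<open>
  Parseval, applied to each matrix entry separately.
\<close>

lemma sum_fnorm_rotate:
  assumes v: "orthonormal_fam m m v"
    and M: "\<And>\<alpha>. \<alpha> < m \<Longrightarrow> M \<alpha> \<in> carrier_mat n n" and Z: "\<And>a. a < m \<Longrightarrow> Z a \<in> carrier_mat n n"
    and entry: "\<And>a i j. a < m \<Longrightarrow> i < n \<Longrightarrow> j < n \<Longrightarrow> Z a $$ (i, j) = (\<Sum>\<alpha><m. v a $ \<alpha> * M \<alpha> $$ (i, j))"
  shows "(\<Sum>a<m. (fnorm (Z a))\<^sup>2) = (\<Sum>\<alpha><m. (fnorm (M \<alpha>))\<^sup>2)"
proof -
  have e: "(\<Sum>a<m. (Z a $$ (i, j))\<^sup>2) = (\<Sum>\<alpha><m. (M \<alpha> $$ (i, j))\<^sup>2)" if ij: "i < n" "j < n" for i j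
  proof -
    define x where "x = vec m (\<lambda>\<alpha>. M \<alpha> $$ (i, j))"
    have x: "x \<in> carrier_vec m" by (simp add: x_def)
    have "Z a $$ (i, j) = x \<bullet> v a" if "a < m" for a
      using entry[OF that ij] carrier_vecD[OF orthonormal_famD(1)[OF v that]]
      by (simp add: x_def scalar_prod_def atLeast0LessThan mult.commute)
    then have "(\<Sum>a<m. (Z a $$ (i, j))\<^sup>2) = x \<bullet> x"
      using parseval_fam[OF v x x] by (simp add: power2_eq_square)
    also have "\<dots> = (\<Sum>\<alpha><m. (M \<alpha> $$ (i, j))\<^sup>2)"
      by (simp add: x_def scalar_prod_def atLeast0LessThan power2_eq_square)
    finally show ?thesis .
  qed
  have swap: "(\<Sum>a<m. (fnorm (Y a))\<^sup>2) = (\<Sum>i<n. \<Sum>j<n. \<Sum>a<m. (Y a $$ (i, j))\<^sup>2)"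
    if "\<And>a. a < m \<Longrightarrow> Y a \<in> carrier_mat n n" for Y
  proof -
    have "(\<Sum>a<m. (fnorm (Y a))\<^sup>2) = (\<Sum>a<m. \<Sum>i<n. \<Sum>j<n. (Y a $$ (i, j))\<^sup>2)"
      by (rule sum.cong[OF refl]) (use fnorm_square_entries that in auto)
    also have "\<dots> = (\<Sum>i<n. \<Sum>a<m. \<Sum>j<n. (Y a $$ (i, j))\<^sup>2)" by (rule sum.swap)
    also have "\<dots> = (\<Sum>i<n. \<Sum>j<n. \<Sum>a<m. (Y a $$ (i, j))\<^sup>2)"
      by (rule sum.cong[OF refl], rule sum.swap)
    finally show ?thesis .
  qed
  have "(\<Sum>a<m. (fnorm (Z a))\<^sup>2) = (\<Sum>i<n. \<Sum>j<n. \<Sum>a<m. (Z a $$ (i, j))\<^sup>2)" by (rule swap[OF Z])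
  also have "\<dots> = (\<Sum>i<n. \<Sum>j<n. \<Sum>\<alpha><m. (M \<alpha> $$ (i, j))\<^sup>2)" using e by simp
  also have "\<dots> = (\<Sum>\<alpha><m. (fnorm (M \<alpha>))\<^sup>2)" by (rule swap[OF M, symmetric])
  finally show ?thesis .
qed

lemma comm_swap:
  assumes "A \<in> carrier_mat n n" "B \<in> carrier_mat n n"
  shows "comm A B = (-1) \<cdot>\<^sub>m comm B A"
proof (rule eq_matI)
  fix i j assume "i < dim_row ((-1) \<cdot>\<^sub>m comm B A)" "j < dim_col ((-1) \<cdot>\<^sub>m comm B A)"
  then have "i < n" "j < n" using carrier_matD[OF comm_carrier[OF assms(2,1)]] by auto
  then show "comm A B $$ (i, j) = ((-1) \<cdot>\<^sub>m comm B A) $$ (i, j)"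
    using comm_entry[OF assms] comm_entry[OF assms(2,1)] carrier_matD[OF comm_carrier[OF assms(2,1)]]
    by simp
qed (use carrier_matD[OF comm_carrier[OF assms(2,1)]] carrier_matD[OF comm_carrier[OF assms]] in auto)

lemma fnorm_comm_swap:
  assumes "A \<in> carrier_mat n n" "B \<in> carrier_mat n n"
  shows "(fnorm (comm A B))\<^sup>2 = (fnorm (comm B A))\<^sup>2"
  unfolding comm_swap[OF assms] fnorm_smult[OF comm_carrier[OF assms(2,1)]] by simp

lemma comm_smult_right:
  assumes "B \<in> carrier_mat n n" "Y \<in> carrier_mat n n"
  shows "comm B (c \<cdot>\<^sub>m Y) = c \<cdot>\<^sub>m comm B Y"
proof -
  have "comm B (c \<cdot>\<^sub>m Y) = (-1) \<cdot>\<^sub>m (c \<cdot>\<^sub>m comm Y B)"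
    using comm_swap[of B n "c \<cdot>\<^sub>m Y"] comm_smult_left[OF assms(2,1)] assms by simp
  also have "\<dots> = c \<cdot>\<^sub>m ((-1) \<cdot>\<^sub>m comm Y B)" by (rule eq_matI) auto
  finally show ?thesis unfolding comm_swap[OF assms, symmetric] .
qed

text \<open>
  Makes the trilinear form \<open>Tr (A [B, Y])\<close> accessible in each argument through the first one.
\<close>

lemma mtrace_cyclic:
  assumes A: "A \<in> carrier_mat n n" and B: "B \<in> carrier_mat n n" and Y: "Y \<in> carrier_mat n n"
  shows "mtrace (A * comm B Y) = mtrace (Y * comm A B)"
proof -
  let ?K = "ad_transpose n B"
  have Kc: "?K *\<^sub>v vecm n A \<in> carrier_vec (n * n)"
    by (rule mult_mat_vec_carrier[OF ad_transpose_carrier vecm_carrier])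
  have YBA: "Y * comm B A \<in> carrier_mat n n"
    by (rule mult_carrier_mat[OF Y comm_carrier[OF B A]])
  have "mtrace (A * comm B Y) = vecm n A \<bullet> (?K *\<^sub>v vecm n Y)" by (rule mtrace_mult_comm[OF A B Y])
  also have "\<dots> = - ((?K *\<^sub>v vecm n A) \<bullet> vecm n Y)"
    using skew_scalar_prod[OF ad_transpose_carrier ad_transpose_skew[OF B] vecm_carrier vecm_carrier, of A Y]
    by simp
  also have "\<dots> = - mtrace (Y * comm B A)"
    using mtrace_mult_comm[OF Y B A] scalar_prod_comm_carrier[OF Kc vecm_carrier] by simp
  also have "\<dots> = mtrace ((-1) \<cdot>\<^sub>m (Y * comm B A))" unfolding mtrace_smult[OF YBA] by simp
  also have "(-1) \<cdot>\<^sub>m (Y * comm B A) = Y * comm A B"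
    unfolding comm_swap[OF A B]
    by (rule mult_smult_distrib[OF Y comm_carrier[OF B A], symmetric])
  finally show ?thesis .
qed

lemma mtrace_comm_smult:
  assumes A: "A \<in> carrier_mat n n" and B: "B \<in> carrier_mat n n" and Y: "Y \<in> carrier_mat n n"
    and 0: "mtrace (A * comm B Y) = 0"
  shows "mtrace ((p \<cdot>\<^sub>m A) * comm (q \<cdot>\<^sub>m B) (r \<cdot>\<^sub>m Y)) = 0"
proof -
  note C = comm_carrier[OF B Y]
  have "comm (q \<cdot>\<^sub>m B) (r \<cdot>\<^sub>m Y) = q \<cdot>\<^sub>m (r \<cdot>\<^sub>m comm B Y)"
    using comm_smult_left[OF B smult_carrier_mat[OF Y]] comm_smult_right[OF B Y] by simp
  then have "(p \<cdot>\<^sub>m A) * comm (q \<cdot>\<^sub>m B) (r \<cdot>\<^sub>m Y) = q \<cdot>\<^sub>m (r \<cdot>\<^sub>m (p \<cdot>\<^sub>m (A * comm B Y)))"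
    using A C by (simp add: mult_smult_distrib[of _ n n _ n] mult_smult_assoc_mat[of _ n n _ n])
  then show ?thesis
    using 0 mult_carrier_mat[OF A C] by (simp add: mtrace_smult[of _ n])
qed

text \<open>
  The combination \<open>\<Sum>z\<^sub>\<alpha> M\<^sub>\<alpha>\<close>, defined by entries so that it stays in the carrier also for \<open>m = 0\<close>.
\<close>

definition lincomb_mat :: "nat \<Rightarrow> nat \<Rightarrow> (nat \<Rightarrow> real mat) \<Rightarrow> real vec \<Rightarrow> real mat" where
  "lincomb_mat n m M z = mat n n (\<lambda>(i, j). \<Sum>\<alpha><m. z $ \<alpha> * M \<alpha> $$ (i, j))"

lemma lincomb_mat_carrier [simp]: "lincomb_mat n m M z \<in> carrier_mat n n"
  by (simp add: lincomb_mat_def)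

lemma mtrace_lincomb_mult:
  assumes M: "\<And>\<alpha>. \<alpha> < m \<Longrightarrow> M \<alpha> \<in> carrier_mat n n" and Y: "Y \<in> carrier_mat n n"
  shows "mtrace (lincomb_mat n m M z * Y) = (\<Sum>\<alpha><m. z $ \<alpha> * mtrace (M \<alpha> * Y))"
proof -
  have "mtrace (lincomb_mat n m M z * Y)
      = (\<Sum>i<n. \<Sum>j<n. \<Sum>\<alpha><m. z $ \<alpha> * (M \<alpha> $$ (i, j) * Y $$ (j, i)))"
    unfolding mtrace_mult[OF lincomb_mat_carrier Y] vecm_scalar_prod using Y
    by (intro sum.cong refl) (simp add: lincomb_mat_def sum_distrib_right mult.assoc)
  also have "\<dots> = (\<Sum>i<n. \<Sum>\<alpha><m. \<Sum>j<n. z $ \<alpha> * (M \<alpha> $$ (i, j) * Y $$ (j, i)))"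
    by (rule sum.cong[OF refl], rule sum.swap)
  also have "\<dots> = (\<Sum>\<alpha><m. \<Sum>i<n. \<Sum>j<n. z $ \<alpha> * (M \<alpha> $$ (i, j) * Y $$ (j, i)))"
    by (rule sum.swap)
  also have "\<dots> = (\<Sum>\<alpha><m. z $ \<alpha> * mtrace (M \<alpha> * Y))"
  proof (rule sum.cong[OF refl])
    fix \<alpha> assume "\<alpha> \<in> {..<m}"
    then show "(\<Sum>i<n. \<Sum>j<n. z $ \<alpha> * (M \<alpha> $$ (i, j) * Y $$ (j, i))) = z $ \<alpha> * mtrace (M \<alpha> * Y)"
      using mtrace_mult[OF M Y] Y by (simp add: vecm_scalar_prod sum_distrib_left)
  qed
  finally show ?thesis .
qed

lemma comm_lincomb_entry:
  assumes M: "\<And>\<alpha>. \<alpha> < m \<Longrightarrow> M \<alpha> \<in> carrier_mat n n" and Y: "Y \<in> carrier_mat n n"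
    and ij: "i < n" "j < n"
  shows "comm (lincomb_mat n m M z) Y $$ (i, j) = (\<Sum>\<alpha><m. z $ \<alpha> * comm (M \<alpha>) Y $$ (i, j))"
proof -
  have "comm (lincomb_mat n m M z) Y $$ (i, j) =
      (\<Sum>k<n. \<Sum>\<alpha><m. z $ \<alpha> * (M \<alpha> $$ (i, k) * Y $$ (k, j))) -
      (\<Sum>k<n. \<Sum>\<alpha><m. z $ \<alpha> * (Y $$ (i, k) * M \<alpha> $$ (k, j)))"
    unfolding comm_entry[OF lincomb_mat_carrier Y ij]
    using ij by (simp add: lincomb_mat_def sum_distrib_right sum_distrib_left mult_ac)
  also have "\<dots> = (\<Sum>\<alpha><m. \<Sum>k<n. z $ \<alpha> * (M \<alpha> $$ (i, k) * Y $$ (k, j))) -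
      (\<Sum>\<alpha><m. \<Sum>k<n. z $ \<alpha> * (Y $$ (i, k) * M \<alpha> $$ (k, j)))"
    by (intro arg_cong2[where f = "(-)"] sum.swap)
  also have "\<dots> = (\<Sum>\<alpha><m. z $ \<alpha> * comm (M \<alpha>) Y $$ (i, j))"
    unfolding sum_subtractf[symmetric]
    by (intro sum.cong refl)
      (simp add: comm_entry[OF M Y ij] sum_distrib_left right_diff_distrib sum_subtractf)
  finally show ?thesis .
qed

lemma transpose_smult_mat: "transpose_mat (c \<cdot>\<^sub>m A) = c \<cdot>\<^sub>m transpose_mat A"
  by (rule eq_matI) auto

text \<open>
  Apply \<open>C2\<close> to \<open>W \<alpha>\<close> and the rescaled matrices \<open>sqrt (x b) W b\<close> with \<open>b \<noteq> \<alpha>\<close>.  Their maximal squared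
  norm is at most \<open>x \<alpha>\<close>, which is just what the sum over \<open>b \<noteq> \<alpha>\<close> leaves out.
\<close>

lemma C2_orthogonal_row_bound:
  fixes W :: "nat \<Rightarrow> real mat"
  assumes C2 "2 \<le> n" and W: "\<And>a. a < m \<Longrightarrow> W a \<in> carrier_mat n n"
    and orth: "\<And>a b. a < m \<Longrightarrow> b < m \<Longrightarrow> a \<noteq> b \<Longrightarrow> mtrace (W a * transpose_mat (W b)) = 0"
    and tri: "\<And>a b c. a < m \<Longrightarrow> b < m \<Longrightarrow> c < m \<Longrightarrow> mtrace (W a * comm (W b) (W c)) = 0"
    and norm: "\<And>a. a < m \<Longrightarrow> (fnorm (W a))\<^sup>2 \<le> 1"
    and \<alpha>: "\<alpha> < m" and x: "\<And>b. b < m \<Longrightarrow> 0 \<le> x b \<and> x b \<le> x \<alpha>"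
  shows "(\<Sum>b<m. (fnorm (comm (W \<alpha>) (W b)))\<^sup>2 * x b) \<le> (\<Sum>b<m. x b)"
proof -
  \<comment> \<open>the zero at \<open>\<alpha>\<close> removes \<open>W \<alpha>\<close> from the family without renumbering it\<close>
  define c where "c b = (if b = \<alpha> then 0 else sqrt (x b))" for b
  define A where "A \<gamma> = c (\<gamma> - 2) \<cdot>\<^sub>m W (\<gamma> - 2)" for \<gamma> :: nat
  have less: "\<gamma> - 2 < m" if "\<gamma> \<in> {2..Suc m}" for \<gamma> using that by auto
  have c2: "(c b)\<^sup>2 = (if b = \<alpha> then 0 else x b)" if "b < m" for b using x[OF that] by (simp add: c_def)
  have A: "A \<gamma> \<in> carrier_mat n n" if "\<gamma> \<in> {2..Suc m}" for \<gamma> using W[OF less[OF that]] by (simp add: A_def)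
  have normA: "(fnorm (A \<gamma>))\<^sup>2 \<le> (c (\<gamma> - 2))\<^sup>2" if "\<gamma> \<in> {2..Suc m}" for \<gamma>
    unfolding A_def fnorm_smult[OF W[OF less[OF that]]]
    using mult_left_mono[OF norm[OF less[OF that]], of "(c (\<gamma> - 2))\<^sup>2"] by simp
  have "mtrace (A \<gamma> * transpose_mat (A \<delta>)) = 0" if "\<gamma> \<in> {2..Suc m}" "\<delta> \<in> {2..Suc m}" "\<gamma> \<noteq> \<delta>" for \<gamma> \<delta>
  proof -
    note l = less[OF that(1)] less[OF that(2)]
    have "\<gamma> - 2 \<noteq> \<delta> - 2" using that by auto
    moreover have "A \<gamma> * transpose_mat (A \<delta>) = c (\<delta> - 2) \<cdot>\<^sub>m (c (\<gamma> - 2) \<cdot>\<^sub>m (W (\<gamma> - 2) * transpose_mat (W (\<delta> - 2))))"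
      using W[OF l(1)] W[OF l(2)]
      by (simp add: A_def transpose_smult_mat mult_smult_distrib[of _ n n _ n] mult_smult_assoc_mat[of _ n n _ n])
    moreover have "W (\<gamma> - 2) * transpose_mat (W (\<delta> - 2)) \<in> carrier_mat n n"
      using W[OF l(1)] W[OF l(2)] by (intro mult_carrier_mat[of _ n n]) auto
    ultimately show ?thesis using orth[OF l] by (simp add: mtrace_smult[of _ n])
  qed
  moreover have "mtrace (A \<gamma> * comm (W \<alpha>) (A \<delta>)) = 0" if "\<gamma> \<in> {2..Suc m}" "\<delta> \<in> {2..Suc m}" for \<gamma> \<delta>
  proof -
    note l = less[OF that(1)] less[OF that(2)]
    have "1 \<cdot>\<^sub>m W \<alpha> = W \<alpha>" by (rule eq_matI) auto
    then show ?thesis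
      using mtrace_comm_smult[OF W[OF l(1)] W[OF \<alpha>] W[OF l(2)] tri[OF l(1) \<alpha> l(2)], of _ 1]
      by (simp add: A_def)
  qed
  moreover have m: "2 \<le> Suc m" using \<alpha> by simp
  ultimately have "(\<Sum>\<gamma>=2..Suc m. (fnorm (comm (W \<alpha>) (A \<gamma>)))\<^sup>2)
      \<le> (Max ((\<lambda>\<gamma>. (fnorm (A \<gamma>))\<^sup>2) ` {2..Suc m}) + (\<Sum>\<gamma>=2..Suc m. (fnorm (A \<gamma>))\<^sup>2)) * (fnorm (W \<alpha>))\<^sup>2"
    using \<open>C2\<close> \<open>2 \<le> n\<close> W[OF \<alpha>] A unfolding C2_def by blast
  also have "\<dots> \<le> (x \<alpha> + (\<Sum>b<m. (c b)\<^sup>2)) * 1"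
  proof (intro mult_mono add_mono norm[OF \<alpha>])
    have "(fnorm (A \<gamma>))\<^sup>2 \<le> x \<alpha>" if "\<gamma> \<in> {2..Suc m}" for \<gamma>
      using normA[OF that] c2[OF less[OF that]] x[OF less[OF that]] x[OF \<alpha>] by (auto split: if_splits)
    then show "Max ((\<lambda>\<gamma>. (fnorm (A \<gamma>))\<^sup>2) ` {2..Suc m}) \<le> x \<alpha>" using m by (subst Max_le_iff) auto
    have "(\<Sum>\<gamma>=2..Suc m. (fnorm (A \<gamma>))\<^sup>2) \<le> (\<Sum>\<gamma>=2..Suc m. (c (\<gamma> - 2))\<^sup>2)"
      by (rule sum_mono) (rule normA)
    also have "\<dots> = (\<Sum>b<m. (c b)\<^sup>2)" by (rule shift_sum)
    finally show "(\<Sum>\<gamma>=2..Suc m. (fnorm (A \<gamma>))\<^sup>2) \<le> (\<Sum>b<m. (c b)\<^sup>2)" .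
    show "0 \<le> x \<alpha> + (\<Sum>b<m. (c b)\<^sup>2)" using x[OF \<alpha>] by (simp add: sum_nonneg)
  qed simp
  also have "(\<Sum>b<m. (c b)\<^sup>2) = (\<Sum>b<m. x b - (if b = \<alpha> then x \<alpha> else 0))"
    by (rule sum.cong) (use c2 in auto)
  also have "\<dots> = (\<Sum>b<m. x b) - x \<alpha>" using \<alpha> by (simp add: sum_subtractf)
  also have "(\<Sum>\<gamma>=2..Suc m. (fnorm (comm (W \<alpha>) (A \<gamma>)))\<^sup>2)
      = (\<Sum>\<gamma>=2..Suc m. (fnorm (comm (W \<alpha>) (W (\<gamma> - 2))))\<^sup>2 * x (\<gamma> - 2))"
  proof (rule sum.cong[OF refl])
    fix \<gamma> assume g: "\<gamma> \<in> {2..Suc m}"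
    have "(fnorm (comm (W \<alpha>) (W \<alpha>)))\<^sup>2 = 0"
    proof -
      have "comm (W \<alpha>) (W \<alpha>) = 0 \<cdot>\<^sub>m comm (W \<alpha>) (W \<alpha>)"
        by (rule eq_matI) (use W[OF \<alpha>] in \<open>auto simp: comm_def\<close>)
      then show ?thesis using fnorm_smult[OF comm_carrier[OF W[OF \<alpha>] W[OF \<alpha>]], of 0] by simp
    qed
    then show "(fnorm (comm (W \<alpha>) (A \<gamma>)))\<^sup>2 = (fnorm (comm (W \<alpha>) (W (\<gamma> - 2))))\<^sup>2 * x (\<gamma> - 2)"
      unfolding A_def comm_smult_right[OF W[OF \<alpha>] W[OF less[OF g]]]
        fnorm_smult[OF comm_carrier[OF W[OF \<alpha>] W[OF less[OF g]]]] c2[OF less[OF g]]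
      by auto
  qed
  also have "\<dots> = (\<Sum>b<m. (fnorm (comm (W \<alpha>) (W b)))\<^sup>2 * x b)"
    by (rule shift_sum[of "\<lambda>b. (fnorm (comm (W \<alpha>) (W b)))\<^sup>2 * x b"])
  finally show ?thesis by simp
qed

text \<open>
  With the normalized matrices \<open>E a\<close> fixed, the left side is a quadratic form in the squared norms.
\<close>

lemma C2_orthogonal_imp_C1_bound:
  fixes W :: "nat \<Rightarrow> real mat"
  assumes C2 "2 \<le> n" and W: "\<And>a. a < m \<Longrightarrow> W a \<in> carrier_mat n n"
    and orth: "\<And>a b. a < m \<Longrightarrow> b < m \<Longrightarrow> a \<noteq> b \<Longrightarrow> mtrace (W a * transpose_mat (W b)) = 0"
    and tri: "\<And>a b c. a < m \<Longrightarrow> b < m \<Longrightarrow> c < m \<Longrightarrow> mtrace (W a * comm (W b) (W c)) = 0"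
  shows "(\<Sum>a<m. \<Sum>b<m. (fnorm (comm (W a) (W b)))\<^sup>2) \<le> (\<Sum>a<m. (fnorm (W a))\<^sup>2)\<^sup>2"
proof -
  define E where "E a = (1 / fnorm (W a)) \<cdot>\<^sub>m W a" for a
  define C where "C a b = (if a < m \<and> b < m then (fnorm (comm (E a) (E b)))\<^sup>2 else 0)" for a b
  have E: "E a \<in> carrier_mat n n" if "a < m" for a using W[OF that] by (simp add: E_def)
  have WE: "W a = fnorm (W a) \<cdot>\<^sub>m E a" if "a < m" for a
  proof (cases "fnorm (W a) = 0")
    case True
    then show ?thesis using fnorm_0D[OF W[OF that] True] by (auto simp: E_def intro!: eq_matI)
  next
    case False
    then show ?thesis by (intro eq_matI) (auto simp: E_def)
  qed
  have "mtrace (E a * transpose_mat (E b)) = 0" if ab: "a < m" "b < m" "a \<noteq> b" for a b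
  proof -
    have "E a * transpose_mat (E b) = (1 / fnorm (W b)) \<cdot>\<^sub>m ((1 / fnorm (W a)) \<cdot>\<^sub>m (W a * transpose_mat (W b)))"
      using W[OF ab(1)] W[OF ab(2)]
      by (simp add: E_def transpose_smult_mat mult_smult_distrib[of _ n n _ n] mult_smult_assoc_mat[of _ n n _ n])
    moreover have "W a * transpose_mat (W b) \<in> carrier_mat n n"
      using W[OF ab(1)] W[OF ab(2)] by (intro mult_carrier_mat[of _ n n]) auto
    ultimately show ?thesis using orth[OF ab] by (simp add: mtrace_smult[of _ n])
  qed
  moreover have "mtrace (E a * comm (E b) (E c)) = 0" if "a < m" "b < m" "c < m" for a b c
    unfolding E_def by (rule mtrace_comm_smult[OF W[OF that(1)] W[OF that(2)] W[OF that(3)] tri[OF that]])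
  moreover have "(fnorm (E a))\<^sup>2 \<le> 1" if "a < m" for a
    unfolding E_def fnorm_smult[OF W[OF that]] by (simp add: power_divide)
  ultimately have row: "(\<Sum>b<m. (fnorm (comm (E \<alpha>) (E b)))\<^sup>2 * x b) \<le> (\<Sum>b<m. x b)"
    if "\<alpha> < m" "\<And>b. b < m \<Longrightarrow> 0 \<le> x b \<and> x b \<le> x \<alpha>" for \<alpha> and x :: "nat \<Rightarrow> real"
    using C2_orthogonal_row_bound[OF assms(1,2), of m E \<alpha> x] E that by blast
  have "(\<Sum>a<m. \<Sum>b<m. (fnorm (comm (W a) (W b)))\<^sup>2)
      = (\<Sum>a<m. \<Sum>b<m. C a b * (fnorm (W a))\<^sup>2 * (fnorm (W b))\<^sup>2)"
  proof (intro sum.cong refl)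
    fix a b assume "a \<in> {..<m}" "b \<in> {..<m}"
    then have ab: "a < m" "b < m" by auto
    have "comm (W a) (W b) = fnorm (W a) \<cdot>\<^sub>m (fnorm (W b) \<cdot>\<^sub>m comm (E a) (E b))"
      using comm_smult_left[OF E[OF ab(1)] smult_carrier_mat[OF E[OF ab(2)]], of "fnorm (W a)" "fnorm (W b)"]
        comm_smult_right[OF E[OF ab(1)] E[OF ab(2)], of "fnorm (W b)"] WE[OF ab(1)] WE[OF ab(2)] by simp
    then show "(fnorm (comm (W a) (W b)))\<^sup>2 = C a b * (fnorm (W a))\<^sup>2 * (fnorm (W b))\<^sup>2"
      using ab comm_carrier[OF E[OF ab(1)] E[OF ab(2)]] by (simp add: fnorm_smult[of _ n] C_def)
  qed
  also have "\<dots> \<le> (\<Sum>a<m. (fnorm (W a))\<^sup>2)\<^sup>2"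
  proof (rule quadratic_form_le_square_sum)
    show "C a b = C b a" for a b using fnorm_comm_swap[OF E E, of a b] by (auto simp: C_def)
    show "(\<Sum>b<m. C \<alpha> b * x b) \<le> (\<Sum>b<m. x b)"
      if "\<alpha> < m" "\<And>b. b < m \<Longrightarrow> 0 \<le> x b \<and> x b \<le> x \<alpha>" for x \<alpha>
      using row[of \<alpha> x] that by (simp add: C_def)
  qed simp
  finally show ?thesis .
qed

text \<open>
  The eigenvectors \<open>v a\<close> of the Gram matrix give an orthogonal change of the tuple after which its
  members \<open>W a\<close> are mutually orthogonal.  Both sides of the inequality are invariant under it, and the
  trilinear condition survives because it holds on the span.
\<close>

lemma C2_imp_C1:
  assumes C2
  shows C1
  unfolding C1_def
proof (intro allI impI)
  fix n m :: nat and B :: "nat \<Rightarrow> real mat"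
  assume n: "2 \<le> n" and "1 \<le> m" and B0: "\<forall>\<alpha>\<in>{1..m}. B \<alpha> \<in> carrier_mat n n"
    and tri0: "\<forall>\<alpha>\<in>{1..m}. \<forall>\<beta>\<in>{1..m}. \<forall>\<gamma>\<in>{1..m}. mtrace (B \<alpha> * comm (B \<gamma>) (B \<beta>)) = 0"
  define M where "M \<alpha> = B (Suc \<alpha>)" for \<alpha>
  have M: "M \<alpha> \<in> carrier_mat n n" if "\<alpha> < m" for \<alpha> using B0 that by (simp add: M_def)
  have triM: "mtrace (M \<alpha> * comm (M \<beta>) (M \<gamma>)) = 0" if "\<alpha> < m" "\<beta> < m" "\<gamma> < m" for \<alpha> \<beta> \<gamma>
    using tri0 that by (simp add: M_def)
  define G where "G = mat m m (\<lambda>(\<alpha>, \<beta>). mtrace (M \<alpha> * transpose_mat (M \<beta>)))"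
  have G: "G \<in> carrier_mat m m" by (simp add: G_def)
  have "transpose_mat G = G"
  proof (rule eq_matI)
    fix \<alpha> \<beta> assume "\<alpha> < dim_row G" "\<beta> < dim_col G"
    then have ab: "\<alpha> < m" "\<beta> < m" using G by auto
    then show "transpose_mat G $$ (\<alpha>, \<beta>) = G $$ (\<alpha>, \<beta>)"
      using mtrace_mult_transpose[OF M[OF ab(1)] M[OF ab(2)]] mtrace_mult_transpose[OF M[OF ab(2)] M[OF ab(1)]]
        scalar_prod_comm_carrier[OF vecm_carrier vecm_carrier]
      by (simp add: G_def)
  qed (use G in auto)
  then obtain v \<nu> where v: "orthonormal_fam m m v" and ev: "\<And>a. a < m \<Longrightarrow> G *\<^sub>v v a = \<nu> a \<cdot>\<^sub>v v a"
    using symmetric_eigenbasis[OF G] by blast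
  have vdim: "dim_vec (v a) = m" if "a < m" for a using orthonormal_famD(1)[OF v that] by auto
  define W where "W a = lincomb_mat n m M (v a)" for a
  have W: "W a \<in> carrier_mat n n" for a by (simp add: W_def)
  have W_entry: "W a $$ (i, j) = (\<Sum>\<alpha><m. v a $ \<alpha> * M \<alpha> $$ (i, j))" if "i < n" "j < n" for a i j
    using that by (simp add: W_def lincomb_mat_def)
  have mtW: "mtrace (W a * Y) = (\<Sum>\<alpha><m. v a $ \<alpha> * mtrace (M \<alpha> * Y))" if "Y \<in> carrier_mat n n" for a Y
    unfolding W_def by (rule mtrace_lincomb_mult[OF M that])
  have orth: "mtrace (W a * transpose_mat (W b)) = 0" if ab: "a < m" "b < m" "a \<noteq> b" for a b
  proof -
    have sw: "mtrace (X * transpose_mat Y) = mtrace (Y * transpose_mat X)"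
      if "X \<in> carrier_mat n n" "Y \<in> carrier_mat n n" for X Y
      unfolding mtrace_mult_transpose[OF that] mtrace_mult_transpose[OF that(2,1)]
      by (rule scalar_prod_comm_carrier[OF vecm_carrier vecm_carrier])
    have "mtrace (W a * transpose_mat (W b)) = (\<Sum>\<alpha><m. v a $ \<alpha> * (G *\<^sub>v v b) $ \<alpha>)"
    proof -
      have "mtrace (M \<alpha> * transpose_mat (W b)) = (G *\<^sub>v v b) $ \<alpha>" if al: "\<alpha> < m" for \<alpha>
      proof -
        have "mtrace (M \<alpha> * transpose_mat (W b)) = mtrace (W b * transpose_mat (M \<alpha>))"
          by (rule sw[OF M[OF al] W])
        also have "\<dots> = (\<Sum>\<beta><m. v b $ \<beta> * mtrace (M \<beta> * transpose_mat (M \<alpha>)))"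
          by (rule mtW) (use M[OF al] in simp)
        also have "\<dots> = (\<Sum>\<beta><m. G $$ (\<alpha>, \<beta>) * v b $ \<beta>)"
          by (rule sum.cong[OF refl]) (use al sw[OF M M] in \<open>simp add: G_def\<close>)
        also have "\<dots> = (G *\<^sub>v v b) $ \<alpha>"
          using G al vdim[OF ab(2)] by (simp add: scalar_prod_def atLeast0LessThan)
        finally show ?thesis .
      qed
      then show ?thesis using mtW[of "transpose_mat (W b)" a] W by simp
    qed
    also have "\<dots> = v a \<bullet> (G *\<^sub>v v b)" using G by (simp add: scalar_prod_def atLeast0LessThan)
    also have "\<dots> = 0"
      using ev[OF ab(2)] orthonormal_famD(1)[OF v ab(1)] orthonormal_famD(1)[OF v ab(2)] orthonormal_famD(3)[OF v ab]
      by (simp add: scalar_prod_smult_distrib[of _ m])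
    finally show ?thesis .
  qed
  have tri: "mtrace (W a * comm (W b) (W c)) = 0" for a b c
  proof -
    have 1: "mtrace (W a * comm X Y) = 0"
      if X: "X \<in> carrier_mat n n" and Y: "Y \<in> carrier_mat n n"
        and z: "\<And>\<alpha>. \<alpha> < m \<Longrightarrow> mtrace (M \<alpha> * comm X Y) = 0" for a X Y
      using mtW[OF comm_carrier[OF X Y]] z by simp
    have 2: "mtrace (W b * comm (M \<beta>) (M \<gamma>)) = 0" if "\<beta> < m" "\<gamma> < m" for b \<beta> \<gamma>
      by (rule 1[OF M M]) (use that triM in auto)
    have 3: "mtrace (W c * comm (W b) (M \<gamma>)) = 0" if "\<gamma> < m" for b c \<gamma>
    proof (rule 1[OF W M[OF that]])
      fix \<alpha> assume al: "\<alpha> < m"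
      show "mtrace (M \<alpha> * comm (W b) (M \<gamma>)) = 0"
        using mtrace_cyclic[OF M[OF al] W M[OF that]] mtrace_cyclic[OF M[OF that] M[OF al] W] 2[OF that al] by simp
    qed
    show ?thesis
    proof (rule 1[OF W W])
      fix \<alpha> assume al: "\<alpha> < m"
      show "mtrace (M \<alpha> * comm (W b) (W c)) = 0"
        using mtrace_cyclic[OF M[OF al] W W] mtrace_cyclic[OF W M[OF al] W] 3[OF al] by simp
    qed
  qed
  have norms: "(\<Sum>a<m. (fnorm (W a))\<^sup>2) = (\<Sum>\<alpha><m. (fnorm (M \<alpha>))\<^sup>2)"
    by (rule sum_fnorm_rotate[OF v M W W_entry])
  have rot: "(\<Sum>a<m. (fnorm (comm (W a) Y))\<^sup>2) = (\<Sum>\<alpha><m. (fnorm (comm (M \<alpha>) Y))\<^sup>2)"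
    if Y: "Y \<in> carrier_mat n n" for Y
    by (rule sum_fnorm_rotate[OF v comm_carrier[OF M Y] comm_carrier[OF W Y]])
      (simp_all add: W_def comm_lincomb_entry[OF M Y])
  have "(\<Sum>a<m. \<Sum>b<m. (fnorm (comm (M a) (M b)))\<^sup>2) = (\<Sum>b<m. \<Sum>a<m. (fnorm (comm (M a) (M b)))\<^sup>2)"
    by (rule sum.swap)
  also have "\<dots> = (\<Sum>b<m. \<Sum>a<m. (fnorm (comm (W a) (M b)))\<^sup>2)"
    by (rule sum.cong[OF refl]) (use rot[OF M] in auto)
  also have "\<dots> = (\<Sum>a<m. \<Sum>b<m. (fnorm (comm (W a) (M b)))\<^sup>2)" by (rule sum.swap)
  also have "\<dots> = (\<Sum>a<m. \<Sum>b<m. (fnorm (comm (M b) (W a)))\<^sup>2)"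
    by (intro sum.cong refl) (use fnorm_comm_swap[OF W M] in auto)
  also have "\<dots> = (\<Sum>a<m. \<Sum>b<m. (fnorm (comm (W b) (W a)))\<^sup>2)"
    by (rule sum.cong[OF refl]) (use rot[OF W] in auto)
  also have "\<dots> \<le> (\<Sum>a<m. (fnorm (W a))\<^sup>2)\<^sup>2"
    unfolding sum.swap[of "\<lambda>a b. (fnorm (comm (W b) (W a)))\<^sup>2"]
    by (rule C2_orthogonal_imp_C1_bound[OF assms n W orth tri])
  also have "\<dots> = (\<Sum>\<alpha><m. (fnorm (M \<alpha>))\<^sup>2)\<^sup>2" by (simp add: norms)
  finally show "(\<Sum>\<alpha>=1..m. \<Sum>\<beta>=1..m. (fnorm (comm (B \<alpha>) (B \<beta>)))\<^sup>2) \<le> (\<Sum>\<alpha>=1..m. (fnorm (B \<alpha>))\<^sup>2)\<^sup>2"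
    by (simp add: M_def sum.atLeast1_atMost_eq)
qed

section \<open>The equivalences\<close>

theorem theorem1p1:
  shows "((C2 \<longleftrightarrow> C4) \<and> (C4 \<longleftrightarrow> C5) \<and> (C5 \<longleftrightarrow> C6)) \<and>
         (C2 \<or> C4 \<or> C5 \<or> C6 \<longrightarrow> C1 \<and> C3)"
  using C2_imp_C4 C4_imp_C2 C4_iff_C5 C4_imp_C6 C6_imp_C4 C4_imp_C3 C2_imp_C1 by blast

end
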